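(* There is a randomized algorithm that, given an undirected graph $G$ on $n$ vertices together with an elimination forest of $G$ of depth $d$, and a number $k\in\mathbb{N}$, solves each of the problems \textsc{Hamiltonian Cycle}, \textsc{Hamiltonian Path}, \textsc{$k$-Cycle}, \textsc{$k$-Path} and \textsc{Min Cycle Cover} in time $5^{d}\cdot n^{\mathcal{O}(1)}$ and using polynomial space. The algorithm has one-sided error: it may give false negatives (report "no" on a yes-instance) with probability at most $\frac{1}{2}$, and never gives false positives.
   Context: A rooted forest is a directed acyclic graph in which every vertex has outdegree at most $1$ (the out-neighbour is the parent); $u$ is an ancestor of $v$ (and $v$ a descendant of $u$) if $u$ is reachable from $v$ by a directed path (every vertex is its own ancestor). The depth of a rooted forest is the maximum number of vertices on a directed path. An elimination forest of a graph $G$ is a rooted forest on vertex set $V(G)$ such that for every edge $uv$ of $G$, $u$ is an ancestor of $v$ or $v$ is an ancestor of $u$. Problems: \textsc{Hamiltonian Cycle}: is there a simple cycle visiting all vertices of $G$? \textsc{Hamiltonian Path}: is there a simple path visiting all vertices of $G$? \textsc{$k$-Cycle}: is there a simple cycle of length $k$ in $G$? \textsc{$k$-Path}: is there a simple path on $k$ vertices in $G$? \textsc{Min Cycle Cover}: can the vertices of $G$ be covered by at most $k$ vertex-disjoint cycles? *)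

theory Defs
  imports
    "HOL-Probability.Probability_Mass_Function"
    "HOL-Computational_Algebra.Polynomial"
    "HOL-Library.Log_Nat"
begin

section \<open>Graphs, paths and cycles\<close>

definition simple_graph :: "'a set \<Rightarrow> 'a set set \<Rightarrow> bool" where
  "simple_graph V E \<longleftrightarrow> finite V \<and> (\<forall>e\<in>E. e \<subseteq> V \<and> card e = 2)"

text \<open>Paths and cycles are given by the list of their vertices. A path has at least one vertex,
  a cycle at least three; the length of a cycle is its number of vertices.\<close>

definition simple_path :: "'a set \<Rightarrow> 'a set set \<Rightarrow> 'a list \<Rightarrow> bool" where
  "simple_path V E p \<longleftrightarrow>
     p \<noteq> [] \<and> set p \<subseteq> V \<and> distinct p \<and> successively (\<lambda>u v. {u, v} \<in> E) p"

definition simple_cycle :: "'a set \<Rightarrow> 'a set set \<Rightarrow> 'a list \<Rightarrow> bool" where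
  "simple_cycle V E p \<longleftrightarrow> simple_path V E p \<and> 3 \<le> length p \<and> {last p, hd p} \<in> E"

section \<open>Elimination forests\<close>

text \<open>A rooted forest is given by its set of arcs (child, parent).\<close>

definition rooted_forest :: "'a set \<Rightarrow> ('a \<times> 'a) set \<Rightarrow> bool" where
  "rooted_forest V F \<longleftrightarrow> F \<subseteq> V \<times> V \<and> acyclic F \<and> single_valued F"

definition ancestor :: "('a \<times> 'a) set \<Rightarrow> 'a \<Rightarrow> 'a \<Rightarrow> bool" where
  "ancestor F u v \<longleftrightarrow> (v, u) \<in> F\<^sup>*"

text \<open>The empty list is admitted as a directed path, so that the empty forest has depth 0.\<close>

definition forest_depth :: "'a set \<Rightarrow> ('a \<times> 'a) set \<Rightarrow> nat" where
  "forest_depth V F =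
     Max {length p | p. set p \<subseteq> V \<and> distinct p \<and> successively (\<lambda>u v. (u, v) \<in> F) p}"

definition elimination_forest :: "'a set \<Rightarrow> 'a set set \<Rightarrow> ('a \<times> 'a) set \<Rightarrow> bool" where
  "elimination_forest V E F \<longleftrightarrow>
     rooted_forest V F \<and> (\<forall>u v. {u, v} \<in> E \<longrightarrow> ancestor F u v \<or> ancestor F v u)"

section \<open>The decision problems\<close>

text \<open>A problem is a predicate of the vertex set, the edge set and the number \<open>k\<close>, which the
  two Hamiltonicity problems ignore.\<close>

type_synonym 'a problem = "'a set \<Rightarrow> 'a set set \<Rightarrow> nat \<Rightarrow> bool"

definition hamiltonian_cycle :: "'a problem" where
  "hamiltonian_cycle V E k \<longleftrightarrow> (\<exists>p. simple_cycle V E p \<and> set p = V)"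

definition hamiltonian_path :: "'a problem" where
  "hamiltonian_path V E k \<longleftrightarrow> (\<exists>p. simple_path V E p \<and> set p = V)"

definition k_cycle :: "'a problem" where
  "k_cycle V E k \<longleftrightarrow> (\<exists>p. simple_cycle V E p \<and> length p = k)"

definition k_path :: "'a problem" where
  "k_path V E k \<longleftrightarrow> (\<exists>p. simple_path V E p \<and> length p = k)"

definition min_cycle_cover :: "'a problem" where
  "min_cycle_cover V E k \<longleftrightarrow>
     (\<exists>C. finite C \<and> card C \<le> k \<and> (\<forall>p\<in>C. simple_cycle V E p) \<and>
          pairwise (\<lambda>p q. disjnt (set p) (set q)) C \<and> (\<Union>p\<in>C. set p) = V)"

section \<open>Probabilistic random access machines\<close>

text \<open>A program works on registers and on an indirectly addressed memory, both holding natural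
  numbers, and may toss fair coins. The arithmetic operations are addition and truncated
  subtraction; a test succeeds iff the expression is nonzero.\<close>

type_synonym state = "(nat \<Rightarrow> nat) \<times> (nat \<Rightarrow> nat)"

datatype aexp = Const nat | Reg nat | Load aexp | Add aexp aexp | Sub aexp aexp

primrec aval :: "aexp \<Rightarrow> state \<Rightarrow> nat" where
  "aval (Const i) s = i"
| "aval (Reg r) s = fst s r"
| "aval (Load a) s = snd s (aval a s)"
| "aval (Add a b) s = aval a s + aval b s"
| "aval (Sub a b) s = aval a s - aval b s"

datatype com =
    Skip
  | Assign nat aexp
  | Store aexp aexp
  | Toss nat
  | Seq com com
  | Cond aexp com com
  | While aexp com

primrec step :: "com \<Rightarrow> state \<Rightarrow> (com \<times> state) pmf" where
  "step Skip s = return_pmf (Skip, s)"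
| "step (Assign r a) s = return_pmf (Skip, ((fst s)(r := aval a s), snd s))"
| "step (Store a b) s = return_pmf (Skip, (fst s, (snd s)(aval a s := aval b s)))"
| "step (Toss r) s =
     map_pmf (\<lambda>b. (Skip, ((fst s)(r := of_bool b), snd s))) (bernoulli_pmf (1 / 2))"
| "step (Seq c1 c2) s =
     (if c1 = Skip then return_pmf (c2, s)
      else map_pmf (\<lambda>(c1', s'). (Seq c1' c2, s')) (step c1 s))"
| "step (Cond a c1 c2) s = return_pmf (if aval a s \<noteq> 0 then c1 else c2, s)"
| "step (While a c) s = return_pmf (if aval a s \<noteq> 0 then Seq c (While a c) else Skip, s)"

text \<open>The distribution of the configuration after \<open>t\<close> steps. The program has halted iff the
  remaining command is \<^const>\<open>Skip\<close>.\<close>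

primrec run :: "com \<Rightarrow> state \<Rightarrow> nat \<Rightarrow> (com \<times> state) pmf" where
  "run c s 0 = return_pmf (c, s)"
| "run c s (Suc t) = bind_pmf (run c s t) (\<lambda>(c', s'). step c' s')"

text \<open>Space is the number of bits of the nonzero cells, addresses included. Every state reachable
  from an input has only finitely many nonzero cells, so these sums are genuine.
  Time is the number of steps, at unit cost; it is only ever bounded together with
  the space, so the numbers operated on in a single step have a bounded number of bits.\<close>

definition cells_space :: "(nat \<Rightarrow> nat) \<Rightarrow> nat" where
  "cells_space f = (\<Sum>i | f i \<noteq> 0. floorlog 2 i + floorlog 2 (f i))"

definition space_of :: "state \<Rightarrow> nat" where
  "space_of s = cells_space (fst s) + cells_space (snd s)"

definition answers_yes :: "com \<times> state \<Rightarrow> bool" where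
  "answers_yes cs \<longleftrightarrow> fst cs = Skip \<and> fst (snd cs) 0 \<noteq> 0"

text \<open>On input \<open>s\<close>, whatever the coin tosses, \<open>P\<close> halts within \<open>T\<close> steps and never uses more
  than \<open>S\<close> bits; it decides whether \<open>yes\<close> holds with one-sided error.\<close>

definition decides_one_sided :: "com \<Rightarrow> state \<Rightarrow> bool \<Rightarrow> nat \<Rightarrow> nat \<Rightarrow> bool" where
  "decides_one_sided P s yes T S \<longleftrightarrow>
     (\<forall>cs\<in>set_pmf (run P s T). fst cs = Skip) \<and>
     (\<forall>t. \<forall>cs\<in>set_pmf (run P s t). space_of (snd cs) \<le> S) \<and>
     (yes \<longrightarrow> measure_pmf.prob (run P s T) {cs. \<not> answers_yes cs} \<le> 1 / 2) \<and>
     (\<not> yes \<longrightarrow> (\<forall>cs\<in>set_pmf (run P s T). \<not> answers_yes cs))"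

text \<open>Encoding of a graph on the vertices \<open>0, \<dots>, n - 1\<close>, an elimination forest and \<open>k\<close>:
  registers 0 and 1 hold \<open>n\<close> and \<open>k\<close>; the memory holds the parent array (0 for a root,
  otherwise the successor of the parent), followed by the rows of the adjacency matrix.\<close>

definition parent_code :: "(nat \<times> nat) set \<Rightarrow> nat \<Rightarrow> nat" where
  "parent_code F v = (if v \<in> Domain F then Suc (THE u. (v, u) \<in> F) else 0)"

definition input_state :: "nat \<Rightarrow> nat set set \<Rightarrow> (nat \<times> nat) set \<Rightarrow> nat \<Rightarrow> state" where
  "input_state n E F k =
     ((\<lambda>_. 0)(0 := n, 1 := k),
      (\<lambda>a. if a < n then parent_code F a
           else if a < n + n * n then of_bool ({(a - n) div n, (a - n) mod n} \<in> E)
           else 0))"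

end

theory Submission
  imports Defs "HOL-Library.Z2" "HOL-Probability.Product_PMF"
begin

text \<open>
  This is cut and count modulo 2. Add an auxiliary vertex \<open>0\<close> above all roots of the forest, isolated for
  the cycle problems and adjacent to every vertex for the path problems; every problem then asks for
  vertex-disjoint cycles, at most \<open>m\<close> in number, covering exactly \<open>s\<close> vertices. Take an edge set \<open>X\<close> that
  is 2-regular on \<open>s\<close> vertices together with \<open>m\<close> marked vertices such that every component of \<open>X\<close>
  contains a mark. The condition on the components is dropped by counting also the consistent cuts of
  \<open>X\<close> whose left side contains all marks: there is one such cut for a good pair, and an even number for
  a bad one. Random weights isolate one good pair, if any, with probability at least \<open>1/2\<close>, so that
  some weight class has odd size.

  To avoid recording the degree of each vertex in \<open>X\<close>, every edge carries an indeterminate for each of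
  its ends, which is evaluated at \<open>0\<close>, \<open>1\<close> and \<open>\<xi>\<close>. Modulo 2 the values are combined such that an isolated
  vertex contributes \<open>1\<close> and a vertex of degree \<open>d \<ge> 1\<close> contributes \<open>\<xi> + \<xi>^d\<close>, which vanishes for
  \<open>d = 1\<close>; if there are as many edges as touched vertices, only 2-regular \<open>X\<close> survive. The side of
  the cut matters only at \<open>1\<close> and \<open>\<xi>\<close>. So there are five states per vertex, and since all edges join
  vertices comparable in the forest, the sum over all state assignments is computed by a depth-first
  search that visits a vertex once for each assignment of states to its ancestors.

  The numbers of edges, vertices and marks, the power of \<open>\<xi>\<close> and the weight are packed as digits to
  base \<open>R\<close> into the exponent of a single variable, which is set to \<open>2^\<beta>\<close> for a \<open>\<beta>\<close> so large that the
  coefficients do not overlap. The search thus handles integers with polynomially many bits, and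
  the parities of the coefficients are bits of the result.
\<close>

section \<open>Executions\<close>

text \<open>Polynomial space rules out tables indexed by degrees or connectivity of partial
  solutions: below a vertex only the states of its ancestors are stored, and the values of the child
  subtrees must simply multiply. Evaluating the local polynomial \<open>f\<close> of a vertex, in
  which the exponent is its degree, at fixed points achieves this, since the value of an edge then
  depends only on the states of its two ends. In characteristic 2 the combination
  \<open>\<xi> * f(1) + f(\<xi>)\<close> kills degree 1. If all degrees are at least 2 and there are
  as many edges as touched vertices, the handshake lemma forces degree 2. The product of
  \<open>s\<close> factors \<open>\<xi> + \<xi>^2\<close> has coefficient 1 at
  \<open>\<xi>^s\<close>, so no good pair is lost. Marks replace a count of components:
  \<open>m\<close> touched vertices that meet every component exist iff there are at most
  \<open>m\<close> components and at most \<open>s\<close> marks are asked for. One edge set may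
  admit many sets of marks, so the marks carry random weights as well. The auxiliary vertex also
  turns the forest into a tree. It adds one level, hence one factor 5, which the polynomial
  absorbs.\<close>

lemma run_Suc_left: "run c s (Suc t) = bind_pmf (step c s) (\<lambda>(c', s'). run c' s' t)"
proof (induction t)
  case 0
  show ?case by (simp add: bind_return_pmf case_prod_unfold bind_return_pmf')
next
  case (Suc t)
  have "run c s (Suc (Suc t)) = bind_pmf (run c s (Suc t)) (\<lambda>(c', s'). step c' s')" by simp
  also have "\<dots> = bind_pmf (step c s) (\<lambda>(c', s'). run c' s' (Suc t))"
    unfolding Suc by (simp add: bind_assoc_pmf case_prod_unfold)
  finally show ?case .
qed

lemma run_Skip [simp]: "run Skip s t = return_pmf (Skip, s)"
  by (induction t) (simp_all add: bind_return_pmf)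

text \<open>Space is bounded through \<open>I\<close>, which therefore ranges over the
  configurations at all times and not only over the final ones.\<close>

definition halts_as :: "(state \<Rightarrow> bool) \<Rightarrow> com \<times> state \<Rightarrow> nat \<Rightarrow> state pmf \<Rightarrow> bool" where
  "halts_as I cs T D \<longleftrightarrow> run (fst cs) (snd cs) T = map_pmf (Pair Skip) D \<and>
     (\<forall>t. \<forall>x\<in>set_pmf (run (fst cs) (snd cs) t). I (snd x))"

lemma halts_as_Skip: "I s \<Longrightarrow> halts_as I (Skip, s) T (return_pmf s)"
  by (simp add: halts_as_def)

lemma halts_as_step:
  assumes "I s" "\<And>x. x \<in> set_pmf (step c s) \<Longrightarrow> halts_as I x T (D x)"
  shows "halts_as I (c, s) (Suc T) (bind_pmf (step c s) D)"
  unfolding halts_as_def fst_conv snd_conv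
proof (intro conjI allI ballI)
  show "run c s (Suc T) = map_pmf (Pair Skip) (bind_pmf (step c s) D)"
    unfolding run_Suc_left map_bind_pmf
    by (rule bind_pmf_cong) (use assms(2) in \<open>auto simp: halts_as_def\<close>)
next
  fix t x assume x: "x \<in> set_pmf (run c s t)"
  show "I (snd x)"
  proof (cases t)
    case 0
    then show ?thesis using x assms(1) by simp
  next
    case (Suc t')
    with x obtain y where "y \<in> set_pmf (step c s)" "x \<in> set_pmf (run (fst y) (snd y) t')"
      unfolding Suc run_Suc_left by (auto simp: case_prod_unfold)
    then show ?thesis using assms(2)[of y] by (auto simp: halts_as_def)
  qed
qed

text \<open>A halted configuration idles, so time bounds may be rounded up.\<close>

lemma halts_as_mono:
  assumes "halts_as I cs T D" "T \<le> T'"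
  shows "halts_as I cs T' D"
proof -
  have "run c s (T + k) = map_pmf (Pair Skip) D" if "run c s T = map_pmf (Pair Skip) D" for c s k
    by (induction k) (use that in \<open>simp_all add: map_pmf_def bind_assoc_pmf bind_return_pmf\<close>)
  then show ?thesis using assms le_add_diff_inverse[OF assms(2)]
    unfolding halts_as_def by metis
qed

text \<open>Execution without coin tosses, with invariant \<open>I\<close>: every step has a single outcome.\<close>

inductive path :: "(state \<Rightarrow> bool) \<Rightarrow> com \<times> state \<Rightarrow> nat \<Rightarrow> com \<times> state \<Rightarrow> bool"
  for I :: "state \<Rightarrow> bool" where
  path_refl: "I (snd x) \<Longrightarrow> path I x 0 x"
| path_step: "c \<noteq> Skip \<Longrightarrow> I s \<Longrightarrow> step c s = return_pmf y \<Longrightarrow> path I y t x \<Longrightarrow> path I (c, s) (Suc t) x"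

definition reach :: "(state \<Rightarrow> bool) \<Rightarrow> com \<times> state \<Rightarrow> nat \<Rightarrow> com \<times> state \<Rightarrow> bool" where
  "reach I x T y \<longleftrightarrow> (\<exists>t\<le>T. path I x t y)"

lemma path_trans: "path I x t y \<Longrightarrow> path I y t' z \<Longrightarrow> path I x (t + t') z"
  by (induction rule: path.induct) (auto intro: path_step)

lemma path_inv: "path I x t y \<Longrightarrow> I (snd x) \<and> I (snd y)"
  by (induction rule: path.induct) auto

lemma path_halts_as: "path I x t y \<Longrightarrow> halts_as I y T D \<Longrightarrow> halts_as I x (t + T) D"
proof (induction rule: path.induct)
  case (path_step c s y t x)
  then have "halts_as I (c, s) (Suc (t + T)) (bind_pmf (step c s) (\<lambda>_. D))"
    by (intro halts_as_step) auto
  then show ?case using path_step by (simp add: bind_return_pmf)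
qed simp

lemma reach_halts_as:
  assumes "reach I x T y" "halts_as I y T' D" shows "halts_as I x (T + T') D"
  using assms path_halts_as halts_as_mono unfolding reach_def by (meson add_le_mono1)

lemma reach_inv: "reach I x T y \<Longrightarrow> I (snd x) \<and> I (snd y)"
  unfolding reach_def using path_inv by metis

lemma reach_refl: "I (snd x) \<Longrightarrow> reach I x T x"
  unfolding reach_def using path_refl by blast

lemma reach_trans: "reach I x T y \<Longrightarrow> reach I y T' z \<Longrightarrow> reach I x (T + T') z"
  unfolding reach_def using path_trans add_le_mono by metis

lemma reach_mono: "reach I x T y \<Longrightarrow> T \<le> T' \<Longrightarrow> reach I x T' y"
  unfolding reach_def by (meson le_trans)

lemma reach_step:
  assumes "c \<noteq> Skip" "I s" "step c s = return_pmf y" "I (snd y)"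
  shows "reach I (c, s) 1 y"
  unfolding reach_def by (intro exI[of _ 1] conjI) (use assms path_step[of c I s y 0 y] path_refl[of I y] in auto)

lemma path_Seq: "path I x t y \<Longrightarrow> path I (Seq (fst x) c2, snd x) t (Seq (fst y) c2, snd y)"
proof (induction rule: path.induct)
  case (path_step c s y t x)
  have "step (Seq c c2) s = return_pmf (Seq (fst y) c2, snd y)"
    using path_step by (simp add: case_prod_unfold)
  then show ?case using path_step by (auto intro: path.path_step)
qed (auto intro: path_refl)

lemma reach_Seq:
  assumes "reach I (c1, s) T (Skip, s')"
  shows "reach I (Seq c1 c2, s) (T + 1) (c2, s')"
proof -
  have "reach I (Seq c1 c2, s) T (Seq Skip c2, s')"
    using assms path_Seq unfolding reach_def by fastforce
  moreover have "reach I (Seq Skip c2, s') 1 (c2, s')"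
    using reach_inv[OF assms] by (intro reach_step) auto
  ultimately show ?thesis by (rule reach_trans)
qed

abbreviation ex :: "(state \<Rightarrow> bool) \<Rightarrow> com \<Rightarrow> state \<Rightarrow> nat \<Rightarrow> state \<Rightarrow> bool" where
  "ex I c s T s' \<equiv> reach I (c, s) T (Skip, s')"

lemma ex_Seq:
  assumes "ex I c1 s T1 s1" "ex I c2 s1 T2 s2" "T1 + T2 + 1 \<le> T"
  shows "ex I (Seq c1 c2) s T s2"
  using reach_trans[OF reach_Seq[OF assms(1)] assms(2)] by (rule reach_mono) (use assms in simp)

lemma ex_Skip: "I s \<Longrightarrow> ex I Skip s T s"
  by (rule reach_refl) simp

lemma ex_Assign:
  assumes "I s" "I ((fst s)(r := aval a s), snd s)" "1 \<le> T"
  shows "ex I (Assign r a) s T ((fst s)(r := aval a s), snd s)"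
  by (rule reach_mono[OF reach_step assms(3)]) (use assms in auto)

lemma ex_Store:
  assumes "I s" "I (fst s, (snd s)(aval a s := aval b s))" "1 \<le> T"
  shows "ex I (Store a b) s T (fst s, (snd s)(aval a s := aval b s))"
  by (rule reach_mono[OF reach_step assms(3)]) (use assms in auto)

lemma ex_Cond:
  assumes "ex I (if aval a s \<noteq> 0 then c1 else c2) s T0 s'" "T0 + 1 \<le> T"
  shows "ex I (Cond a c1 c2) s T s'"
proof -
  have "reach I (Cond a c1 c2, s) 1 (if aval a s \<noteq> 0 then c1 else c2, s)"
    using reach_inv[OF assms(1)] by (intro reach_step) auto
  from reach_trans[OF this assms(1)] show ?thesis by (rule reach_mono) (use assms in simp)
qed

lemma reach_While:
  assumes "aval a s \<noteq> 0" "ex I c s T s'"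
  shows "reach I (While a c, s) (T + 2) (While a c, s')"
proof -
  have "reach I (While a c, s) 1 (Seq c (While a c), s)"
    using reach_inv[OF assms(2)] assms(1) by (intro reach_step) auto
  from reach_trans[OF this reach_Seq[OF assms(2)]] show ?thesis
    by (rule reach_mono) simp
qed

lemma ex_While_end:
  assumes "aval a s = 0" "I s" "1 \<le> T"
  shows "ex I (While a c) s T s"
  by (rule reach_mono[OF reach_step assms(3)]) (use assms in auto)

section \<open>The generating function of marked cuts\<close>

text \<open>The states of a vertex are 0 (evaluation at 0), 1 and 2 (evaluation at 1, left or right of the
  cut), 3 and 4 (evaluation at \<open>\<xi>\<close>, left or right of the cut).\<close>

definition high :: "nat \<Rightarrow> nat" where "high a = of_bool (3 \<le> a)"
definition left :: "nat \<Rightarrow> bool" where "left a \<longleftrightarrow> a = 1 \<or> a = 3"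
definition same_side :: "nat \<Rightarrow> nat \<Rightarrow> bool" where
  "same_side a b \<longleftrightarrow> a \<noteq> 0 \<and> b \<noteq> 0 \<and> (left a \<longleftrightarrow> left b)"

definition touched :: "('a \<times> 'a) set \<Rightarrow> 'a set" where "touched X = fst ` X \<union> snd ` X"
definition deg :: "('a \<times> 'a) set \<Rightarrow> 'a \<Rightarrow> nat" where "deg X v = card {e \<in> X. fst e = v \<or> snd e = v}"
definition closed_under :: "('a \<times> 'a) set \<Rightarrow> 'a set \<Rightarrow> bool" where
  "closed_under X C \<longleftrightarrow> (\<forall>(u, v)\<in>X. u \<in> C \<longleftrightarrow> v \<in> C)"
text \<open>The nonempty closed sets of touched vertices are the unions of components. Quantifying
  over them says that every component of \<open>X\<close> contains a vertex of \<open>M\<close>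
  without introducing components.\<close>

definition hits :: "('a \<times> 'a) set \<Rightarrow> 'a set \<Rightarrow> bool" where
  "hits X M \<longleftrightarrow> (\<forall>C \<subseteq> touched X. C \<noteq> {} \<longrightarrow> closed_under X C \<longrightarrow> C \<inter> M \<noteq> {})"

text \<open>The symmetric difference with a union of components that avoids \<open>M\<close> pairs off the cuts.\<close>

lemma odd_card_closed_supersets:
  fixes X :: "('a \<times> 'a) set"
  assumes "finite X" "M \<subseteq> touched X"
  shows "odd (card {L. M \<subseteq> L \<and> L \<subseteq> touched X \<and> closed_under X L}) \<longleftrightarrow> hits X M"
    (is "odd (card ?A) \<longleftrightarrow> _")
proof (cases "hits X M")
  case True
  have "?A = {touched X}"
  proof (intro subset_antisym subsetI)
    fix L assume "L \<in> ?A"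
    then have L: "M \<subseteq> L" "L \<subseteq> touched X" "closed_under X L" by auto
    \<comment> \<open>The complement of \<open>L\<close> is closed as well and contains no mark, so
      it is empty once \<open>M\<close> hits every component.\<close>
    have "closed_under X (touched X - L)"
      unfolding closed_under_def
    proof (clarify)
      fix u v assume "(u, v) \<in> X"
      then have "u \<in> touched X" "v \<in> touched X" "u \<in> L \<longleftrightarrow> v \<in> L"
        using L(3) by (force simp: touched_def, force simp: touched_def, auto simp: closed_under_def)
      then show "u \<in> touched X - L \<longleftrightarrow> v \<in> touched X - L" by simp
    qed
    moreover have "(touched X - L) \<inter> M = {}" using L by auto
    ultimately have "touched X - L = {}" using True unfolding hits_def by blast
    then show "L \<in> {touched X}" using L by auto
  next
    fix L assume "L \<in> {touched X}"
    moreover have "closed_under X (touched X)"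
      unfolding closed_under_def touched_def by (auto intro: rev_image_eqI)
    ultimately show "L \<in> ?A" using assms(2) by simp
  qed
  then show ?thesis using True by simp
next
  case False
  then obtain C where C: "C \<subseteq> touched X" "C \<noteq> {}" "closed_under X C" "C \<inter> M = {}"
    unfolding hits_def by blast
  define f where "f L = (L - C) \<union> (C - L)" for L
  have fin: "finite ?A"
    by (rule finite_subset[of _ "Pow (touched X)"]) (use assms(1) in \<open>auto simp: touched_def\<close>)
  \<comment> \<open>As \<open>c\<close> lies in \<open>C\<close>, the involution \<open>f\<close>
    toggles the membership of \<open>c\<close>, so it matches the sets with \<open>c\<close> to
    those without.\<close>
  obtain c where c: "c \<in> C" using C(2) by blast
  have f_in: "f L \<in> ?A" if "L \<in> ?A" for L
    using that C unfolding f_def closed_under_def by blast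
  have ff: "f (f L) = L" for L unfolding f_def by blast
  have "bij_betw f {L \<in> ?A. c \<in> L} {L \<in> ?A. c \<notin> L}"
    by (rule bij_betw_byWitness[where f' = f]) (use f_in ff c in \<open>auto simp: f_def\<close>)
  then have "card {L \<in> ?A. c \<in> L} = card {L \<in> ?A. c \<notin> L}" by (rule bij_betw_same_card)
  moreover have "card ?A = card {L \<in> ?A. c \<in> L} + card {L \<in> ?A. c \<notin> L}"
    by (subst card_Un_disjoint[symmetric])
      (use fin in \<open>auto intro: arg_cong[where f = card] rev_finite_subset[OF fin]\<close>)
  ultimately show ?thesis using False by simp
qed

text \<open>Incidences of vertices and edges are counted twice, with weight \<open>h\<close>. The
  choice \<open>h = high\<close> collects the powers of \<open>\<xi>\<close> at the vertices, and
  \<open>h = 1\<close> is the handshake lemma. Loops are excluded because they would count once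
  instead of twice.\<close>

lemma sum_high_deg:
  assumes "finite X" "finite V" "touched X \<subseteq> V" "\<And>e. e \<in> X \<Longrightarrow> fst e \<noteq> snd e"
  shows "(\<Sum>e\<in>X. h (fst e) + h (snd e)) = (\<Sum>v\<in>V. h v * deg X v :: nat)"
proof -
  have "(\<Sum>v\<in>V. h v * deg X v) = (\<Sum>v\<in>V. \<Sum>e\<in>X. if fst e = v \<or> snd e = v then h v else 0)"
    unfolding deg_def by (intro sum.cong) (use assms in \<open>auto simp: sum.If_cases Int_def\<close>)
  also have "\<dots> = (\<Sum>e\<in>X. \<Sum>v\<in>V. if fst e = v \<or> snd e = v then h v else 0)" by (rule sum.swap)
  also have "\<dots> = (\<Sum>e\<in>X. h (fst e) + h (snd e))"
  proof (rule sum.cong[OF refl])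
    fix e assume e: "e \<in> X"
    then have "{v \<in> V. fst e = v \<or> snd e = v} = {fst e, snd e}"
      using assms(3) by (auto simp: touched_def)
    then show "(\<Sum>v\<in>V. if fst e = v \<or> snd e = v then h v else 0) = h (fst e) + h (snd e)"
      using assms(2) assms(4)[OF e] by (simp add: sum.inter_filter[symmetric])
  qed
  finally show ?thesis by simp
qed

text \<open>Uniqueness of the expansion to base \<open>R\<close>; the top digit needs no bound, as
  nothing lies above it.\<close>

lemma radix_inject:
  fixes R :: nat
  assumes "a0 + R * a1 + R\<^sup>2 * a2 + R ^ 3 * a3 = b0 + R * b1 + R\<^sup>2 * b2 + R ^ 3 * b3"
    and "a0 < R" "a1 < R" "a2 < R" "b0 < R" "b1 < R" "b2 < R"
  shows "a0 = b0 \<and> a1 = b1 \<and> a2 = b2 \<and> a3 = b3"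
proof -
  have step: "p = p' \<and> q = q'" if "p + R * q = p' + R * q'" "p < R" "p' < R" for p q p' q' :: nat
  proof -
    have "(p + R * q) mod R = p" "(p' + R * q') mod R = p'" "(p + R * q) div R = q" "(p' + R * q') div R = q'"
      using that(2,3) by simp_all
    then show ?thesis using that(1) by metis
  qed
  have "a0 + R * (a1 + R * (a2 + R * a3)) = b0 + R * (b1 + R * (b2 + R * b3))"
    using assms(1) by (simp add: algebra_simps power2_eq_square power3_eq_cube)
  from step[OF this] show ?thesis using step[of a1 "a2 + R * a3" b1 "b2 + R * b3"] step[of a2 a3 b2 b3] assms by blast
qed

lemma radix_less:
  fixes R :: nat
  assumes "a0 < R" "a1 < R" "a2 < R" "a3 < R"
  shows "a0 + R * a1 + R\<^sup>2 * a2 + R ^ 3 * a3 < R ^ 4"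
proof -
  have step: "p + R * q < R * n" if "p < R" "q < n" for p q n :: nat
  proof -
    have "R * (q + 1) \<le> R * n" using that by (intro mult_le_mono2) simp
    then show ?thesis using that by simp
  qed
  have "a0 + R * (a1 + R * (a2 + R * a3)) < R * (R * (R * R))"
    using assms by (intro step)
  then show ?thesis by (simp add: algebra_simps power2_eq_square power3_eq_cube power4_eq_xxxx)
qed

text \<open>Loops are excluded, which leaves the diagonal pairs free: \<open>w (v, v)\<close> is the
  weight of a mark at \<open>v\<close>.\<close>

locale cut_count =
  fixes V :: "nat set" and EA :: "(nat \<times> nat) set" and w :: "nat \<times> nat \<Rightarrow> nat" and R :: nat
  assumes finV: "finite V" and EA: "EA \<subseteq> V \<times> V" and irr: "\<And>e. e \<in> EA \<Longrightarrow> fst e \<noteq> snd e"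
begin

text \<open>The variable is \<open>x\<close>, and \<open>\<xi>\<close> is \<open>x ^ (R ^ 4)\<close>. The lower digits of the exponent are the weight and the
  numbers of edges, of touched vertices and of marks. The summand with \<open>1 + \<xi>\<close> in state 0
  makes an isolated vertex contribute \<open>1\<close> modulo 2.\<close>

definition mcost :: "nat \<Rightarrow> nat" where "mcost v = R ^ 3 + w (v, v)"

text \<open>States 1 and 2 carry the factor \<open>\<xi>\<close>, states 3 and 4 do not: these are
  the coefficients of \<open>\<xi> * f(1) + f(\<xi>)\<close>. The power \<open>R\<^sup>2\<close>
  counts a touched vertex, and a vertex on the left may or may not be marked, hence
  \<open>1 + x ^ mcost v\<close>.\<close>

definition vfac :: "'a::comm_semiring_1 \<Rightarrow> nat \<Rightarrow> nat \<Rightarrow> 'a" where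
  "vfac x v a = (if a = 0 then 1 + x ^ (R\<^sup>2 + mcost v) * (1 + x ^ (R ^ 4))
     else x ^ (R\<^sup>2 + R ^ 4 * of_bool (a < 3)) * (if left a then 1 + x ^ mcost v else 1))"

text \<open>The product of the indeterminates of the two ends: an end in state 0 makes it vanish, an
  end in state 3 or 4 gives \<open>\<xi>\<close>. It also vanishes if the edge crosses the
  cut.\<close>

definition efac :: "'a::comm_semiring_1 \<Rightarrow> nat \<times> nat \<Rightarrow> nat \<Rightarrow> nat \<Rightarrow> 'a" where
  "efac x e a b = (if same_side a b then x ^ (R + w e + R ^ 4 * (high a + high b)) else 0)"

definition total :: "'a::comm_semiring_1 \<Rightarrow> 'a" where
  "total x = (\<Sum>\<sigma>\<in>PiE V (\<lambda>_. {..<5}). (\<Prod>v\<in>V. vfac x v (\<sigma> v)) *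
     (\<Prod>e\<in>EA. 1 + efac x e (\<sigma> (fst e)) (\<sigma> (snd e))))"

lemma finEA: "finite EA"
  using finite_subset[OF EA] finV by auto

lemma touched_V: "X \<subseteq> EA \<Longrightarrow> touched X \<subseteq> V"
  using EA by (force simp: touched_def)

text \<open>The powers of \<open>\<xi>\<close> are regrouped by vertices, so that each factor
  depends on the state of one vertex only.\<close>

lemma prod_efac:
  assumes X: "X \<subseteq> EA"
  shows "(\<Prod>e\<in>X. efac x e (\<sigma> (fst e)) (\<sigma> (snd e))) =
    (if \<forall>e\<in>X. same_side (\<sigma> (fst e)) (\<sigma> (snd e)) then
       x ^ (R * card X + sum w X) * (\<Prod>v\<in>touched X. x ^ (R ^ 4 * high (\<sigma> v) * deg X v))
     else (0::'a::comm_semiring_1))"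
proof (cases "\<forall>e\<in>X. same_side (\<sigma> (fst e)) (\<sigma> (snd e))")
  case True
  have fX: "finite X" using X finEA finite_subset by blast
  have "(\<Prod>e\<in>X. efac x e (\<sigma> (fst e)) (\<sigma> (snd e))) =
     (\<Prod>e\<in>X. x ^ (R + w e + R ^ 4 * (high (\<sigma> (fst e)) + high (\<sigma> (snd e)))))"
    by (rule prod.cong) (use True in \<open>auto simp: efac_def\<close>)
  also have "\<dots> = x ^ (\<Sum>e\<in>X. R + w e + R ^ 4 * (high (\<sigma> (fst e)) + high (\<sigma> (snd e))))"
    by (simp add: power_sum)
  also have "(\<Sum>e\<in>X. R + w e + R ^ 4 * (high (\<sigma> (fst e)) + high (\<sigma> (snd e)))) =
     R * card X + sum w X + R ^ 4 * (\<Sum>e\<in>X. high (\<sigma> (fst e)) + high (\<sigma> (snd e)))"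
    by (simp add: sum.distrib sum_distrib_left algebra_simps)
  also have "(\<Sum>e\<in>X. high (\<sigma> (fst e)) + high (\<sigma> (snd e))) = (\<Sum>v\<in>touched X. high (\<sigma> v) * deg X v)"
    using sum_high_deg[of X "touched X" "\<lambda>v. high (\<sigma> v)"] fX irr X by (auto simp: touched_def)
  also have "R ^ 4 * \<dots> = (\<Sum>v\<in>touched X. R ^ 4 * high (\<sigma> v) * deg X v)"
    by (simp add: sum_distrib_left mult.assoc)
  finally show ?thesis using True by (simp add: power_add power_sum)
next
  case False
  then have "(\<Prod>e\<in>X. efac x e (\<sigma> (fst e)) (\<sigma> (snd e))) = 0"
    using finite_subset[OF X finEA] by (intro prod_zero) (auto simp: efac_def)
  then show ?thesis using False by (simp only: if_False)
qed

text \<open>The only \<open>L\<close> with a nonzero summand is the set of left touched vertices.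
  Summing over all closed \<open>L\<close> nevertheless pays off, since the condition on pairs of
  states becomes a product of conditions on single states.\<close>

lemma same_side_indicator:
  assumes X: "X \<subseteq> EA"
  shows "(if \<forall>e\<in>X. same_side (\<sigma> (fst e)) (\<sigma> (snd e)) then 1 else (0::'a::comm_semiring_1)) =
    (\<Sum>L | L \<subseteq> touched X \<and> closed_under X L.
       (\<Prod>v\<in>touched X. of_bool (\<sigma> v \<noteq> 0 \<and> (left (\<sigma> v) \<longleftrightarrow> v \<in> L))))"
proof -
  let ?L = "{v \<in> touched X. left (\<sigma> v)}"
  have fX: "finite X" using X finEA finite_subset by blast
  have fT: "finite (touched X)" using fX by (simp add: touched_def)
  have fin: "finite {L. L \<subseteq> touched X \<and> closed_under X L}"
    by (rule finite_subset[of _ "Pow (touched X)"]) (use fT in auto)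
  have prod: "(\<Prod>v\<in>touched X. of_bool (\<sigma> v \<noteq> 0 \<and> (left (\<sigma> v) \<longleftrightarrow> v \<in> L))) =
      (of_bool ((\<forall>v\<in>touched X. \<sigma> v \<noteq> 0) \<and> L = ?L) :: 'a)" if "L \<subseteq> touched X" for L
  proof (cases "(\<forall>v\<in>touched X. \<sigma> v \<noteq> 0) \<and> L = ?L")
    case True
    then show ?thesis by auto
  next
    case False
    then have "\<exists>v\<in>touched X. \<not> (\<sigma> v \<noteq> 0 \<and> (left (\<sigma> v) \<longleftrightarrow> v \<in> L))"
      using that by auto
    then have "(\<Prod>v\<in>touched X. of_bool (\<sigma> v \<noteq> 0 \<and> (left (\<sigma> v) \<longleftrightarrow> v \<in> L))) = (0::'a)"
      by (intro prod_zero[OF fT]) simp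
    then show ?thesis using False by simp
  qed
  have "(\<Sum>L | L \<subseteq> touched X \<and> closed_under X L.
       (\<Prod>v\<in>touched X. of_bool (\<sigma> v \<noteq> 0 \<and> (left (\<sigma> v) \<longleftrightarrow> v \<in> L)))) =
     (\<Sum>L | L \<subseteq> touched X \<and> closed_under X L.
        if L = ?L then of_bool (\<forall>v\<in>touched X. \<sigma> v \<noteq> 0) else (0::'a))"
  proof (rule sum.cong[OF refl])
    fix L assume "L \<in> {L. L \<subseteq> touched X \<and> closed_under X L}"
    then have "L \<subseteq> touched X" by simp
    from prod[OF this] show "(\<Prod>v\<in>touched X. of_bool (\<sigma> v \<noteq> 0 \<and> (left (\<sigma> v) \<longleftrightarrow> v \<in> L))) =
      (if L = ?L then of_bool (\<forall>v\<in>touched X. \<sigma> v \<noteq> 0) else (0::'a))" by (simp only:) simp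
  qed
  also have "\<dots> = of_bool (closed_under X ?L \<and> (\<forall>v\<in>touched X. \<sigma> v \<noteq> 0))"
    using fin by (subst sum.delta) auto
  also have "(closed_under X ?L \<and> (\<forall>v\<in>touched X. \<sigma> v \<noteq> 0)) \<longleftrightarrow>
      (\<forall>e\<in>X. same_side (\<sigma> (fst e)) (\<sigma> (snd e)))"
  proof -
    have "fst e \<in> touched X" "snd e \<in> touched X" if "e \<in> X" for e
      using that by (auto simp: touched_def)
    then have "closed_under X ?L \<longleftrightarrow> (\<forall>e\<in>X. left (\<sigma> (fst e)) \<longleftrightarrow> left (\<sigma> (snd e)))"
      by (simp add: closed_under_def case_prod_unfold)
    moreover have "(\<forall>v\<in>touched X. \<sigma> v \<noteq> 0) \<longleftrightarrow> (\<forall>e\<in>X. \<sigma> (fst e) \<noteq> 0 \<and> \<sigma> (snd e) \<noteq> 0)"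
      by (auto simp: touched_def)
    ultimately show ?thesis by (auto simp: same_side_def)
  qed
  finally show ?thesis by simp
qed

text \<open>An isolated vertex counts as 1: modulo 2 the states 1 to 4 add up to
  \<open>x ^ (R\<^sup>2 + mcost v) * (1 + x ^ (R ^ 4))\<close>, which is exactly the correction term
  of state 0.\<close>

lemma vfac_sum:
  fixes x :: "'a::comm_ring_1"
  assumes two: "\<And>a :: 'a. a + a = 0"
  shows "(\<Sum>a<5. vfac x v a) = 1"
proof -
  let ?A = "x ^ R\<^sup>2" and ?y = "x ^ mcost v" and ?z = "x ^ (R ^ 4)"
  have set5: "{..<5::nat} = {0, 1, 2, 3, 4}" by auto
  have "(\<Sum>a<5. vfac x v a) = 1 + ?A * ?y * (1 + ?z) + (?A * ?z * (1 + ?y) + (?A * ?z + (?A * (1 + ?y) + ?A)))"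
    unfolding set5 by (simp add: vfac_def left_def power_add)
  also have "\<dots> = 1 + ((?A * ?y * (1 + ?z) + ?A * (1 + ?z)) + (?A * ?y * (1 + ?z) + ?A * (1 + ?z)))"
    by (simp add: algebra_simps)
  finally show ?thesis by (simp add: two)
qed

lemma vfac_sum_side:
  "(\<Sum>a<5. vfac x v a * (x ^ (R ^ 4 * high a * d) * of_bool (a \<noteq> 0 \<and> (left a \<longleftrightarrow> l)))) =
   x ^ R\<^sup>2 * (x ^ (R ^ 4) + x ^ (R ^ 4 * d)) * (if l then 1 + x ^ mcost v else 1)"
proof -
  have set5: "{..<5::nat} = {0, 1, 2, 3, 4}" by auto
  show ?thesis unfolding set5
    by (simp add: vfac_def left_def high_def power_add algebra_simps)
qed

lemma total_expand:
  fixes x :: "'a::comm_ring_1"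
  assumes two: "\<And>a :: 'a. a + a = 0"
  shows "total x = (\<Sum>X\<in>Pow EA. x ^ (R * card X + sum w X) *
     (\<Prod>v\<in>touched X. x ^ R\<^sup>2 * (x ^ (R ^ 4) + x ^ (R ^ 4 * deg X v))) *
     (\<Sum>L | L \<subseteq> touched X \<and> closed_under X L. \<Prod>v\<in>L. 1 + x ^ mcost v))"
proof -
  let ?S = "PiE V (\<lambda>_. {..<5::nat})"
  let ?cl = "\<lambda>X. {L. L \<subseteq> touched X \<and> closed_under X L}"
  have "total x = (\<Sum>\<sigma>\<in>?S. (\<Prod>v\<in>V. vfac x v (\<sigma> v)) *
      (\<Sum>X\<in>Pow EA. \<Prod>e\<in>X. efac x e (\<sigma> (fst e)) (\<sigma> (snd e))))"
    unfolding total_def add.commute[of 1] using finEA by (simp add: prod_add)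
  also have "\<dots> = (\<Sum>X\<in>Pow EA. \<Sum>\<sigma>\<in>?S. (\<Prod>v\<in>V. vfac x v (\<sigma> v)) *
      (\<Prod>e\<in>X. efac x e (\<sigma> (fst e)) (\<sigma> (snd e))))"
    by (subst sum.swap) (simp add: sum_distrib_left)
  also have "\<dots> = (\<Sum>X\<in>Pow EA. x ^ (R * card X + sum w X) *
     (\<Prod>v\<in>touched X. x ^ R\<^sup>2 * (x ^ (R ^ 4) + x ^ (R ^ 4 * deg X v))) *
     (\<Sum>L\<in>?cl X. \<Prod>v\<in>L. 1 + x ^ mcost v))"
  proof (rule sum.cong[OF refl])
    fix X assume "X \<in> Pow EA"
    then have X: "X \<subseteq> EA" by simp
    have fT: "finite (touched X)" using touched_V[OF X] finV finite_subset by blast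
    let ?c = "x ^ (R * card X + sum w X)"
    define a where "a L v b = vfac x v b * (if v \<in> touched X then x ^ (R ^ 4 * high b * deg X v) *
        of_bool (b \<noteq> 0 \<and> (left b \<longleftrightarrow> v \<in> L)) else 1)" for L v b
    have split: "(\<Prod>v\<in>V. g v * (if v \<in> touched X then h v else 1)) = prod g V * prod h (touched X)"
      for g h :: "nat \<Rightarrow> 'a"
      using touched_V[OF X] finV by (simp add: prod.distrib prod.inter_restrict[symmetric] Int_absorb1)
    have "(\<Prod>v\<in>V. vfac x v (\<sigma> v)) * (\<Prod>e\<in>X. efac x e (\<sigma> (fst e)) (\<sigma> (snd e))) =
        ?c * (\<Sum>L\<in>?cl X. \<Prod>v\<in>V. a L v (\<sigma> v))" for \<sigma>
    proof -
      have "(\<Prod>e\<in>X. efac x e (\<sigma> (fst e)) (\<sigma> (snd e))) =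
         ?c * (\<Prod>v\<in>touched X. x ^ (R ^ 4 * high (\<sigma> v) * deg X v)) *
         (if \<forall>e\<in>X. same_side (\<sigma> (fst e)) (\<sigma> (snd e)) then 1 else 0)"
        unfolding prod_efac[OF X] by simp
      also have "\<dots> = (\<Sum>L\<in>?cl X. ?c * (\<Prod>v\<in>touched X. x ^ (R ^ 4 * high (\<sigma> v) * deg X v) *
          of_bool (\<sigma> v \<noteq> 0 \<and> (left (\<sigma> v) \<longleftrightarrow> v \<in> L))))"
        unfolding same_side_indicator[OF X] by (simp add: sum_distrib_left prod.distrib mult.assoc)
      finally show ?thesis
        unfolding a_def split by (simp add: sum_distrib_left mult_ac)
    qed
    then have "(\<Sum>\<sigma>\<in>?S. (\<Prod>v\<in>V. vfac x v (\<sigma> v)) * (\<Prod>e\<in>X. efac x e (\<sigma> (fst e)) (\<sigma> (snd e)))) =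
        ?c * (\<Sum>L\<in>?cl X. \<Sum>\<sigma>\<in>?S. \<Prod>v\<in>V. a L v (\<sigma> v))"
      by (simp add: sum_distrib_left[symmetric]) (subst sum.swap, simp)
    also have "(\<Sum>L\<in>?cl X. \<Sum>\<sigma>\<in>?S. \<Prod>v\<in>V. a L v (\<sigma> v)) =
        (\<Sum>L\<in>?cl X. \<Prod>v\<in>touched X. x ^ R\<^sup>2 * (x ^ (R ^ 4) + x ^ (R ^ 4 * deg X v)) * (if v \<in> L then 1 + x ^ mcost v else 1))"
    proof (rule sum.cong[OF refl])
      fix L
      \<comment> \<open>With \<open>X\<close> and \<open>L\<close> fixed, each factor sees the state
        of a single vertex, so the sum over all assignments becomes a product of sums over five
        states.\<close>
      have "(\<Sum>\<sigma>\<in>?S. \<Prod>v\<in>V. a L v (\<sigma> v)) = (\<Prod>v\<in>V. \<Sum>b<5. a L v b)"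
        using finV by (subst prod_sum_PiE) auto
      also have "\<dots> = (\<Prod>v\<in>V. 1 * (if v \<in> touched X then x ^ R\<^sup>2 * (x ^ (R ^ 4) + x ^ (R ^ 4 * deg X v)) *
          (if v \<in> L then 1 + x ^ mcost v else 1) else 1))"
      proof (rule prod.cong[OF refl])
        fix v
        show "(\<Sum>b<5. a L v b) = 1 * (if v \<in> touched X then x ^ R\<^sup>2 * (x ^ (R ^ 4) + x ^ (R ^ 4 * deg X v)) *
          (if v \<in> L then 1 + x ^ mcost v else 1) else 1)"
        proof (cases "v \<in> touched X")
          case True
          then show ?thesis unfolding a_def
            using vfac_sum_side[of x v "deg X v" "v \<in> L"] by (simp only: if_True mult_1_left)
        next
          case False
          then show ?thesis unfolding a_def by (simp add: vfac_sum[OF two])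
        qed
      qed
      finally show "(\<Sum>\<sigma>\<in>?S. \<Prod>v\<in>V. a L v (\<sigma> v)) =
        (\<Prod>v\<in>touched X. x ^ R\<^sup>2 * (x ^ (R ^ 4) + x ^ (R ^ 4 * deg X v)) * (if v \<in> L then 1 + x ^ mcost v else 1))"
        unfolding split by simp
    qed
    also have "\<dots> = (\<Sum>L\<in>?cl X. (\<Prod>v\<in>touched X. x ^ R\<^sup>2 * (x ^ (R ^ 4) + x ^ (R ^ 4 * deg X v))) *
        (\<Prod>v\<in>L. 1 + x ^ mcost v))"
    proof (rule sum.cong[OF refl])
      fix L assume "L \<in> ?cl X"
      then have "touched X \<inter> L = L" by auto
      then have "(\<Prod>v\<in>touched X. if v \<in> L then 1 + x ^ mcost v else 1) = (\<Prod>v\<in>L. 1 + x ^ mcost v)"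
        using prod.inter_restrict[OF fT, of "\<lambda>v. 1 + x ^ mcost v" L] by simp
      then show "(\<Prod>v\<in>touched X. x ^ R\<^sup>2 * (x ^ (R ^ 4) + x ^ (R ^ 4 * deg X v)) * (if v \<in> L then 1 + x ^ mcost v else 1))
        = (\<Prod>v\<in>touched X. x ^ R\<^sup>2 * (x ^ (R ^ 4) + x ^ (R ^ 4 * deg X v))) * (\<Prod>v\<in>L. 1 + x ^ mcost v)"
        by (simp add: prod.distrib)
    qed
    finally show "(\<Sum>\<sigma>\<in>?S. (\<Prod>v\<in>V. vfac x v (\<sigma> v)) * (\<Prod>e\<in>X. efac x e (\<sigma> (fst e)) (\<sigma> (snd e)))) =
       ?c * (\<Prod>v\<in>touched X. x ^ R\<^sup>2 * (x ^ (R ^ 4) + x ^ (R ^ 4 * deg X v))) *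
       (\<Sum>L\<in>?cl X. \<Prod>v\<in>L. 1 + x ^ mcost v)"
      by (simp add: sum_distrib_left mult.assoc)
  qed
  finally show ?thesis .
qed

text \<open>Expanding the product over \<open>L\<close> selects a set of marks \<open>M\<close>
  inside \<open>L\<close>. After exchanging the sums, \<open>M\<close> is counted once for each
  closed set between \<open>M\<close> and \<open>touched X\<close>, and that number is odd iff
  \<open>M\<close> hits every component.\<close>

lemma sum_closed_sets:
  fixes x :: "'a::comm_ring_1"
  assumes two: "\<And>a :: 'a. a + a = 0" and X: "X \<subseteq> EA"
  shows "(\<Sum>L | L \<subseteq> touched X \<and> closed_under X L. \<Prod>v\<in>L. 1 + x ^ mcost v) =
    (\<Sum>M | M \<subseteq> touched X \<and> hits X M. x ^ sum mcost M)"
proof -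
  let ?cl = "{L. L \<subseteq> touched X \<and> closed_under X L}"
  have fX: "finite X" using X finEA finite_subset by blast
  have fT: "finite (touched X)" using touched_V[OF X] finV finite_subset by blast
  have fcl: "finite ?cl" by (rule finite_subset[of _ "Pow (touched X)"]) (use fT in auto)
  have of_nat: "of_nat n = (of_bool (odd n) :: 'a)" for n
  proof (induction n)
    case (Suc n)
    then show ?case using two[of 1] by simp
  qed simp
  have "(\<Sum>L\<in>?cl. \<Prod>v\<in>L. 1 + x ^ mcost v) = (\<Sum>L\<in>?cl. \<Sum>M\<in>Pow (touched X). if M \<subseteq> L then x ^ sum mcost M else 0)"
  proof (rule sum.cong[OF refl])
    fix L assume L: "L \<in> ?cl"
    then have fL: "finite L" using fT finite_subset by blast
    have "(\<Prod>v\<in>L. 1 + x ^ mcost v) = (\<Sum>M\<in>Pow L. x ^ sum mcost M)"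
      using prod_add[OF fL, of "\<lambda>v. x ^ mcost v" "\<lambda>_. 1"] by (simp add: add.commute power_sum)
    also have "Pow L = {M \<in> Pow (touched X). M \<subseteq> L}" using L by auto
    finally show "(\<Prod>v\<in>L. 1 + x ^ mcost v) = (\<Sum>M\<in>Pow (touched X). if M \<subseteq> L then x ^ sum mcost M else 0)"
      using fT by (simp only: sum.inter_filter finite_Pow_iff)
  qed
  also have "\<dots> = (\<Sum>M\<in>Pow (touched X). \<Sum>L\<in>?cl. if M \<subseteq> L then x ^ sum mcost M else 0)" by (rule sum.swap)
  also have "\<dots> = (\<Sum>M\<in>Pow (touched X). if hits X M then x ^ sum mcost M else 0)"
  proof (rule sum.cong[OF refl])
    fix M assume M: "M \<in> Pow (touched X)"
    have eq: "{L \<in> ?cl. M \<subseteq> L} = {L. M \<subseteq> L \<and> L \<subseteq> touched X \<and> closed_under X L}" by auto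
    have "(\<Sum>L\<in>?cl. if M \<subseteq> L then x ^ sum mcost M else 0) = of_nat (card {L \<in> ?cl. M \<subseteq> L}) * x ^ sum mcost M"
      using sum.inter_filter[OF fcl, of "\<lambda>_. x ^ sum mcost M" "\<lambda>L. M \<subseteq> L"] by simp
    also have "\<dots> = (if hits X M then x ^ sum mcost M else 0)"
      unfolding eq of_nat using odd_card_closed_supersets[OF fX, of M] M by simp
    finally show "(\<Sum>L\<in>?cl. if M \<subseteq> L then x ^ sum mcost M else 0) = (if hits X M then x ^ sum mcost M else 0)" .
  qed
  also have "\<dots> = (\<Sum>M\<in>{M \<in> Pow (touched X). hits X M}. x ^ sum mcost M)"
    using fT by (simp only: sum.inter_filter finite_Pow_iff)
  finally show ?thesis by (simp only: Pow_iff)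
qed

definition good :: "nat \<Rightarrow> nat \<Rightarrow> ((nat \<times> nat) set \<times> nat set) set" where
  "good s m = {(X, M). X \<subseteq> EA \<and> M \<subseteq> touched X \<and> hits X M \<and> (\<forall>v\<in>touched X. deg X v = 2) \<and>
     card (touched X) = s \<and> card X = s \<and> card M = m}"

definition weight :: "(nat \<times> nat) set \<times> nat set \<Rightarrow> nat" where
  "weight = (\<lambda>(X, M). sum w X + (\<Sum>v\<in>M. w (v, v)))"

text \<open>A pair contributes a monomial with exponent below \<open>R ^ 4\<close> times factors
  \<open>\<xi> + \<xi>^d\<close>, whose exponents are multiples of \<open>R ^ 4\<close>. The
  exponent of the coefficient thus determines weight and cardinalities as digits; equal numbers of
  edges and touched vertices then leave only the 2-regular sets.\<close>

lemma total_coeff: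
  assumes R: "card EA < R" "card V < R" "sum w EA + (\<Sum>v\<in>V. w (v, v)) < R"
    and T: "w0 < R" "s < R" "m < R"
  shows "coeff (total [:0, 1:]) (w0 + R * s + R\<^sup>2 * s + R ^ 3 * m + R ^ 4 * s) =
    (of_nat (card {Y \<in> good s m. weight Y = w0}) :: bit)"
proof -
  let ?x = "monom 1 1 :: bit poly" and ?t = "w0 + R * s + R\<^sup>2 * s + R ^ 3 * m"
  let ?z = "monom 1 (R ^ 4) :: bit poly"
  define fac where "fac X v = ?z + monom 1 (R ^ 4 * deg X v)" for X :: "(nat \<times> nat) set" and v
  define lo where "lo = (\<lambda>(X, M). sum w X + (\<Sum>v\<in>M. w (v, v)) + R * card X + R\<^sup>2 * card (touched X) + R ^ 3 * card M)"
  have two: "a + a = 0" for a :: "bit poly"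
  proof (rule poly_eqI)
    have "c + c = 0" for c :: bit by (cases c rule: bit.exhaust) simp_all
    then show "coeff (a + a) n = coeff 0 n" for n by (simp only: coeff_add coeff_0)
  qed
  have pw: "?x ^ e = monom 1 e" for e by (simp add: monom_power)
  define S where "S = (SIGMA X:Pow EA. {M. M \<subseteq> touched X \<and> hits X M})"
  have fT: "finite (touched X)" if "X \<subseteq> EA" for X using touched_V[OF that] finV finite_subset by blast
  have finS: "finite S" unfolding S_def
    using finEA fT by (intro finite_SigmaI) (auto intro: rev_finite_subset[OF finite_Pow_iff[THEN iffD2]])
  have "total ?x = (\<Sum>X\<in>Pow EA. \<Sum>M | M \<subseteq> touched X \<and> hits X M.
      ?x ^ (R * card X + sum w X) * (\<Prod>v\<in>touched X. ?x ^ R\<^sup>2 * (?x ^ (R ^ 4) + ?x ^ (R ^ 4 * deg X v))) * ?x ^ sum mcost M)"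
    by (subst total_expand[OF two]) (simp add: sum_closed_sets[OF two] sum_distrib_left)
  also have "\<dots> = (\<Sum>(X, M)\<in>S. ?x ^ (R * card X + sum w X) *
      (\<Prod>v\<in>touched X. ?x ^ R\<^sup>2 * (?x ^ (R ^ 4) + ?x ^ (R ^ 4 * deg X v))) * ?x ^ sum mcost M)"
    unfolding S_def using finEA fT by (subst sum.Sigma) (auto intro: rev_finite_subset[OF finite_Pow_iff[THEN iffD2]])
  also have "\<dots> = (\<Sum>Y\<in>S. monom 1 (lo Y) * (\<Prod>v\<in>touched (fst Y). fac (fst Y) v))"
  proof (rule sum.cong[OF refl], clarify)
    fix X M assume "(X, M) \<in> S"
    then have M: "M \<subseteq> touched X" and X: "X \<subseteq> EA" by (auto simp: S_def)
    have "sum mcost M = (\<Sum>v\<in>M. w (v, v)) + R ^ 3 * card M"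
      by (simp add: mcost_def sum.distrib)
    then have "monom 1 (lo (X, M)) = ?x ^ (R * card X + sum w X) * ?x ^ (R\<^sup>2 * card (touched X)) * ?x ^ sum mcost M"
      unfolding lo_def pw by (simp add: mult_monom algebra_simps)
    moreover have "(\<Prod>v\<in>touched X. ?x ^ R\<^sup>2 * (?x ^ (R ^ 4) + ?x ^ (R ^ 4 * deg X v))) =
        ?x ^ (R\<^sup>2 * card (touched X)) * (\<Prod>v\<in>touched X. fac X v)"
      unfolding pw by (simp add: prod.distrib monom_power fac_def)
    ultimately show "?x ^ (R * card X + sum w X) *
      (\<Prod>v\<in>touched X. ?x ^ R\<^sup>2 * (?x ^ (R ^ 4) + ?x ^ (R ^ 4 * deg X v))) * ?x ^ sum mcost M =
      monom 1 (lo (X, M)) * (\<Prod>v\<in>touched (fst (X, M)). fac (fst (X, M)) v)"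
      by (simp add: mult_ac)
  qed
  finally have tot: "total ?x = \<dots>" .
  have "coeff (total ?x) (?t + R ^ 4 * s) = (\<Sum>Y\<in>S. of_bool (Y \<in> good s m \<and> weight Y = w0))"
    unfolding tot coeff_sum
  proof (rule sum.cong[OF refl], clarify)
    fix X M assume "(X, M) \<in> S"
    then have M: "M \<subseteq> touched X" and X: "X \<subseteq> EA" and hit: "hits X M" by (auto simp: S_def)
    let ?P = "\<Prod>v\<in>touched X. fac X v"
    note fTX = fT[OF X]
    have fX: "finite X" using X finEA finite_subset by blast
    \<comment> \<open>The product is a polynomial in \<open>\<xi> = x ^ (R ^ 4)\<close>.\<close>
    have sparse: "coeff ?P e = 0" if "\<not> R ^ 4 dvd e" for e
    proof -
      have "\<forall>e. coeff (prod (fac X) A) e \<noteq> 0 \<longrightarrow> R ^ 4 dvd e" if "finite A" for A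
        using that
      proof (induction A)
        case empty
        then show ?case by (auto simp: one_pCons coeff_pCons split: if_splits nat.splits)
      next
        case (insert v A)
        show ?case
        proof (intro allI impI)
          fix e assume "coeff (prod (fac X) (insert v A)) e \<noteq> 0"
          then have "(\<Sum>i\<le>e. coeff (fac X v) i * coeff (prod (fac X) A) (e - i)) \<noteq> 0"
            using insert by (simp add: coeff_mult)
          then obtain i where i: "i \<le> e" "coeff (fac X v) i \<noteq> 0" "coeff (prod (fac X) A) (e - i) \<noteq> 0"
            by (metis (no_types, lifting) atMost_iff mult_not_zero sum.neutral)
          have "R ^ 4 dvd i" using i(2) by (auto simp: fac_def split: if_splits)
          moreover have "R ^ 4 dvd e - i" using insert i by auto
          ultimately show "R ^ 4 dvd e" using i(1) by (metis dvd_add le_add_diff_inverse)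
        qed
      qed
      then show ?thesis using that fTX by blast
    qed
    have cX: "card X < R" using card_mono[OF finEA X] R(1) by simp
    have cT: "card (touched X) < R" using card_mono[OF finV touched_V[OF X]] R(2) by simp
    have cM: "card M < R" using card_mono[OF fTX M] cT by simp
    have wY: "sum w X + (\<Sum>v\<in>M. w (v, v)) < R"
    proof -
      have "sum w X \<le> sum w EA" using X finEA by (intro sum_mono2) auto
      moreover have "(\<Sum>v\<in>M. w (v, v)) \<le> (\<Sum>v\<in>V. w (v, v))"
        using M touched_V[OF X] finV by (intro sum_mono2) auto
      ultimately show ?thesis using R(3) by simp
    qed
    have lo_lt: "lo (X, M) < R ^ 4" unfolding lo_def prod.case
      using radix_less[OF wY cX cT cM] .
    have t_lt: "?t < R ^ 4" using radix_less[OF T(1,2,2,3)] .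
    have shake: "2 * card X = (\<Sum>v\<in>touched X. deg X v)"
    proof -
      have "fst e \<noteq> snd e" if "e \<in> X" for e using irr X that by blast
      from sum_high_deg[OF fX fTX order_refl this, of "\<lambda>_. 1"] show ?thesis by simp
    qed
    have pos: "deg X v \<noteq> 0" if "v \<in> touched X" for v
    proof -
      have "\<exists>e\<in>X. fst e = v \<or> snd e = v" using that by (auto simp: touched_def)
      then have "{e \<in> X. fst e = v \<or> snd e = v} \<noteq> {}" by blast
      then show ?thesis using fX by (simp add: deg_def)
    qed
    have "coeff (monom 1 (lo (X, M)) * ?P) (?t + R ^ 4 * s) = of_bool ((X, M) \<in> good s m \<and> weight (X, M) = w0)"
    proof (cases "coeff (monom 1 (lo (X, M)) * ?P) (?t + R ^ 4 * s) = 0")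
      case False
      then have le: "lo (X, M) \<le> ?t + R ^ 4 * s" and ne: "coeff ?P (?t + R ^ 4 * s - lo (X, M)) \<noteq> 0"
        by (auto simp: coeff_monom_mult split: if_splits)
      then have "R ^ 4 dvd ?t + R ^ 4 * s - lo (X, M)" using sparse by blast
      then have "(?t + R ^ 4 * s) mod R ^ 4 = lo (X, M) mod R ^ 4"
        using le by (metis mod_eq_dvd_iff_nat)
      then have eq: "?t = lo (X, M)" using t_lt lo_lt by simp
      from radix_inject[OF this[unfolded lo_def prod.case] T(1,2,2) wY cX cT]
      have d: "w0 = sum w X + (\<Sum>v\<in>M. w (v, v))" "s = card X" "s = card (touched X)" "m = card M" by auto
      have "?P \<noteq> 0" using ne by auto
      then have "fac X v \<noteq> 0" if "v \<in> touched X" for v using that fTX by auto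
      \<comment> \<open>In degree 1 the two terms of the factor coincide and cancel in
        characteristic 2.\<close>
      moreover have "fac X v = 0" if "deg X v = 1" for v
        unfolding fac_def that by (simp only: mult_1_right two)
      ultimately have "deg X v \<noteq> 1" if "v \<in> touched X" for v using that by blast
      then have ge: "deg X v \<ge> 2" if "v \<in> touched X" for v using that pos[OF that] by (metis One_nat_def Suc_1 Suc_leI le_neq_implies_less less_one not_le_imp_less)
      have "deg X v = 2" if v: "v \<in> touched X" for v
      proof (rule ccontr)
        assume "deg X v \<noteq> 2"
        \<comment> \<open>A larger degree anywhere would push the degree sum above twice the number
          of touched vertices, which equals twice the number of edges.\<close>
        then have "(\<Sum>v\<in>touched X. 2) < (\<Sum>v\<in>touched X. deg X v)"
          using ge v fTX by (intro sum_strict_mono_ex1) (auto intro!: bexI[of _ v] simp: le_neq_implies_less)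
        then show False using shake d by simp
      qed
      then have "(X, M) \<in> good s m \<and> weight (X, M) = w0"
        using d X M hit by (auto simp: good_def weight_def)
      moreover have "coeff (monom 1 (lo (X, M)) * ?P) (?t + R ^ 4 * s) = 1"
        using False by (cases "coeff (monom 1 (lo (X, M)) * ?P) (?t + R ^ 4 * s)" rule: bit.exhaust) auto
      ultimately show ?thesis by simp
    next
      case True
      have no: "False" if g: "(X, M) \<in> good s m" "weight (X, M) = w0"
      proof -
        have d: "card X = s" "card (touched X) = s" "card M = m" "\<forall>v\<in>touched X. deg X v = 2"
          using g by (auto simp: good_def)
        have "lo (X, M) = ?t" using g d by (simp add: lo_def weight_def)
        \<comment> \<open>The lowest power of \<xi> is the one asked for, so its coefficient is the
          constant term of \<open>(1 + ?z) ^ s\<close>.\<close>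
        moreover have "?P = monom 1 (R ^ 4 * s) * (1 + ?z) ^ s"
        proof -
          have "?P = (\<Prod>v\<in>touched X. ?z * (1 + ?z))"
            by (rule prod.cong) (use d in \<open>auto simp: fac_def distrib_left mult_monom mult_2_right\<close>)
          then show ?thesis using d by (simp add: power_mult_distrib monom_power)
        qed
        moreover have "coeff ((1 + ?z) ^ s) 0 = 1"
        proof -
          have "R ^ 4 \<noteq> 0" using T by simp
          then show ?thesis by (simp add: poly_0_coeff_0[symmetric] poly_monom)
        qed
        ultimately show False using True by (simp add: coeff_monom_mult)
      qed
      show ?thesis unfolding True using no by (simp only: of_bool_eq_0_iff eq_commute[of 0]) blast
    qed
    then show "coeff (monom 1 (lo (X, M)) * (\<Prod>v\<in>touched (fst (X, M)). fac (fst (X, M)) v)) (?t + R ^ 4 * s) =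
      of_bool ((X, M) \<in> good s m \<and> weight (X, M) = w0)" by simp
  qed
  also have "\<dots> = of_nat (card {Y \<in> S. Y \<in> good s m \<and> weight Y = w0})"
    using finS by (simp add: sum.inter_filter[symmetric] of_bool_def)
  also have "{Y \<in> S. Y \<in> good s m \<and> weight Y = w0} = {Y \<in> good s m. weight Y = w0}"
    by (auto simp: S_def good_def)
  also have "?x = [:0, 1:]" by (simp add: monom_altdef)
  finally show ?thesis by simp
qed

end

text \<open>Neighbours on a cycle are the cyclic successor and predecessor; the latter is written
  with \<open>+ length p\<close> to avoid truncated subtraction. They differ because the cycle has
  at least three vertices.\<close>

lemma adjacent_indices_cycle:
  assumes p: "distinct p" "3 \<le> length p" and v: "j < length p"
    and A: "\<And>x y. A x y \<longleftrightarrow> (\<exists>i<length p. (x = p ! i \<and> y = p ! (Suc i mod length p)) \<or> (y = p ! i \<and> x = p ! (Suc i mod length p)))"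
  shows "{u. A u (p ! j)} = {p ! (Suc j mod length p), p ! ((j + length p - 1) mod length p)}"
    "p ! (Suc j mod length p) \<noteq> p ! ((j + length p - 1) mod length p)"
proof -
  let ?l = "length p"
  have idx: "p ! a = p ! b \<longleftrightarrow> a = b" if "a < ?l" "b < ?l" for a b
    using p(1) that by (rule nth_eq_iff_index_eq)
  have lt: "a mod ?l < ?l" for a using p(2) by (intro mod_less_divisor) linarith
  have pred: "(j + ?l - 1) mod ?l = (if j = 0 then ?l - 1 else j - 1)"
    using v p(2) by (auto simp: mod_if)
  have succ: "Suc i mod ?l = (if Suc i = ?l then 0 else Suc i)" if "i < ?l" for i
    using that by (auto simp: mod_if)
  show "p ! (Suc j mod ?l) \<noteq> p ! ((j + ?l - 1) mod ?l)"
  proof -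
    have "Suc j mod ?l \<noteq> (j + ?l - 1) mod ?l"
      unfolding pred succ[OF v] using p(2) v by auto
    then show ?thesis using idx[OF lt lt] by blast
  qed
  show "{u. A u (p ! j)} = {p ! (Suc j mod ?l), p ! ((j + ?l - 1) mod ?l)}"
  proof (intro subset_antisym subsetI)
    fix u assume "u \<in> {u. A u (p ! j)}"
    then obtain i where i: "i < ?l" "(u = p ! i \<and> p ! j = p ! (Suc i mod ?l)) \<or> (p ! j = p ! i \<and> u = p ! (Suc i mod ?l))"
      unfolding A by auto
    from i(2) show "u \<in> {p ! (Suc j mod ?l), p ! ((j + ?l - 1) mod ?l)}"
    proof
      assume a: "u = p ! i \<and> p ! j = p ! (Suc i mod ?l)"
      then have "j = Suc i mod ?l" using idx[OF v lt] by simp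
      then have "(j + ?l - 1) mod ?l = i" unfolding pred using succ[OF i(1)] i(1) by (auto split: if_splits)
      then show ?thesis using a by simp
    next
      assume "p ! j = p ! i \<and> u = p ! (Suc i mod ?l)"
      then show ?thesis using idx[OF v i(1)] by auto
    qed
  next
    fix u assume "u \<in> {p ! (Suc j mod ?l), p ! ((j + ?l - 1) mod ?l)}"
    then show "u \<in> {u. A u (p ! j)}"
    proof (elim insertE emptyE)
      assume "u = p ! (Suc j mod ?l)"
      then show ?thesis using v by (auto simp: A)
    next
      assume u: "u = p ! ((j + ?l - 1) mod ?l)"
      have "Suc ((j + ?l - 1) mod ?l) mod ?l = j" unfolding pred using v p(2) by auto
      then have "u = p ! ((j + ?l - 1) mod ?l) \<and> p ! j = p ! (Suc ((j + ?l - 1) mod ?l) mod ?l)" using u by simp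
      then show ?thesis using lt[of "j + ?l - 1"] unfolding mem_Collect_eq A by blast
    qed
  qed
qed

section \<open>Two-regular graphs and cycle covers\<close>

definition closed_walk :: "('a \<Rightarrow> 'a \<Rightarrow> bool) \<Rightarrow> 'a list \<Rightarrow> bool" where
  "closed_walk A p \<longleftrightarrow> 3 \<le> length p \<and> distinct p \<and> successively A p \<and> A (last p) (hd p)"

lemma closed_walk_nth:
  assumes "closed_walk A p" "i < length p"
  shows "A (p ! i) (p ! (Suc i mod length p))"
proof (cases "Suc i = length p")
  case True
  then have "i = length p - 1" "p \<noteq> []" by auto
  then show ?thesis using assms True by (auto simp: closed_walk_def last_conv_nth hd_conv_nth)
next
  case False
  then show ?thesis using assms by (auto simp: closed_walk_def successively_conv_nth)
qed

text \<open>In a longest path, both neighbours of the first vertex lie on the path. One of them has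
  index at least 2, and it must be the last vertex: an inner vertex would have a third neighbour.
  The cycle so obtained already uses up both neighbours of each of its vertices, hence no edge
  leaves it.\<close>

lemma exists_closed_walk:
  assumes fin: "finite T" and ne: "T \<noteq> {}" and sym: "\<And>x y. A x y \<Longrightarrow> A y x" and irr: "\<And>x. \<not> A x x"
    and closed: "\<And>u v. v \<in> T \<Longrightarrow> A u v \<Longrightarrow> u \<in> T"
    and two: "\<And>v. v \<in> T \<Longrightarrow> card {u. A u v} = 2"
  shows "\<exists>p. closed_walk A p \<and> set p \<subseteq> T \<and> (\<forall>v\<in>set p. \<forall>u. A u v \<longrightarrow> u \<in> set p)"
proof -
  let ?P = "\<lambda>p. p \<noteq> [] \<and> set p \<subseteq> T \<and> distinct p \<and> successively A p"
  obtain t where "t \<in> T" using ne by blast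
  then have "?P [t]" by simp
  moreover have "\<forall>q. ?P q \<longrightarrow> length q < Suc (card T)"
    using card_mono[OF fin] by (auto simp: distinct_card[symmetric] less_Suc_eq_le)
  ultimately obtain p where p: "?P p" and max: "\<And>q. ?P q \<Longrightarrow> length q \<le> length p"
    using ex_has_greatest_nat[of ?P "[t]" length "Suc (card T)"] by blast
  let ?l = "length p"
  have idx: "p ! a = p ! b \<longleftrightarrow> a = b" if "a < ?l" "b < ?l" for a b
    using p that by (simp add: nth_eq_iff_index_eq)
  have l0: "0 < ?l" using p by simp
  let ?x = "p ! 0"
  have xT: "?x \<in> T" using p l0 by (metis nth_mem subsetD)
  have in_p: "u \<in> set p" if "A u ?x" for u
  proof (rule ccontr)
    assume "u \<notin> set p"
    then have "?P (u # p)" using p that closed[OF xT that] l0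
      by (auto simp: successively_Cons hd_conv_nth)
    then show False using max[of "u # p"] by simp
  qed
  obtain a b where ab: "{u. A u ?x} = {a, b}" "a \<noteq> b" using two[OF xT] by (auto simp: card_2_iff)
  have "\<exists>j. 2 \<le> j \<and> j < ?l \<and> A (p ! j) ?x"
  proof -
    obtain i where i: "i < ?l" "p ! i = a" using in_p[of a] ab by (auto simp: in_set_conv_nth)
    obtain j where j: "j < ?l" "p ! j = b" using in_p[of b] ab by (auto simp: in_set_conv_nth)
    have "A a ?x" "A b ?x" using ab by auto
    moreover from calculation have "a \<noteq> ?x" "b \<noteq> ?x" using irr[of ?x] by auto
    then have "i \<noteq> 0" "j \<noteq> 0" using i(2) j(2) by (cases "i = 0"; cases "j = 0"; simp)+
    moreover have "i \<noteq> j" using i(2) j(2) ab(2) by blast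
    ultimately have "2 \<le> i \<or> 2 \<le> j" "A (p ! i) ?x" "A (p ! j) ?x" using i j by auto
    then show ?thesis using i(1) j(1) by blast
  qed
  then obtain j where j: "2 \<le> j" "j < ?l" "A (p ! j) ?x" by blast
  have last: "Suc j = ?l"
  proof (rule ccontr)
    assume "Suc j \<noteq> ?l"
    then have j': "Suc j < ?l" using j by simp
    have "Suc (j - 1) = j" using j by simp
    moreover have "A (p ! k) (p ! Suc k)" if "Suc k < ?l" for k
      using p that by (simp add: successively_conv_nth)
    ultimately have "A (p ! (j - 1)) (p ! j)" using j(2) by metis
    moreover have "A (p ! Suc j) (p ! j)" using p j' sym by (auto simp: successively_conv_nth)
    moreover have "A ?x (p ! j)" using j sym by blast
    \<comment> \<open>Predecessor, successor and first vertex of the path are three different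
      neighbours of \<open>p ! j\<close>.\<close>
    ultimately have sub: "{p ! (j - 1), p ! Suc j, ?x} \<subseteq> {u. A u (p ! j)}" by auto
    have "card {p ! (j - 1), p ! Suc j, ?x} = 3"
      using j j' idx l0 by (subst card_insert_disjoint | simp)+
    moreover have "p ! j \<in> T" using p j by (metis nth_mem subsetD)
    ultimately have "3 \<le> card {u. A u (p ! j)}" "card {u. A u (p ! j)} = 2"
      using two[of "p ! j"] card_mono[OF card_ge_0_finite sub] by auto
    then show False by simp
  qed
  have cw: "closed_walk A p"
  proof -
    have "last p = p ! j" using last p by (metis diff_Suc_1 last_conv_nth)
    then show ?thesis using p j last l0 by (simp add: closed_walk_def hd_conv_nth)
  qed
  have "\<forall>v\<in>set p. \<forall>u. A u v \<longrightarrow> u \<in> set p"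
  proof (intro ballI allI impI)
    fix v u assume "v \<in> set p" and u: "A u v"
    then obtain k where k: "k < ?l" "v = p ! k" by (auto simp: in_set_conv_nth)
    define B where "B x y \<longleftrightarrow> (\<exists>i<?l. (x = p ! i \<and> y = p ! (Suc i mod ?l)) \<or> (y = p ! i \<and> x = p ! (Suc i mod ?l)))" for x y
    have p3: "distinct p" "3 \<le> ?l" using cw by (auto simp: closed_walk_def)
    note adj = adjacent_indices_cycle[OF p3 k(1) B_def]
    have "A x y" if "B x y" for x y using that closed_walk_nth[OF cw] sym unfolding B_def by blast
    then have sub: "{u. B u v} \<subseteq> {u. A u v}" by auto
    have "v \<in> T" using k p by auto
    then have "card {u. A u v} = 2" by (rule two)
    moreover have "card {u. B u v} = 2" using adj k by simp
    moreover have "finite {u. A u v}" using calculation(1) by (metis card.infinite zero_neq_numeral)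
    ultimately have "{u. B u v} = {u. A u v}" using sub by (metis card_subset_eq)
    then have "B u v" using u by auto
    moreover have "x \<in> set p" if "B x y" for x y
    proof -
      have "a mod ?l < ?l" for a using l0 by simp
      then show ?thesis using that unfolding B_def by (metis nth_mem)
    qed
    ultimately show "u \<in> set p" by blast
  qed
  then show ?thesis using cw p by blast
qed

text \<open>No edge leaves the cycle found, so what remains after its removal is 2-regular
  again.\<close>

lemma two_regular_cycle_cover:
  assumes "finite T" and sym: "\<And>x y. A x y \<Longrightarrow> A y x" and irr: "\<And>x. \<not> A x x"
    and "\<And>u v. v \<in> T \<Longrightarrow> A u v \<Longrightarrow> u \<in> T" and "\<And>v. v \<in> T \<Longrightarrow> card {u. A u v} = 2"
  shows "\<exists>C. finite C \<and> (\<forall>p\<in>C. closed_walk A p \<and> (\<forall>v\<in>set p. \<forall>u. A u v \<longrightarrow> u \<in> set p)) \<and>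
     pairwise (\<lambda>p q. disjnt (set p) (set q)) C \<and> (\<Union>p\<in>C. set p) = T"
  using assms(1,4,5)
proof (induction T rule: finite_psubset_induct)
  case (psubset T)
  show ?case
  proof (cases "T = {}")
    case True
    then show ?thesis by (intro exI[of _ "{}"]) auto
  next
    case False
    obtain p where p: "closed_walk A p" "set p \<subseteq> T" "\<forall>v\<in>set p. \<forall>u. A u v \<longrightarrow> u \<in> set p"
    proof -
      have "\<exists>p. closed_walk A p \<and> set p \<subseteq> T \<and> (\<forall>v\<in>set p. \<forall>u. A u v \<longrightarrow> u \<in> set p)"
        by (rule exists_closed_walk) (use psubset(1,3,4) False sym irr in auto)
      then show ?thesis using that by blast
    qed
    have "p \<noteq> []" using p(1) by (auto simp: closed_walk_def)
    then have "hd p \<in> T \<inter> set p" using p(2) by auto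
    then have "T - set p \<subset> T" by blast
    moreover have "u \<in> T - set p" if "v \<in> T - set p" "A u v" for u v
      using that psubset(3)[of v u] p(3) sym by blast
    moreover have "card {u. A u v} = 2" if "v \<in> T - set p" for v using psubset(4) that by blast
    ultimately have "\<exists>C. finite C \<and> (\<forall>p\<in>C. closed_walk A p \<and> (\<forall>v\<in>set p. \<forall>u. A u v \<longrightarrow> u \<in> set p)) \<and>
       pairwise (\<lambda>p q. disjnt (set p) (set q)) C \<and> (\<Union>p\<in>C. set p) = T - set p"
      by (rule psubset(2))
    then obtain C where C: "finite C" "\<forall>p\<in>C. closed_walk A p \<and> (\<forall>v\<in>set p. \<forall>u. A u v \<longrightarrow> u \<in> set p)"
      "pairwise (\<lambda>p q. disjnt (set p) (set q)) C" "(\<Union>p\<in>C. set p) = T - set p"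
      by blast
    show ?thesis
    proof (intro exI[of _ "insert p C"] conjI)
      show "pairwise (\<lambda>p q. disjnt (set p) (set q)) (insert p C)"
      proof -
        have "disjnt (set p) (set q)" "disjnt (set q) (set p)" if "q \<in> C" for q
          using C(4) that by (auto simp: disjnt_def)
        then show ?thesis using C(3) unfolding pairwise_insert by blast
      qed
      show "(\<Union>p\<in>insert p C. set p) = T" using C(4) p(2) by auto
    qed (use C(1,2) p(1,3) in auto)
  qed
qed

lemma simple_cycle_iff:
  "simple_cycle V E p \<longleftrightarrow> set p \<subseteq> V \<and> closed_walk (\<lambda>u v. {u, v} \<in> E) p"
  by (auto simp: simple_cycle_def simple_path_def closed_walk_def)

text \<open>Sending an incident edge to its other end is injective because each edge is listed in
  one direction only.\<close>

lemma deg_neighbours: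
  assumes "\<And>u v. (u, v) \<in> X \<Longrightarrow> (v, u) \<notin> X"
  shows "deg X v = card {u. (u, v) \<in> X \<or> (v, u) \<in> X}"
  unfolding deg_def
proof (rule bij_betw_same_card)
  show "bij_betw (\<lambda>e. if fst e = v then snd e else fst e) {e \<in> X. fst e = v \<or> snd e = v}
      {u. (u, v) \<in> X \<or> (v, u) \<in> X}"
    unfolding bij_betw_def
  proof
    show "inj_on (\<lambda>e. if fst e = v then snd e else fst e) {e \<in> X. fst e = v \<or> snd e = v}"
      using assms by (auto simp: inj_on_def)
    show "(\<lambda>e. if fst e = v then snd e else fst e) ` {e \<in> X. fst e = v \<or> snd e = v} =
        {u. (u, v) \<in> X \<or> (v, u) \<in> X}" (is "?f ` ?A = ?B")
    proof (intro subset_antisym subsetI)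
      fix u assume "u \<in> ?B"
      then show "u \<in> ?f ` ?A"
      proof (cases "(v, u) \<in> X")
        case True
        then show ?thesis by (intro image_eqI[of _ _ "(v, u)"]) auto
      next
        case False
        then show ?thesis using \<open>u \<in> ?B\<close> by (intro image_eqI[of _ _ "(u, v)"]) auto
      qed
    qed auto
  qed
qed

section \<open>Good pairs and vertex-disjoint cycles\<close>

context cut_count
begin

definition edges :: "nat set set" where "edges = (\<lambda>(u, v). {u, v}) ` EA"

text \<open>Each cycle is closed under adjacency in \<open>X\<close> and thus contains a mark.
  Disjoint cycles have different marks, so there are at most \<open>m\<close> of them; and
  \<open>m \<le> s\<close> because marks are touched vertices.\<close>

lemma good_imp_cycles:
  assumes anti: "\<And>u v. (u, v) \<in> EA \<Longrightarrow> (v, u) \<notin> EA" and g: "(X, M) \<in> good s m"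
  shows "\<exists>C. finite C \<and> card C \<le> m \<and> m \<le> s \<and> (\<forall>p\<in>C. simple_cycle V edges p) \<and>
    pairwise (\<lambda>p q. disjnt (set p) (set q)) C \<and> card (\<Union>p\<in>C. set p) = s"
proof -
  have X: "X \<subseteq> EA" and M: "M \<subseteq> touched X" "hits X M" "card M = m"
    and d: "\<And>v. v \<in> touched X \<Longrightarrow> deg X v = 2" and s: "card (touched X) = s"
    using g by (auto simp: good_def)
  have fT: "finite (touched X)" using touched_V[OF X] finV finite_subset by blast
  have fM: "finite M" using M(1) fT finite_subset by blast
  define A where "A u v \<longleftrightarrow> (u, v) \<in> X \<or> (v, u) \<in> X" for u v
  have "(v, u) \<notin> X" if "(u, v) \<in> X" for u v using X that anti by blast
  note deg = deg_neighbours[OF this, folded A_def]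
  have "\<exists>C. finite C \<and> (\<forall>p\<in>C. closed_walk A p \<and> (\<forall>v\<in>set p. \<forall>u. A u v \<longrightarrow> u \<in> set p)) \<and>
     pairwise (\<lambda>p q. disjnt (set p) (set q)) C \<and> (\<Union>p\<in>C. set p) = touched X"
  proof (rule two_regular_cycle_cover[OF fT])
    show "\<not> A x x" for x using irr[of "(x, x)"] X by (auto simp: A_def)
    show "u \<in> touched X" if "A u v" for u v using that by (force simp: A_def touched_def)
    show "card {u. A u v} = 2" if "v \<in> touched X" for v using d[OF that] deg by simp
  qed (auto simp: A_def)
  then obtain C where C': "finite C"
    "\<forall>p\<in>C. closed_walk A p \<and> (\<forall>v\<in>set p. \<forall>u. A u v \<longrightarrow> u \<in> set p)"
    "pairwise (\<lambda>p q. disjnt (set p) (set q)) C" "(\<Union>p\<in>C. set p) = touched X"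
    by (elim exE conjE)
  then have "closed_walk A p" if "p \<in> C" for p using that by simp
  moreover have "u \<in> set p" if "p \<in> C" "v \<in> set p" "A u v" for p u v
    using C'(2) that by simp
  ultimately have C: "finite C" "\<And>p. p \<in> C \<Longrightarrow> closed_walk A p"
    "\<And>p u v. p \<in> C \<Longrightarrow> v \<in> set p \<Longrightarrow> A u v \<Longrightarrow> u \<in> set p"
    "pairwise (\<lambda>p q. disjnt (set p) (set q)) C" "(\<Union>p\<in>C. set p) = touched X"
    using C'(1,3,4) by simp_all
  have meet: "set p \<inter> M \<noteq> {}" if p: "p \<in> C" for p
  proof -
    have "closed_under X (set p)"
      unfolding closed_under_def using C(3)[OF p] by (auto simp: A_def)
    moreover have "set p \<noteq> {}" "set p \<subseteq> touched X" using C(2)[OF p] C(5) p by (auto simp: closed_walk_def)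
    ultimately show ?thesis using M(2) unfolding hits_def by blast
  qed
  define f where "f p = (SOME x. x \<in> set p \<inter> M)" for p
  have f: "f p \<in> set p \<inter> M" if "p \<in> C" for p
    unfolding f_def using meet[OF that] by (meson ex_in_conv someI_ex)
  have "inj_on f C"
  proof (rule inj_onI)
    fix p q assume pq: "p \<in> C" "q \<in> C" "f p = f q"
    then have "f p \<in> set p \<inter> set q" using f[of p] f[of q] by simp
    then have "\<not> disjnt (set p) (set q)" unfolding disjnt_def by blast
    then show "p = q" using C(4) pq by (auto simp: pairwise_def)
  qed
  then have "card C \<le> m" using card_inj_on_le[of f C M] f fM M(3) by blast
  moreover have "m \<le> s" using card_mono[OF fT M(1)] M(3) s by simp
  moreover have "simple_cycle V edges p" if p: "p \<in> C" for p
    unfolding simple_cycle_iff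
  proof
    show "set p \<subseteq> V" using C(5) p touched_V[OF X] by blast
    have "{u, v} \<in> edges" if "A u v" for u v
      using that X by (auto simp: A_def edges_def doubleton_eq_iff image_iff split: prod.splits)
    moreover have "successively A p" "A (last p) (hd p)" using C(2)[OF p] by (auto simp: closed_walk_def)
    ultimately show "closed_walk (\<lambda>u v. {u, v} \<in> edges) p"
      using C(2)[OF p] successively_mono[of A p "\<lambda>u v. {u, v} \<in> edges"] unfolding closed_walk_def by blast
  qed
  ultimately show ?thesis using C s by (intro exI[of _ C]) auto
qed

text \<open>The first vertices of the cycles serve as marks. They are filled up with arbitrary
  vertices of the cycles to exactly \<open>m\<close> marks, which is where
  \<open>card C \<le> m\<close> and \<open>m \<le> s\<close> enter.\<close>

lemma cycles_imp_good:
  assumes anti: "\<And>u v. (u, v) \<in> EA \<Longrightarrow> (v, u) \<notin> EA"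
    and C: "finite C" "card C \<le> m" "m \<le> s" "\<And>p. p \<in> C \<Longrightarrow> simple_cycle V edges p"
    "pairwise (\<lambda>p q. disjnt (set p) (set q)) C" "card (\<Union>p\<in>C. set p) = s"
  shows "good s m \<noteq> {}"
proof -
  define B where "B p x y \<longleftrightarrow> (\<exists>i<length p. (x = p ! i \<and> y = p ! (Suc i mod length p)) \<or> (y = p ! i \<and> x = p ! (Suc i mod length p)))"
    for p :: "nat list" and x y
  let ?T = "\<Union>p\<in>C. set p"
  define X where "X = {(u, v) \<in> EA. \<exists>p\<in>C. B p u v}"
  have cw: "closed_walk (\<lambda>u v. {u, v} \<in> edges) p" "set p \<subseteq> V" if "p \<in> C" for p
    using C(4)[OF that] unfolding simple_cycle_iff by auto
  have X: "X \<subseteq> EA" by (auto simp: X_def)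
  have l3: "3 \<le> length p" "distinct p" if "p \<in> C" for p using cw[OF that] by (auto simp: closed_walk_def)
  have Bsym: "B p x y \<Longrightarrow> B p y x" for p x y by (auto simp: B_def)
  have Bset: "x \<in> set p" "y \<in> set p" if "p \<in> C" "B p x y" for p x y
  proof -
    have "a mod length p < length p" for a using l3[OF that(1)] by (intro mod_less_divisor) linarith
    then show "x \<in> set p" "y \<in> set p" using that(2) unfolding B_def by (metis nth_mem)+
  qed
  have Bedge: "{x, y} \<in> edges" if "p \<in> C" "B p x y" for p x y
    using that(2) closed_walk_nth[OF cw(1)[OF that(1)]] unfolding B_def by (auto simp: insert_commute)
  have adj: "(u, v) \<in> X \<or> (v, u) \<in> X \<longleftrightarrow> (\<exists>p\<in>C. B p u v)" for u v
  proof
    assume "\<exists>p\<in>C. B p u v"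
    then obtain p where p: "p \<in> C" "B p u v" by blast
    then have "(u, v) \<in> EA \<or> (v, u) \<in> EA" using Bedge[OF p] by (auto simp: edges_def doubleton_eq_iff)
    then show "(u, v) \<in> X \<or> (v, u) \<in> X" using p Bsym by (auto simp: X_def)
  qed (use Bsym in \<open>auto simp: X_def\<close>)
  have uniq: "p = q" if "p \<in> C" "q \<in> C" "v \<in> set p" "v \<in> set q" for p q v
    using C(5) that by (auto simp: pairwise_def disjnt_def)
  have nb: "card {u. (u, v) \<in> X \<or> (v, u) \<in> X} = 2" if v: "v \<in> ?T" for v
  proof -
    obtain p where p: "p \<in> C" "v \<in> set p" using v by blast
    then obtain j where j: "j < length p" "v = p ! j" by (auto simp: in_set_conv_nth)
    have "{u. (u, v) \<in> X \<or> (v, u) \<in> X} = {u. B p u v}"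
      using uniq[OF p(1) _ p(2)] Bset p(1) unfolding adj by blast
    also have "card \<dots> = 2"
      using adjacent_indices_cycle[OF l3(2,1)[OF p(1)] j(1) B_def] j(2) by simp
    finally show ?thesis .
  qed
  have T: "touched X = ?T"
  proof (intro subset_antisym subsetI)
    fix v assume "v \<in> touched X"
    then have "\<exists>u. (u, v) \<in> X \<or> (v, u) \<in> X" by (auto simp: touched_def)
    then obtain u where "(u, v) \<in> X \<or> (v, u) \<in> X" by blast
    then obtain p where "p \<in> C" "B p u v" unfolding adj by blast
    then show "v \<in> ?T" using Bset(2) by blast
  next
    fix v assume "v \<in> ?T"
    then have "{u. (u, v) \<in> X \<or> (v, u) \<in> X} \<noteq> {}" using nb[of v] by (metis card.empty zero_neq_numeral)
    then show "v \<in> touched X" by (force simp: touched_def)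
  qed
  have "(v, u) \<notin> X" if "(u, v) \<in> X" for u v using X that anti by blast
  then have deg: "deg X v = 2" if "v \<in> touched X" for v
    using nb that deg_neighbours[of X v] unfolding T by simp
  have fX: "finite X" using X finEA finite_subset by blast
  have fT: "finite (touched X)" using touched_V[OF X] finV finite_subset by blast
  have "2 * card X = 2 * card (touched X)"
  proof -
    have "fst e \<noteq> snd e" if "e \<in> X" for e using irr X that by blast
    from sum_high_deg[OF fX fT order_refl this, of "\<lambda>_. 1"] show ?thesis using deg by simp
  qed
  then have cX: "card X = s" using C(6) T by simp
  have ne: "p \<noteq> []" if "p \<in> C" for p using l3[OF that] by auto
  have "hd ` C \<subseteq> touched X" unfolding T using ne by force
  moreover have "card (hd ` C) \<le> m" using card_image_le[OF C(1), of hd] C(2) by simp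
  ultimately obtain M where M: "hd ` C \<subseteq> M" "M \<subseteq> touched X" "card M = m"
    using exists_subset_between[of "hd ` C" m "touched X"] C(3,6) T fT by auto
  have "hits X M"
    unfolding hits_def
  proof (intro allI impI)
    \<comment> \<open>A closed set that meets a cycle contains all of it, in particular its marked
      first vertex.\<close>
    fix D assume D: "D \<subseteq> touched X" "D \<noteq> {}" "closed_under X D"
    then obtain p v where p: "p \<in> C" "v \<in> set p" "v \<in> D" unfolding T by blast
    then obtain j where j: "j < length p" "v = p ! j" by (auto simp: in_set_conv_nth)
    have step: "x \<in> D \<longleftrightarrow> y \<in> D" if "B p x y" for x y
      using adj[of x y] that p(1) D(3) by (auto simp: closed_under_def)
    have st: "p ! i \<in> D \<longleftrightarrow> p ! Suc i \<in> D" if "Suc i < length p" for i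
      using that by (intro step) (auto simp: B_def intro!: exI[of _ i])
    have "p ! 0 \<in> D \<longleftrightarrow> p ! i \<in> D" if "i < length p" for i
      using that by (induction i) (use st in auto)
    then have "hd p \<in> D" using j p ne[OF p(1)] by (simp add: hd_conv_nth)
    then show "D \<inter> M \<noteq> {}" using M(1) p(1) by blast
  qed
  then have "(X, M) \<in> good s m"
    using X M deg C(6) T cX by (auto simp: good_def)
  then show ?thesis by blast
qed

end

section \<open>Isolation\<close>

text \<open>Horner evaluation: bit 0 is the most significant one, so the machine can read the cells
  of a weight in increasing order.\<close>

primrec binval :: "(nat \<Rightarrow> nat) \<Rightarrow> nat \<Rightarrow> nat" where
  "binval f 0 = 0"
| "binval f (Suc j) = 2 * binval f j + f j"

lemma binval_inject:
  "binval (\<lambda>j. of_bool (f j)) b = binval (\<lambda>j. of_bool (g j)) b \<Longrightarrow> j < b \<Longrightarrow> f j = g j"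
proof (induction b)
  case (Suc b)
  have "odd (binval (\<lambda>j. of_bool (f j)) (Suc b)) = f b" "odd (binval (\<lambda>j. of_bool (g j)) (Suc b)) = g b"
    by auto
  then have fb: "f b = g b" using Suc.prems(1) by metis
  then have "binval (\<lambda>j. of_bool (f j)) b = binval (\<lambda>j. of_bool (g j)) b" using Suc.prems(1) by simp
  then show ?case using Suc fb by (cases "j = b") auto
qed simp

lemma binval_less: "(\<And>j. j < b \<Longrightarrow> f j \<le> 1) \<Longrightarrow> binval f b < 2 ^ b"
proof (induction b)
  case (Suc b)
  then have "binval f b < 2 ^ b" "f b \<le> 1" by auto
  then show ?case by simp
qed simp

lemma binval_cong: "(\<And>j. j < b \<Longrightarrow> f j = g j) \<Longrightarrow> binval f b = binval g b"
  by (induction b) auto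

definition bit_weight :: "(nat \<Rightarrow> bool) \<Rightarrow> nat \<Rightarrow> nat \<Rightarrow> nat" where
  "bit_weight f b i = binval (\<lambda>j. of_bool (f (i * b + j))) b"

lemma bit_weight_less: "bit_weight f b i < 2 ^ b"
  unfolding bit_weight_def by (rule binval_less) simp

text \<open>Here \<open>bad\<close> is the event that one lightest set contains \<open>i\<close> and
  another one does not. Fix all bits outside the weight of \<open>i\<close>. When that weight grows,
  the sets without \<open>i\<close> keep their weight and those with \<open>i\<close> become
  heavier, so the two minima can tie for at most one value. Hence erasing the \<open>b\<close> bits
  of \<open>i\<close> is injective on \<open>bad\<close>. The sample space consists of the functions
  that are \<open>False\<close> outside the index range, as in \<open>Pi_pmf\<close>.\<close>

lemma isolation_card:
  fixes G :: "nat set set" and q b i :: nat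
  defines "B \<equiv> PiE_dflt {..<q * b} False (\<lambda>_. UNIV :: bool set)"
  defines "W \<equiv> \<lambda>f Y. \<Sum>i\<in>Y. bit_weight f b i"
  assumes G: "\<And>Y. Y \<in> G \<Longrightarrow> Y \<subseteq> {..<q}" and i: "i < q"
  defines "bad \<equiv> {f \<in> B. \<exists>Y\<in>G. \<exists>Z\<in>G. i \<in> Y \<and> i \<notin> Z \<and> (\<forall>V\<in>G. W f Y \<le> W f V) \<and> (\<forall>V\<in>G. W f Z \<le> W f V)}"
  shows "card bad * 2 ^ b \<le> 2 ^ (q * b)"
proof -
  let ?K = "{i * b..<i * b + b}"
  define r where "r f = (\<lambda>j. if j \<in> ?K then False else f j)" for f :: "nat \<Rightarrow> bool"
  have finY: "finite Y" if "Y \<in> G" for Y using G[OF that] finite_subset by blast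
  have "Suc i * b \<le> q * b" using i by (intro mult_le_mono1) simp
  then have K: "?K \<subseteq> {..<q * b}" by auto
  have off: "bit_weight f b k = bit_weight g b k" if "r f = r g" "k \<noteq> i" for f g k
    unfolding bit_weight_def
  proof (rule binval_cong)
    fix j assume j: "j < b"
    have "k * b + j \<notin> ?K"
    proof (cases "k < i")
      case True
      then have "Suc k * b \<le> i * b" by (intro mult_le_mono1) simp
      then show ?thesis using j by simp
    next
      case False
      then have "Suc i * b \<le> k * b" using that(2) by (intro mult_le_mono1) simp
      then show ?thesis by simp
    qed
    then have "f (k * b + j) = g (k * b + j)" using fun_cong[OF that(1), of "k * b + j"] by (simp only: r_def if_False)
    then show "of_bool (f (k * b + j)) = of_bool (g (k * b + j))" by simp
  qed
  have not_less: "\<not> bit_weight f b i < bit_weight g b i" if f: "f \<in> bad" and g: "g \<in> bad" and eq: "r f = r g" for f g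
  proof
    assume lt: "bit_weight f b i < bit_weight g b i"
    obtain Y Z where YZ: "Y \<in> G" "Z \<in> G" "i \<in> Y" "i \<notin> Z" "\<And>V. V \<in> G \<Longrightarrow> W f Y \<le> W f V" "\<And>V. V \<in> G \<Longrightarrow> W f Z \<le> W f V"
      using f unfolding bad_def by blast
    obtain Y' Z' where YZ': "Y' \<in> G" "Z' \<in> G" "i \<in> Y'" "i \<notin> Z'" "\<And>V. V \<in> G \<Longrightarrow> W g Y' \<le> W g V" "\<And>V. V \<in> G \<Longrightarrow> W g Z' \<le> W g V"
      using g unfolding bad_def by blast
    have same: "W f V = W g V" if "i \<notin> V" for V
      unfolding W_def
    proof (rule sum.cong[OF refl])
      fix k assume "k \<in> V"
      then have "k \<noteq> i" using that by blast
      then show "bit_weight f b k = bit_weight g b k" by (rule off[OF eq])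
    qed
    have "W g Z' \<le> W g Z" using YZ'(6) YZ(2) by blast
    also have "\<dots> = W f Z" using same[OF YZ(4)] by simp
    also have "\<dots> \<le> W f Y'" using YZ(6) YZ'(1) by blast
    also have "\<dots> = bit_weight f b i + W f (Y' - {i})"
      unfolding W_def using finY[OF YZ'(1)] YZ'(3) by (rule sum.remove)
    also have "\<dots> < bit_weight g b i + W g (Y' - {i})" using lt same[of "Y' - {i}"] by simp
    also have "\<dots> = W g Y'"
      unfolding W_def using finY[OF YZ'(1)] YZ'(3) by (rule sum.remove[symmetric])
    also have "\<dots> \<le> W g Z'" using YZ'(5,2) by blast
    finally show False by simp
  qed
  have "inj_on r bad"
  proof (rule inj_onI)
    fix f g assume fg: "f \<in> bad" "g \<in> bad" and eq: "r f = r g"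
    then have e: "bit_weight f b i = bit_weight g b i" using not_less[of f g] not_less[of g f] by simp
    show "f = g"
    proof
      fix j
      show "f j = g j"
      proof (cases "j \<in> ?K")
        case True
        then obtain t where t: "j = i * b + t" "t < b" by (metis add_less_cancel_left atLeastLessThan_iff le_iff_add)
        show ?thesis using binval_inject[OF e[unfolded bit_weight_def] t(2)] t(1) by simp
      next
        case False
        then show ?thesis using fun_cong[OF eq, of j] by (simp only: r_def if_False)
      qed
    qed
  qed
  moreover have "r ` bad \<subseteq> PiE_dflt ({..<q * b} - ?K) False (\<lambda>_. UNIV)"
    by (auto simp: bad_def B_def r_def PiE_dflt_def)
  ultimately have "card bad \<le> card (PiE_dflt ({..<q * b} - ?K) False (\<lambda>_. UNIV :: bool set))"
    by (intro card_inj_on_le) auto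
  also have "\<dots> = 2 ^ (q * b - b)"
    using K by (subst card_PiE_dflt) (auto simp: card_Diff_subset card_UNIV_bool)
  finally have "card bad * 2 ^ b \<le> 2 ^ (q * b - b) * 2 ^ b" by simp
  also have "\<dots> = 2 ^ (q * b)"
  proof -
    have "b \<le> q * b" using i by simp
    then show ?thesis by (simp add: power_add[symmetric])
  qed
  finally show ?thesis .
qed

text \<open>If every weight class is even, the class of minimal weight has two members. Their images
  under \<open>S\<close> differ in some \<open>i\<close>, which is then ambiguous. The union bound
  over \<open>q\<close> indices gives probability at most \<open>q / 2 ^ b\<close>.\<close>

lemma isolation:
  fixes G :: "'y set" and S :: "'y \<Rightarrow> nat set"
  assumes fin: "finite G" and ne: "G \<noteq> {}" and inj: "inj_on S G" and S: "\<And>Y. Y \<in> G \<Longrightarrow> S Y \<subseteq> {..<q}"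
    and b: "2 * q \<le> 2 ^ b"
  shows "measure_pmf.prob (Pi_pmf {..<q * b} False (\<lambda>_. bernoulli_pmf (1 / 2)))
    {f. \<forall>a. even (card {Y \<in> G. (\<Sum>i\<in>S Y. bit_weight f b i) = a})} \<le> 1 / 2"
proof -
  let ?W = "\<lambda>f Y. \<Sum>i\<in>Y. bit_weight f b i"
  let ?B = "PiE_dflt {..<q * b} False (\<lambda>_. UNIV :: bool set)"
  define bad where "bad i = {f \<in> ?B. \<exists>Y\<in>S ` G. \<exists>Z\<in>S ` G. i \<in> Y \<and> i \<notin> Z \<and> (\<forall>V\<in>S ` G. ?W f Y \<le> ?W f V) \<and> (\<forall>V\<in>S ` G. ?W f Z \<le> ?W f V)}" for i
  let ?A = "{f. \<forall>a. even (card {Y \<in> G. ?W f (S Y) = a})}"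
  have finB: "finite ?B" by auto
  have cB: "card ?B = 2 ^ (q * b)" by (subst card_PiE_dflt) (auto simp: card_UNIV_bool)
  have "?B \<inter> ?A \<subseteq> (\<Union>i<q. bad i)"
  proof
    fix f assume f: "f \<in> ?B \<inter> ?A"
    define a where "a = Min ((\<lambda>Y. ?W f (S Y)) ` G)"
    have "a \<in> (\<lambda>Y. ?W f (S Y)) ` G" unfolding a_def using fin ne by (intro Min_in) auto
    then obtain Y where Y: "Y \<in> G" "?W f (S Y) = a" by auto
    have min: "a \<le> ?W f (S Z)" if "Z \<in> G" for Z unfolding a_def using fin that by auto
    have "{Y \<in> G. ?W f (S Y) = a} \<noteq> {Y}"
    proof
      assume "{Y \<in> G. ?W f (S Y) = a} = {Y}"
      then have "card {Y \<in> G. ?W f (S Y) = a} = 1" by simp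
      moreover have "even (card {Y \<in> G. ?W f (S Y) = a})" using f by blast
      ultimately show False by simp
    qed
    moreover have "Y \<in> {Y \<in> G. ?W f (S Y) = a}" using Y by simp
    ultimately obtain Z where Z: "Z \<in> G" "?W f (S Z) = a" "Z \<noteq> Y" by blast
    then have "S Y \<noteq> S Z" using inj Y by (auto simp: inj_on_def)
    then obtain i where i: "i \<in> S Y \<and> i \<notin> S Z \<or> i \<in> S Z \<and> i \<notin> S Y" by blast
    then have "i < q" using S[OF Y(1)] S[OF Z(1)] by auto
    moreover have "f \<in> bad i"
    proof -
      have minY: "\<forall>V\<in>S ` G. ?W f (S Y) \<le> ?W f V" and minZ: "\<forall>V\<in>S ` G. ?W f (S Z) \<le> ?W f V"
        using min Y(2) Z(2) by auto
      have "\<exists>Y\<in>S ` G. \<exists>Z\<in>S ` G. i \<in> Y \<and> i \<notin> Z \<and> (\<forall>V\<in>S ` G. ?W f Y \<le> ?W f V) \<and> (\<forall>V\<in>S ` G. ?W f Z \<le> ?W f V)"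
        using i
      proof
        assume "i \<in> S Y \<and> i \<notin> S Z"
        then show ?thesis using Y(1) Z(1) minY minZ by (blast intro: rev_image_eqI)
      next
        assume "i \<in> S Z \<and> i \<notin> S Y"
        then show ?thesis using Y(1) Z(1) minY minZ by (blast intro: rev_image_eqI)
      qed
      moreover have "f \<in> ?B" using f by blast
      ultimately show ?thesis unfolding bad_def by (intro CollectI conjI)
    qed
    ultimately show "f \<in> (\<Union>i<q. bad i)" by blast
  qed
  moreover have "finite (\<Union>i<q. bad i)"
    by (rule finite_subset[OF _ finB]) (simp only: bad_def, blast)
  ultimately have "card (?B \<inter> ?A) \<le> card (\<Union>i<q. bad i)" by (intro card_mono)
  also have "\<dots> \<le> (\<Sum>i<q. card (bad i))" by (rule card_UN_le) simp
  finally have "card (?B \<inter> ?A) * 2 ^ b \<le> (\<Sum>i<q. card (bad i) * 2 ^ b)"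
    unfolding sum_distrib_right[symmetric] by (rule mult_le_mono1)
  also have "\<dots> \<le> (\<Sum>i<q. 2 ^ (q * b))"
  proof (rule sum_mono)
    fix i assume "i \<in> {..<q}"
    then show "card (bad i) * 2 ^ b \<le> 2 ^ (q * b)"
      unfolding bad_def using S by (intro isolation_card) auto
  qed
  also have "\<dots> = q * card ?B" using cB by simp
  finally have "card (?B \<inter> ?A) * 2 ^ b \<le> q * card ?B" .
  then have "2 * card (?B \<inter> ?A) * 2 ^ b \<le> (2 * q) * card ?B" by simp
  also have "\<dots> \<le> 2 ^ b * card ?B" using b by simp
  finally have le: "2 * card (?B \<inter> ?A) \<le> card ?B" by simp
  have "Pi_pmf {..<q * b} False (\<lambda>_. bernoulli_pmf (1 / 2)) = pmf_of_set ?B"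
    unfolding bernoulli_pmf_half_conv_pmf_of_set by (subst Pi_pmf_of_set) auto
  then have "measure_pmf.prob (Pi_pmf {..<q * b} False (\<lambda>_. bernoulli_pmf (1 / 2))) ?A = card (?B \<inter> ?A) / card ?B"
    using finB by (subst \<open>_ = pmf_of_set _\<close>) (rule measure_pmf_of_set; auto)
  also have "\<dots> \<le> 1 / 2"
  proof -
    have half: "real x / real y \<le> 1 / 2" if "2 * x \<le> y" "0 < y" for x y :: nat
      using that by (simp add: field_simps)
    have "0 < card ?B" unfolding cB by simp
    from half[OF le this] show ?thesis .
  qed
  finally show ?thesis .
qed

text \<open>The coefficients are the digits of the value to base \<open>2 ^ \<beta>\<close>, so the
  parity of coefficient \<open>e\<close> is the bit at position \<open>\<beta> * e\<close>.\<close>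

lemma odd_digit_poly:
  fixes P :: "nat poly"
  assumes "0 < \<beta>" "\<And>i. coeff P i < 2 ^ \<beta>"
  shows "odd (poly P (2 ^ \<beta>) div 2 ^ (\<beta> * e)) \<longleftrightarrow> odd (coeff P e)"
  using assms(2)
proof (induction e arbitrary: P)
  case 0
  obtain a Q where P: "P = pCons a Q" by (cases P)
  have "even ((2::nat) ^ \<beta> * poly Q (2 ^ \<beta>))" using assms(1) by simp
  then show ?case unfolding P by simp
next
  case (Suc e)
  obtain a Q where P: "P = pCons a Q" by (cases P)
  have a: "a < 2 ^ \<beta>" using Suc.prems[of 0] P by simp
  have Q: "coeff Q i < 2 ^ \<beta>" for i using Suc.prems[of "Suc i"] P by simp
  have "poly P (2 ^ \<beta>) div 2 ^ (\<beta> * Suc e) = poly P (2 ^ \<beta>) div 2 ^ \<beta> div 2 ^ (\<beta> * e)"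
    by (simp add: power_add div_mult2_eq)
  also have "poly P (2 ^ \<beta>) div 2 ^ \<beta> = poly Q (2 ^ \<beta>)" using a P by simp
  finally show ?case using Suc.IH[OF Q] P by simp
qed

lemma coeff_le_poly_1: "coeff P i \<le> poly P (1::nat)"
proof (induction P arbitrary: i)
  case (pCons a P)
  show ?case using pCons(2)[of "i - 1"] by (cases i) (auto simp: trans_le_add2)
qed simp

section \<open>Reduction of coefficients modulo 2\<close>

context
  fixes h :: "nat poly \<Rightarrow> bit poly"
  defines "h \<equiv> map_poly of_nat"
begin

lemma coeff_parity_poly: "coeff (h p) i = of_nat (coeff p i)"
  by (simp add: h_def coeff_map_poly)

lemma parity_poly_add: "h (p + q) = h p + h q"
  by (rule poly_eqI) (simp add: coeff_parity_poly)

lemma parity_poly_mult: "h (p * q) = h p * h q"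
  by (rule poly_eqI) (simp add: coeff_parity_poly coeff_mult)

lemma parity_poly_1: "h 1 = 1"
  by (rule poly_eqI) (simp add: coeff_parity_poly one_pCons coeff_pCons split: nat.splits)

lemma parity_poly_0: "h 0 = 0"
  by (rule poly_eqI) (simp add: coeff_parity_poly)

lemma parity_poly_sum: "h (sum f A) = (\<Sum>a\<in>A. h (f a))"
  by (induction A rule: infinite_finite_induct) (simp_all add: parity_poly_0 parity_poly_add)

lemma parity_poly_prod: "h (prod f A) = (\<Prod>a\<in>A. h (f a))"
  by (induction A rule: infinite_finite_induct) (simp_all add: parity_poly_1 parity_poly_mult)

lemma parity_poly_power: "h (p ^ k) = h p ^ k"
  by (induction k) (simp_all add: parity_poly_1 parity_poly_mult)

lemma parity_poly_X: "h [:0, 1:] = [:0, 1:]"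
  by (rule poly_eqI) (simp add: coeff_parity_poly coeff_pCons split: nat.splits)

lemmas parity_poly_hom = parity_poly_add parity_poly_mult parity_poly_1 parity_poly_0
  parity_poly_sum parity_poly_prod parity_poly_power parity_poly_X

context
  fixes V EA and w :: "nat \<times> nat \<Rightarrow> nat" and R :: nat
  assumes "cut_count V EA"
begin

interpretation cut_count V EA w R by fact

text \<open>\<open>total\<close> is built from sums, products and powers, so it commutes with
  reduction modulo 2. This links the integers handled by the program to the polynomial over two
  elements in which the cancellations happen.\<close>

lemma parity_poly_total: "h (total [:0, 1:]) = total [:0, 1:]"
  unfolding total_def vfac_def efac_def
  by (simp add: parity_poly_hom if_distrib[of h] del: One_nat_def cong: if_cong)

end

end

context cut_count
begin

lemma poly_total: "poly (total [:0, 1:]) c = total (c :: nat)"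
  unfolding total_def vfac_def efac_def
  by (simp add: poly_sum poly_prod if_distrib[of "\<lambda>p. poly p _"] cong: if_cong)

text \<open>The value at 1 is the sum of the coefficients and bounds each of them. There are 5
  states per vertex, a vertex factor is at most 3 and an edge factor at most 2; rounding 15 up to 16
  gives 4 bits per vertex.\<close>

lemma total_1_less:
  assumes "V \<noteq> {}" "4 * card V + card EA \<le> \<beta>"
  shows "total (1::nat) < 2 ^ \<beta>"
proof -
  have "total (1::nat) \<le> (\<Sum>\<sigma>\<in>PiE V (\<lambda>_. {..<5::nat}). (\<Prod>v\<in>V. 3) * (\<Prod>e\<in>EA. 2))"
    unfolding total_def by (intro sum_mono mult_mono prod_mono) (auto simp: vfac_def efac_def)
  also have "\<dots> = 5 ^ card V * (3 ^ card V * 2 ^ card EA)"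
    using finV by (simp add: card_PiE)
  also have "\<dots> = 15 ^ card V * 2 ^ card EA" by (simp add: power_mult_distrib[symmetric])
  also have "\<dots> < 16 ^ card V * 2 ^ card EA"
    using assms(1) finV by (intro mult_strict_right_mono power_strict_mono) (auto simp: card_gt_0_iff)
  also have "\<dots> = 2 ^ (4 * card V + card EA)" by (simp add: power_add power_mult)
  also have "\<dots> \<le> 2 ^ \<beta>" using assms(2) by (intro power_increasing) auto
  finally show ?thesis .
qed

theorem odd_total_digit:
  assumes "V \<noteq> {}" and \<beta>: "4 * card V + card EA \<le> \<beta>"
    and R: "card EA < R" "card V < R" "sum w EA + (\<Sum>v\<in>V. w (v, v)) < R"
    and T: "w0 < R" "s < R" "m < R"
  shows "odd (total (2 ^ \<beta>) div 2 ^ (\<beta> * (w0 + R * s + R\<^sup>2 * s + R ^ 3 * m + R ^ 4 * s)) :: nat) \<longleftrightarrow>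
    odd (card {Y \<in> good s m. weight Y = w0})"
proof -
  let ?e = "w0 + R * s + R\<^sup>2 * s + R ^ 3 * m + R ^ 4 * s"
  let ?P = "total [:0, 1:] :: nat poly"
  have "card V \<noteq> 0" using assms(1) finV by simp
  then have "0 < \<beta>" using \<beta> by simp
  moreover have "coeff ?P i < 2 ^ \<beta>" for i
    using coeff_le_poly_1[of ?P i] total_1_less[OF assms(1) \<beta>] unfolding poly_total by simp
  ultimately have "odd (total (2 ^ \<beta>) div 2 ^ (\<beta> * ?e) :: nat) \<longleftrightarrow> odd (coeff ?P ?e)"
    using odd_digit_poly[of \<beta> ?P ?e] unfolding poly_total by blast
  moreover have "(of_nat (coeff ?P ?e) :: bit) = of_nat (card {Y \<in> good s m. weight Y = w0})"
    unfolding total_coeff[OF R T, symmetric] parity_poly_total[OF cut_count_axioms, symmetric] coeff_parity_poly ..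
  moreover have "(of_nat n :: bit) = of_bool (odd n)" for n by (induction n) auto
  ultimately show ?thesis by (auto split: if_splits simp: of_bool_def)
qed

text \<open>The exponents add up to less than \<open>R ^ 5\<close>, and the number of terms is
  absorbed by one more factor \<open>2 ^ \<beta>\<close>. This is the origin of the bound
  \<open>D = \<beta> * R ^ 5\<close> on the number of bits.\<close>

lemma total_less:
  assumes "V \<noteq> {}" and \<beta>: "4 * card V + card EA \<le> \<beta>"
    and R: "card EA < R" "card V < R" "sum w EA + (\<Sum>v\<in>V. w (v, v)) < R"
    and X: "card V + 2 * card EA < R"
  shows "total (2 ^ \<beta>) < (2::nat) ^ (\<beta> * R ^ 5)"
proof -
  let ?x = "(2::nat) ^ \<beta>"
  define d where "d v = R\<^sup>2 + mcost v + R ^ 4" for v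
  define c where "c e = R + w e + 2 * R ^ 4" for e
  have x1: "1 \<le> ?x" by simp
  have mono: "?x ^ i \<le> ?x ^ j" if "i \<le> j" for i j using that x1 by (rule power_increasing)
  have vf: "vfac ?x v a \<le> 3 * ?x ^ d v" for v a
  proof (cases "a = 0")
    case True
    have "1 \<le> ?x ^ d v" by simp
    moreover have "?x ^ (R\<^sup>2 + mcost v) \<le> ?x ^ d v" by (rule mono) (simp add: d_def)
    moreover have "?x ^ (R\<^sup>2 + mcost v) * ?x ^ (R ^ 4) = ?x ^ d v" by (simp add: d_def power_add)
    moreover have "vfac ?x v a = 1 + (?x ^ (R\<^sup>2 + mcost v) + ?x ^ (R\<^sup>2 + mcost v) * ?x ^ (R ^ 4))"
      using True by (simp add: vfac_def distrib_left)
    ultimately show ?thesis by linarith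
  next
    case False
    have *: "?x ^ (R\<^sup>2 + R ^ 4 * of_bool (a < 3)) \<le> ?x ^ d v" by (rule mono) (simp add: d_def)
    moreover have "?x ^ (R\<^sup>2 + R ^ 4 * of_bool (a < 3)) * ?x ^ mcost v \<le> ?x ^ d v"
      unfolding power_add[symmetric] by (rule mono) (simp add: d_def)
    ultimately show ?thesis using False by (simp add: vfac_def distrib_left)
  qed
  have ef: "1 + efac ?x e a b \<le> 2 * ?x ^ c e" for e a b
  proof -
    have "1 \<le> ?x ^ c e" by simp
    moreover have "?x ^ (R + w e + R ^ 4 * (high a + high b)) \<le> ?x ^ c e"
      by (rule mono) (auto simp: c_def high_def)
    moreover have "efac ?x e a b \<le> ?x ^ (R + w e + R ^ 4 * (high a + high b))"
      by (simp add: efac_def)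
    ultimately show ?thesis by linarith
  qed
  have "total ?x \<le> (\<Sum>\<sigma>\<in>PiE V (\<lambda>_. {..<5::nat}). (\<Prod>v\<in>V. 3 * ?x ^ d v) * (\<Prod>e\<in>EA. 2 * ?x ^ c e))"
    unfolding total_def using vf ef by (intro sum_mono mult_mono prod_mono) auto
  also have "\<dots> = 5 ^ card V * (3 ^ card V * ?x ^ sum d V * (2 ^ card EA * ?x ^ sum c EA))"
    using finV by (simp add: card_PiE prod.distrib power_sum)
  also have "\<dots> = 15 ^ card V * 2 ^ card EA * ?x ^ (sum d V + sum c EA)"
  proof -
    have "(15::nat) = 5 * 3" by simp
    then have "(15::nat) ^ card V = 5 ^ card V * 3 ^ card V" by (metis power_mult_distrib)
    then show ?thesis by (simp only: power_add mult_ac)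
  qed
  also have "\<dots> < ?x * ?x ^ (sum d V + sum c EA)"
  proof (rule mult_strict_right_mono)
    have "(15::nat) ^ card V * 2 ^ card EA < 16 ^ card V * 2 ^ card EA"
      using assms(1) finV by (intro mult_strict_right_mono power_strict_mono) (auto simp: card_gt_0_iff)
    also have "\<dots> = 2 ^ (4 * card V + card EA)" by (simp add: power_add power_mult)
    also have "\<dots> \<le> 2 ^ \<beta>" using \<beta> by (intro power_increasing) auto
    finally show "(15::nat) ^ card V * 2 ^ card EA < 2 ^ \<beta>" .
  qed simp
  also have "\<dots> = ?x ^ Suc (sum d V + sum c EA)" by simp
  also have "\<dots> \<le> ?x ^ (R ^ 5)"
  proof (rule mono, rule Suc_leI)
    have "sum d V + sum c EA = (sum w EA + (\<Sum>v\<in>V. w (v, v))) + R * card EA + R\<^sup>2 * card V + R ^ 3 * card V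
        + R ^ 4 * (card V + 2 * card EA)"
      by (simp add: d_def c_def mcost_def sum.distrib algebra_simps)
    also have "\<dots> < R ^ 4 + R ^ 4 * (card V + 2 * card EA)"
      using radix_less[OF R(3,1,2,2)] by simp
    also have "\<dots> = R ^ 4 * (card V + 2 * card EA + 1)" by simp
    also have "\<dots> \<le> R ^ 4 * R" using X by (intro mult_le_mono2) simp
    also have "\<dots> = R ^ 5" by (simp add: eval_nat_numeral)
    finally show "sum d V + sum c EA < R ^ 5" .
  qed
  finally show ?thesis by (simp add: power_mult)
qed

end

section \<open>Recursion over a rooted tree\<close>

locale rooted_tree =
  fixes n H :: nat and par lvl :: "nat \<Rightarrow> nat"
  assumes lvl_0: "lvl 0 = 0"
    and par_le: "1 \<le> v \<Longrightarrow> v \<le> n \<Longrightarrow> par v \<le> n"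
    and lvl_Suc: "1 \<le> v \<Longrightarrow> v \<le> n \<Longrightarrow> lvl v = Suc (lvl (par v))"
    and lvl_le: "v \<le> n \<Longrightarrow> lvl v \<le> H"
begin

text \<open>\<open>par\<close> is total and does not stop at the root, so it is iterated a given
  number of times. With \<open>lvl v\<close> iterations this lists the proper ancestors, nearest
  first.\<close>

primrec chain :: "nat \<Rightarrow> nat \<Rightarrow> nat list" where
  "chain 0 v = []"
| "chain (Suc h) v = par v # chain h (par v)"

definition ancestors :: "nat \<Rightarrow> nat list" where "ancestors v = chain (lvl v) v"

lemma ancestors_0 [simp]: "ancestors 0 = []" by (simp add: ancestors_def lvl_0)

lemma ancestors_Suc: "1 \<le> v \<Longrightarrow> v \<le> n \<Longrightarrow> ancestors v = par v # ancestors (par v)"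
  by (simp add: ancestors_def lvl_Suc)

lemma tree_induct [consumes 1, case_names root child]:
  assumes "v \<le> n" "P 0" "\<And>v. 1 \<le> v \<Longrightarrow> v \<le> n \<Longrightarrow> P (par v) \<Longrightarrow> P v"
  shows "P v"
  using assms(1)
proof (induction "lvl v" arbitrary: v)
  case 0
  then have "v = 0" using lvl_Suc[of v] by (cases "v = 0") auto
  then show ?case using assms(2) by simp
next
  case (Suc l)
  then have "1 \<le> v" using lvl_0 by (cases "v = 0") auto
  then show ?case using Suc lvl_Suc[of v] par_le[of v] assms(3)[of v] by simp
qed

lemma ancestors_lvl: "v \<le> n \<Longrightarrow> u \<in> set (ancestors v) \<Longrightarrow> u \<le> n \<and> lvl u < lvl v"
proof (induction rule: tree_induct)
  case (child v)
  then show ?case using par_le[of v] lvl_Suc[of v] by (auto simp: ancestors_Suc)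
qed simp

lemma distinct_ancestors: "v \<le> n \<Longrightarrow> distinct (ancestors v)"
proof (induction rule: tree_induct)
  case (child v)
  then show ?case using ancestors_lvl[of "par v" "par v"] par_le[of v] by (auto simp: ancestors_Suc)
qed simp

definition children :: "nat \<Rightarrow> nat set" where "children v = {c. 1 \<le> c \<and> c \<le> n \<and> par c = v}"

lemma finite_children [simp]: "finite (children v)"
  by (rule finite_subset[of _ "{..n}"]) (auto simp: children_def)

lemma children_lvl: "c \<in> children v \<Longrightarrow> lvl c = Suc (lvl v)"
  by (auto simp: children_def lvl_Suc)

text \<open>The descendants of \<open>v\<close> at distance at most \<open>h\<close>. Throughout
  \<open>lvl v + h = H\<close>, in which case these are all descendants.\<close>

primrec subtree :: "nat \<Rightarrow> nat \<Rightarrow> nat set" where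
  "subtree 0 v = {v}"
| "subtree (Suc h) v = insert v (\<Union>c\<in>children v. subtree h c)"

lemma subtree_sub: "v \<le> n \<Longrightarrow> u \<in> subtree h v \<Longrightarrow> u \<le> n \<and> (u = v \<or> v \<in> set (ancestors u))"
proof (induction h arbitrary: v)
  case (Suc h)
  show ?case
  proof (cases "u = v")
    case False
    then obtain c where c: "c \<in> children v" "u \<in> subtree h c" using Suc.prems by auto
    then have cn: "1 \<le> c" "c \<le> n" "par c = v" by (auto simp: children_def)
    have IH: "u \<le> n" "u = c \<or> c \<in> set (ancestors u)" using Suc.IH[OF cn(2) c(2)] by auto
    have "c \<in> set (ancestors u) \<Longrightarrow> v \<in> set (ancestors u)"
      using IH(1)
    proof (induction rule: tree_induct)
      case (child x)
      then show ?case using cn by (auto simp: ancestors_Suc)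
    qed (use cn in auto)
    then show ?thesis using IH cn by (auto simp: ancestors_Suc)
  qed (use Suc in auto)
qed auto

lemma finite_subtree: "v \<le> n \<Longrightarrow> finite (subtree h v)"
  by (rule finite_subset[of _ "{..n}"]) (use subtree_sub in auto)

lemma same_lvl_ancestor_unique:
  assumes "x \<le> n" "u \<in> set (x # ancestors x)" "v \<in> set (x # ancestors x)" "lvl u = lvl v"
  shows "u = v"
  using assms
proof (induction rule: tree_induct)
  case (child x)
  have "lvl y < lvl x" if "y \<in> set (ancestors x)" for y using ancestors_lvl[OF child(2) that] by simp
  then show ?case using child ancestors_Suc[OF child(1,2)] by (metis less_irrefl set_ConsD)
qed simp

lemma subtree_disjoint:
  assumes "c \<in> children v" "c' \<in> children v" "c \<noteq> c'"
  shows "subtree h c \<inter> subtree h c' = {}"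
proof (rule ccontr)
  assume "subtree h c \<inter> subtree h c' \<noteq> {}"
  then obtain x where x: "x \<in> subtree h c" "x \<in> subtree h c'" by blast
  have cn: "c \<le> n" "c' \<le> n" using assms by (auto simp: children_def)
  have "x \<le> n" "c \<in> set (x # ancestors x)" "c' \<in> set (x # ancestors x)"
    using subtree_sub[OF cn(1) x(1)] subtree_sub[OF cn(2) x(2)] by auto
  then show False using same_lvl_ancestor_unique[of x c c'] children_lvl assms by metis
qed

text \<open>Going up from a vertex below \<open>v\<close>, the subtree is left only at
  \<open>v\<close>. Contributions from different child subtrees therefore share no state except
  those of \<open>v\<close> and its ancestors.\<close>

lemma chain_in_subtree:
  "v \<le> n \<Longrightarrow> u \<in> subtree h v \<Longrightarrow> y \<in> set (u # ancestors u) \<Longrightarrow> y \<in> subtree h v \<or> lvl y < lvl v"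
proof (induction h arbitrary: v)
  case 0
  then show ?case using ancestors_lvl[of v y] by auto
next
  case (Suc h)
  show ?case
  proof (cases "u = v")
    case True
    then show ?thesis using Suc.prems ancestors_lvl[of v y] by auto
  next
    case False
    then obtain c where c: "c \<in> children v" "u \<in> subtree h c" using Suc.prems by auto
    then have "c \<le> n" by (simp add: children_def)
    from Suc.IH[OF this c(2) Suc.prems(3)] show ?thesis
    proof
      assume "lvl y < lvl c"
      then have "lvl y < lvl v \<or> lvl y = lvl v" using children_lvl[OF c(1)] by auto
      moreover have "y = v" if "lvl y = lvl v"
        using same_lvl_ancestor_unique[of u y v] subtree_sub[OF Suc.prems(1,2)] Suc.prems(3) that by auto
      ultimately show ?thesis by auto
    qed (use c in auto)
  qed
qed

lemma subtree_full: "v \<le> n \<Longrightarrow> lvl v + h = H \<Longrightarrow> u \<le> n \<Longrightarrow> v \<in> set (u # ancestors u) \<Longrightarrow> u \<in> subtree h v"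
proof (induction h arbitrary: v)
  case 0
  have "u = v"
  proof (rule ccontr)
    assume "u \<noteq> v"
    then have "lvl v < lvl u" using ancestors_lvl[OF 0(3)] 0(4) by auto
    then show False using lvl_le[OF 0(3)] 0(2) by simp
  qed
  then show ?case by simp
next
  case (Suc h)
  show ?case
  proof (cases "u = v")
    case False
    then have "v \<in> set (ancestors u)" using Suc by auto
    with Suc.prems(3) have "\<exists>c\<in>children v. c \<in> set (u # ancestors u)"
    proof (induction rule: tree_induct)
      case (child x)
      then show ?case by (cases "par x = v") (auto simp: ancestors_Suc children_def)
    qed simp
    then obtain c where c: "c \<in> children v" "c \<in> set (u # ancestors u)" by blast
    then have "u \<in> subtree h c"
      using Suc.IH[of c] children_lvl[OF c(1)] Suc.prems by (auto simp: children_def)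
    then show ?thesis using c by auto
  qed simp
qed

lemma root_ancestor: "u \<le> n \<Longrightarrow> 0 \<in> set (u # ancestors u)"
  by (induction rule: tree_induct) (auto simp: ancestors_Suc)

lemma subtree_root: "subtree H 0 = {..n}"
proof (intro subset_antisym subsetI)
  fix u assume u: "u \<in> {..n}"
  then have "0 \<in> set (u # ancestors u)" using root_ancestor by simp
  then show "u \<in> subtree H 0" using subtree_full[of 0 H u] u lvl_0 by simp
qed (use subtree_sub[of 0] in auto)

text \<open>The states outside \<open>D\<close> are fixed by \<open>\<sigma>\<close>. Functions in
  \<open>PiE\<close> are undefined outside \<open>D\<close>, hence the case distinction.\<close>

definition state_sum :: "nat set \<Rightarrow> ((nat \<Rightarrow> nat) \<Rightarrow> 'a) \<Rightarrow> (nat \<Rightarrow> nat) \<Rightarrow> 'a::comm_semiring_1" where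
  "state_sum D g \<sigma> = (\<Sum>\<tau>\<in>PiE D (\<lambda>_. {..<5::nat}). g (\<lambda>x. if x \<in> D then \<tau> x else \<sigma> x))"

lemma state_sum_empty [simp]: "state_sum {} g \<sigma> = g \<sigma>"
  by (simp add: state_sum_def)

lemma state_sum_insert:
  assumes "finite D" "v \<notin> D"
  shows "state_sum (insert v D) g \<sigma> = (\<Sum>a<5. state_sum D g (\<sigma>(v := a)))"
proof -
  have "state_sum (insert v D) g \<sigma> = (\<Sum>(a, \<tau>)\<in>{..<5} \<times> PiE D (\<lambda>_. {..<5::nat}).
      g (\<lambda>x. if x \<in> insert v D then (\<tau>(v := a)) x else \<sigma> x))"
    unfolding state_sum_def PiE_insert_eq
    by (subst sum.reindex[OF inj_combinator[OF assms(2)]]) (simp add: case_prod_unfold)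
  also have "\<dots> = (\<Sum>a<5. \<Sum>\<tau>\<in>PiE D (\<lambda>_. {..<5::nat}). g (\<lambda>x. if x \<in> insert v D then (\<tau>(v := a)) x else \<sigma> x))"
    by (subst sum.cartesian_product) simp
  also have "\<dots> = (\<Sum>a<5. state_sum D g (\<sigma>(v := a)))"
    unfolding state_sum_def
    by (intro sum.cong refl arg_cong[where f = g]) (use assms(2) in auto)
  finally show ?thesis .
qed

lemma state_sum_mult_const:
  assumes "\<And>\<tau>. (\<And>x. x \<notin> D \<Longrightarrow> \<tau> x = \<sigma> x) \<Longrightarrow> f \<tau> = f \<sigma>"
  shows "state_sum D (\<lambda>\<tau>. f \<tau> * g \<tau>) \<sigma> = f \<sigma> * state_sum D g \<sigma>"
  unfolding state_sum_def sum_distrib_left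
proof (rule sum.cong[OF refl])
  fix \<tau>
  show "f (\<lambda>x. if x \<in> D then \<tau> x else \<sigma> x) * g (\<lambda>x. if x \<in> D then \<tau> x else \<sigma> x) = f \<sigma> * g (\<lambda>x. if x \<in> D then \<tau> x else \<sigma> x)"
    using assms[of "\<lambda>x. if x \<in> D then \<tau> x else \<sigma> x"] by simp
qed

text \<open>\<open>g1\<close> does not see the states of \<open>D2\<close>, nor \<open>g2\<close>
  those of \<open>D1\<close>, so the double sum factors.\<close>

lemma state_sum_Un:
  assumes "finite D1" "finite D2" "D1 \<inter> D2 = {}"
    and "\<And>\<sigma> \<tau>. (\<And>x. x \<notin> D2 \<Longrightarrow> \<tau> x = \<sigma> x) \<Longrightarrow> g1 \<tau> = g1 \<sigma>"
    and "\<And>\<sigma> \<tau>. (\<And>x. x \<notin> D1 \<Longrightarrow> \<tau> x = \<sigma> x) \<Longrightarrow> g2 \<tau> = g2 \<sigma>"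
  shows "state_sum (D1 \<union> D2) (\<lambda>\<tau>. g1 \<tau> * g2 \<tau>) \<sigma> = state_sum D1 g1 \<sigma> * state_sum D2 g2 \<sigma>"
  using assms(1,3,5)
proof (induction D1 arbitrary: \<sigma> rule: finite_induct)
  case empty
  show ?case unfolding Un_empty_left state_sum_empty
    by (rule state_sum_mult_const) (rule assms(4), blast)
next
  case (insert v D)
  have indep: "g2 \<tau> = g2 \<sigma>" if "\<And>x. x \<notin> D \<Longrightarrow> \<tau> x = \<sigma> x" for \<sigma> \<tau>
    by (rule insert.prems(2)) (simp add: that)
  have g2: "state_sum D2 g2 (\<sigma>(v := a)) = state_sum D2 g2 \<sigma>" for a
    unfolding state_sum_def by (intro sum.cong refl insert.prems(2)) auto
  have "state_sum (insert v D \<union> D2) (\<lambda>\<tau>. g1 \<tau> * g2 \<tau>) \<sigma> =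
      (\<Sum>a<5. state_sum (D \<union> D2) (\<lambda>\<tau>. g1 \<tau> * g2 \<tau>) (\<sigma>(v := a)))"
    using insert.hyps insert.prems(1) assms(2) by (simp add: state_sum_insert)
  also have "\<dots> = (\<Sum>a<5. state_sum D g1 (\<sigma>(v := a)) * state_sum D2 g2 \<sigma>)"
    using insert.IH[OF _ indep] insert.prems(1) g2 by simp
  also have "\<dots> = state_sum (insert v D) g1 \<sigma> * state_sum D2 g2 \<sigma>"
    using insert.hyps by (simp add: state_sum_insert sum_distrib_right)
  finally show ?case .
qed

context
  fixes loc :: "nat \<Rightarrow> (nat \<Rightarrow> nat) \<Rightarrow> 'a::comm_semiring_1"
  assumes loc: "\<And>v \<sigma> \<tau>. v \<le> n \<Longrightarrow> (\<And>u. u \<in> set (v # ancestors v) \<Longrightarrow> \<tau> u = \<sigma> u) \<Longrightarrow> loc v \<tau> = loc v \<sigma>"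
begin

primrec tree_sum :: "nat \<Rightarrow> nat \<Rightarrow> (nat \<Rightarrow> nat) \<Rightarrow> 'a" where
  "tree_sum 0 v \<sigma> = (\<Sum>a<5. loc v (\<sigma>(v := a)))"
| "tree_sum (Suc h) v \<sigma> = (\<Sum>a<5. loc v (\<sigma>(v := a)) * (\<Prod>c\<in>children v. tree_sum h c (\<sigma>(v := a))))"

text \<open>Once the state of \<open>v\<close> is fixed, the subtrees of its children are
  independent: \<open>loc u\<close> looks only at \<open>u\<close> and its ancestors.\<close>

lemma tree_sum_eq_state_sum:
  "v \<le> n \<Longrightarrow> tree_sum h v \<sigma> = state_sum (subtree h v) (\<lambda>\<tau>. \<Prod>u\<in>subtree h v. loc u \<tau>) \<sigma>"
proof (induction h arbitrary: v \<sigma>)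
  case 0
  show ?case by (simp add: state_sum_insert)
next
  case (Suc h)
  let ?D = "\<lambda>C. \<Union>c\<in>C. subtree h c"
  have lvl_ge: "lvl v < lvl y" if y: "y \<in> ?D (children v)" for y
  proof -
    from y obtain c where c: "c \<in> children v" "y \<in> subtree h c" by blast
    then have "c \<le> n" by (simp add: children_def)
    then have "lvl c \<le> lvl y" using subtree_sub[OF _ c(2)] ancestors_lvl[of y c] by auto
    then show ?thesis using children_lvl[OF c(1)] by simp
  qed
  have cn: "c \<le> n" if "c \<in> children v" for c using that by (simp add: children_def)
  have fin: "finite (subtree h c)" if "c \<in> children v" for c using finite_subtree cn that by blast
  have prod: "state_sum (?D C) (\<lambda>\<tau>. \<Prod>u\<in>?D C. loc u \<tau>) \<sigma> = (\<Prod>c\<in>C. tree_sum h c \<sigma>)"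
    if "C \<subseteq> children v" for C \<sigma>
    using finite_subset[OF that finite_children] that
  proof (induction C rule: finite_induct)
    case (insert c C)
    then have c: "c \<in> children v" and C: "C \<subseteq> children v" by auto
    have disj: "subtree h c \<inter> ?D C = {}"
      using subtree_disjoint[OF c] insert.hyps C by blast
    have fC: "finite (?D C)" using insert.hyps fin C by blast
    have "state_sum (?D (insert c C)) (\<lambda>\<tau>. \<Prod>u\<in>?D (insert c C). loc u \<tau>) \<sigma> =
      state_sum (subtree h c \<union> ?D C) (\<lambda>\<tau>. (\<Prod>u\<in>subtree h c. loc u \<tau>) * (\<Prod>u\<in>?D C. loc u \<tau>)) \<sigma>"
      unfolding UN_insert prod.union_disjoint[OF fin[OF c] fC disj] ..
    also have "\<dots> = state_sum (subtree h c) (\<lambda>\<tau>. \<Prod>u\<in>subtree h c. loc u \<tau>) \<sigma> * state_sum (?D C) (\<lambda>\<tau>. \<Prod>u\<in>?D C. loc u \<tau>) \<sigma>"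
    proof (rule state_sum_Un[OF fin[OF c] fC disj])
      have indep: "loc u \<tau> = loc u \<sigma>" if "d \<in> children v" "u \<in> subtree h d" "\<And>x. x \<notin> S \<Longrightarrow> \<tau> x = \<sigma> x"
        "S \<inter> subtree h d = {}" "S \<subseteq> ?D (children v)" for u d S \<sigma> \<tau>
      proof (rule loc)
        show "u \<le> n" using subtree_sub[OF cn[OF that(1)] that(2)] by simp
        fix y assume "y \<in> set (u # ancestors u)"
        then have "y \<in> subtree h d \<or> lvl y < lvl d" using chain_in_subtree[OF cn[OF that(1)] that(2)] by blast
        then have "y \<notin> S" using that(4,5) lvl_ge children_lvl[OF that(1)] by force
        then show "\<tau> y = \<sigma> y" by (rule that(3))
      qed
      show "(\<Prod>u\<in>subtree h c. loc u \<tau>) = (\<Prod>u\<in>subtree h c. loc u \<sigma>)" if "\<And>x. x \<notin> ?D C \<Longrightarrow> \<tau> x = \<sigma> x" for \<sigma> \<tau>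
      proof (rule prod.cong[OF refl])
        fix u assume u: "u \<in> subtree h c"
        show "loc u \<tau> = loc u \<sigma>"
          by (rule indep[OF c u, where S = "?D C"]) (use C disj that in auto)
      qed
      show "(\<Prod>u\<in>?D C. loc u \<tau>) = (\<Prod>u\<in>?D C. loc u \<sigma>)" if "\<And>x. x \<notin> subtree h c \<Longrightarrow> \<tau> x = \<sigma> x" for \<sigma> \<tau>
      proof (rule prod.cong[OF refl])
        fix u assume "u \<in> ?D C"
        then obtain d where d: "d \<in> C" "u \<in> subtree h d" by blast
        show "loc u \<tau> = loc u \<sigma>"
          by (rule indep[OF _ d(2), where S = "subtree h c"]) (use d C disj c that in auto)
      qed
    qed
    also have "\<dots> = (\<Prod>c\<in>insert c C. tree_sum h c \<sigma>)"
      using insert.hyps insert.IH[OF C] Suc.IH[OF cn[OF c]] by simp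
    finally show ?case .
  qed simp
  have v: "v \<notin> ?D (children v)" using lvl_ge by force
  have "state_sum (subtree (Suc h) v) (\<lambda>\<tau>. \<Prod>u\<in>subtree (Suc h) v. loc u \<tau>) \<sigma> =
      (\<Sum>a<5. state_sum (?D (children v)) (\<lambda>\<tau>. loc v \<tau> * (\<Prod>u\<in>?D (children v). loc u \<tau>)) (\<sigma>(v := a)))"
    using v fin by (simp add: state_sum_insert)
  also have "\<dots> = (\<Sum>a<5. loc v (\<sigma>(v := a)) * state_sum (?D (children v)) (\<lambda>\<tau>. \<Prod>u\<in>?D (children v). loc u \<tau>) (\<sigma>(v := a)))"
  proof (intro sum.cong[OF refl] state_sum_mult_const loc)
    fix a \<tau> u assume t: "\<And>x. x \<notin> ?D (children v) \<Longrightarrow> \<tau> x = (\<sigma>(v := a)) x" and u: "u \<in> set (v # ancestors v)"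
    have "lvl u \<le> lvl v" using u ancestors_lvl[OF Suc.prems, of u] by auto
    then have "u \<notin> ?D (children v)" using lvl_ge by fastforce
    then show "\<tau> u = (\<sigma>(v := a)) u" by (rule t)
  qed (rule Suc.prems)
  also have "\<dots> = tree_sum (Suc h) v \<sigma>" using prod[OF order_refl] by simp
  finally show ?case by simp
qed

end

end

section \<open>Verification of space-bounded programs\<close>

text \<open>The space invariant: at most 40 registers and \<open>A\<close> memory cells are nonzero,
  and all values are below \<open>B\<close>. The number 40 exceeds every register in use.\<close>

definition fits :: "nat \<Rightarrow> nat \<Rightarrow> state \<Rightarrow> bool" where
  "fits A B s \<longleftrightarrow> (\<forall>r. fst s r < B) \<and> (\<forall>r\<ge>40. fst s r = 0) \<and> (\<forall>a. snd s a < B) \<and> (\<forall>a\<ge>A. snd s a = 0)"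

lemma cells_space_le:
  assumes "\<And>i. M \<le> i \<Longrightarrow> f i = 0" "\<And>i. f i < B"
  shows "cells_space f \<le> M * (floorlog 2 M + floorlog 2 B)"
proof -
  have sub: "{i. f i \<noteq> 0} \<subseteq> {..<M}"
  proof
    fix i assume "i \<in> {i. f i \<noteq> 0}"
    then show "i \<in> {..<M}" using assms(1)[of i] by (cases "M \<le> i") auto
  qed
  have "cells_space f \<le> (\<Sum>i | f i \<noteq> 0. floorlog 2 M + floorlog 2 B)"
    unfolding cells_space_def
    using sub assms(2) by (intro sum_mono add_mono floorlog_mono less_imp_le) auto
  also have "\<dots> = card {i. f i \<noteq> 0} * (floorlog 2 M + floorlog 2 B)" by simp
  also have "\<dots> \<le> M * (floorlog 2 M + floorlog 2 B)"
    using card_mono[OF _ sub] by (intro mult_le_mono1) simp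
  finally show ?thesis .
qed

lemma fits_space:
  assumes "fits A B s"
  shows "space_of s \<le> 40 * (floorlog 2 40 + floorlog 2 B) + A * (floorlog 2 A + floorlog 2 B)"
  unfolding space_of_def using assms
  by (intro add_mono cells_space_le) (auto simp: fits_def)

text \<open>Total correctness in time \<open>T\<close>, with \<open>fits\<close> holding at every
  step. The postcondition may be an \<open>ok\<close> statement about the code that follows, which
  permits proofs in continuation-passing style. As \<open>fits\<close> is a premise, bounds on
  stored values can be recovered at any point by \<open>ok_fits\<close>.\<close>

definition ok :: "nat \<Rightarrow> nat \<Rightarrow> com \<Rightarrow> state \<Rightarrow> nat \<Rightarrow> (state \<Rightarrow> bool) \<Rightarrow> bool" where
  "ok A B c s T Q \<longleftrightarrow> (fits A B s \<longrightarrow> (\<exists>s'. ex (fits A B) c s T s' \<and> Q s'))"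

lemma ok_fits: "(fits A B s \<Longrightarrow> ok A B c s T Q) \<Longrightarrow> ok A B c s T Q"
  by (auto simp: ok_def)

lemma ok_mono:
  assumes "ok A B c s T Q" "T \<le> T'" "\<And>s'. fits A B s' \<Longrightarrow> Q s' \<Longrightarrow> Q' s'"
  shows "ok A B c s T' Q'"
  unfolding ok_def
proof
  assume "fits A B s"
  then obtain s' where s': "ex (fits A B) c s T s'" "Q s'" using assms(1) by (auto simp: ok_def)
  have "fits A B s'" using reach_inv[OF s'(1)] by simp
  then show "\<exists>s'. ex (fits A B) c s T' s' \<and> Q' s'"
    using reach_mono[OF s'(1) assms(2)] assms(3) s'(2) by blast
qed

lemma ok_le: "ok A B c s T Q \<Longrightarrow> T \<le> T' \<Longrightarrow> ok A B c s T' Q"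
  by (rule ok_mono)

lemma ok_Skip: "Q s \<Longrightarrow> ok A B Skip s T Q"
  unfolding ok_def using ex_Skip by blast

lemma ok_Seq:
  assumes "ok A B c1 s T1 (\<lambda>s1. ok A B c2 s1 T2 Q)"
  shows "ok A B (Seq c1 c2) s (T1 + T2 + 1) Q"
  unfolding ok_def
proof
  assume "fits A B s"
  then obtain s1 where s1: "ex (fits A B) c1 s T1 s1" "ok A B c2 s1 T2 Q"
    using assms unfolding ok_def[of A B c1] by blast
  have "fits A B s1" using reach_inv[OF s1(1)] by simp
  then obtain s2 where "ex (fits A B) c2 s1 T2 s2" "Q s2"
    using s1(2) unfolding ok_def by blast
  then show "\<exists>s'. ex (fits A B) (Seq c1 c2) s (T1 + T2 + 1) s' \<and> Q s'"
    using ex_Seq[OF s1(1)] by blast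
qed

lemma fits_reg: "fits A B (f, m) \<Longrightarrow> r < 40 \<Longrightarrow> x < B \<Longrightarrow> fits A B (f(r := x), m)"
  by (auto simp: fits_def)

lemma fits_mem: "fits A B (f, m) \<Longrightarrow> a < A \<Longrightarrow> x < B \<Longrightarrow> fits A B (f, m(a := x))"
  by (auto simp: fits_def)

lemma fits_D: "fits A B (f, m) \<Longrightarrow> f r < B" "fits A B (f, m) \<Longrightarrow> m a < B"
  by (auto simp: fits_def)

lemma ok_Assign:
  assumes "r < 40" "fits A B (f, m) \<Longrightarrow> aval a (f, m) < B" "Q (f(r := aval a (f, m)), m)"
  shows "ok A B (Assign r a) (f, m) 1 Q"
  unfolding ok_def
proof
  assume s: "fits A B (f, m)"
  have "fits A B (f(r := aval a (f, m)), m)" using fits_reg[OF s assms(1) assms(2)[OF s]] .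
  then have "ex (fits A B) (Assign r a) (f, m) 1 (f(r := aval a (f, m)), m)"
    using ex_Assign[of "fits A B" "(f, m)" r a 1] s by simp
  then show "\<exists>s'. ex (fits A B) (Assign r a) (f, m) 1 s' \<and> Q s'" using assms(3) by blast
qed

lemma ok_Store:
  assumes "fits A B (f, m) \<Longrightarrow> aval a (f, m) < A" "fits A B (f, m) \<Longrightarrow> aval b (f, m) < B"
    "Q (f, m(aval a (f, m) := aval b (f, m)))"
  shows "ok A B (Store a b) (f, m) 1 Q"
  unfolding ok_def
proof
  assume s: "fits A B (f, m)"
  have "fits A B (f, m(aval a (f, m) := aval b (f, m)))" using fits_mem[OF s assms(1,2)[OF s]] .
  then have "ex (fits A B) (Store a b) (f, m) 1 (f, m(aval a (f, m) := aval b (f, m)))"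
    using ex_Store[of "fits A B" "(f, m)" a b 1] s by simp
  then show "\<exists>s'. ex (fits A B) (Store a b) (f, m) 1 s' \<and> Q s'" using assms(3) by blast
qed

lemma ok_Cond:
  assumes "aval a s \<noteq> 0 \<Longrightarrow> ok A B c1 s T1 Q" "aval a s = 0 \<Longrightarrow> ok A B c2 s T2 Q"
  shows "ok A B (Cond a c1 c2) s (max T1 T2 + 1) Q"
  unfolding ok_def
proof
  assume "fits A B s"
  moreover have "ok A B (if aval a s \<noteq> 0 then c1 else c2) s (max T1 T2) Q"
  proof (cases "aval a s = 0")
    case True
    then show ?thesis using ok_le[OF assms(2)] by simp
  next
    case False
    then show ?thesis using ok_le[OF assms(1)] by simp
  qed
  ultimately obtain s' where "ex (fits A B) (if aval a s \<noteq> 0 then c1 else c2) s (max T1 T2) s'" "Q s'"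
    unfolding ok_def by blast
  then show "\<exists>s'. ex (fits A B) (Cond a c1 c2) s (max T1 T2 + 1) s' \<and> Q s'"
    using ex_Cond by blast
qed

lemma ok_While_end: "aval a s = 0 \<Longrightarrow> Q s \<Longrightarrow> ok A B (While a c) s 1 Q"
  unfolding ok_def using ex_While_end by blast

lemma ok_While_step:
  assumes "aval a s \<noteq> 0" "ok A B c s T1 (\<lambda>s1. ok A B (While a c) s1 T2 Q)"
  shows "ok A B (While a c) s (T1 + T2 + 2) Q"
  unfolding ok_def
proof
  assume "fits A B s"
  then obtain s1 where s1: "ex (fits A B) c s T1 s1" "ok A B (While a c) s1 T2 Q"
    using assms(2) unfolding ok_def[of A B c] by blast
  have "fits A B s1" using reach_inv[OF s1(1)] by simp
  then obtain s2 where s2: "ex (fits A B) (While a c) s1 T2 s2" "Q s2"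
    using s1(2) unfolding ok_def by blast
  have "ex (fits A B) (While a c) s (T1 + 2 + T2) s2"
    using reach_trans[OF reach_While[OF assms(1) s1(1)] s2(1)] .
  moreover have "T1 + 2 + T2 = T1 + T2 + 2" by simp
  ultimately show "\<exists>s'. ex (fits A B) (While a c) s (T1 + T2 + 2) s' \<and> Q s'"
    using s2(2) by metis
qed

text \<open>Each round costs two steps beyond the body, for the test and for discarding the finished
  body; the last 1 is the failing test.\<close>

lemma ok_count_down:
  assumes "\<And>i s. i < k \<Longrightarrow> Inv (Suc i) s \<Longrightarrow> fst s t = Suc i \<Longrightarrow>
      ok A B c s T0 (\<lambda>s'. fst s' t = i \<and> Inv i s')"
    and "Inv k s" "fst s t = k" and "\<And>s'. Inv 0 s' \<Longrightarrow> fst s' t = 0 \<Longrightarrow> Q s'"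
  shows "ok A B (While (Reg t) c) s (k * (T0 + 2) + 1) Q"
  using assms(1-3)
proof (induction k arbitrary: s)
  case 0
  then have "ok A B (While (Reg t) c) s 1 Q" using assms(4) by (intro ok_While_end) auto
  then show ?case by simp
next
  case (Suc k)
  have "ok A B c s T0 (\<lambda>s'. fst s' t = k \<and> Inv k s')" using Suc.prems by blast
  then have "ok A B c s T0 (\<lambda>s1. ok A B (While (Reg t) c) s1 (k * (T0 + 2) + 1) Q)"
  proof (rule ok_mono[OF _ order_refl])
    fix s' assume s': "fst s' t = k \<and> Inv k s'"
    show "ok A B (While (Reg t) c) s' (k * (T0 + 2) + 1) Q"
      by (rule Suc.IH) (use s' Suc.prems(1) in simp_all)
  qed
  then have "ok A B (While (Reg t) c) s (T0 + (k * (T0 + 2) + 1) + 2) Q"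
    by (intro ok_While_step) (use Suc.prems in auto)
  then show ?case by (rule ok_le) simp
qed

text \<open>Repeated addition takes time linear in the second factor, which will always be at most
  \<open>D\<close>. Numbers with up to \<open>D\<close> bits are only ever multiplied by powers of
  two, by repeated doubling.\<close>

definition mul :: "nat \<Rightarrow> nat \<Rightarrow> nat \<Rightarrow> nat \<Rightarrow> com" where
  "mul z x y t = Seq (Assign z (Const 0)) (Seq (Assign t (Reg y))
     (While (Reg t) (Seq (Assign z (Add (Reg z) (Reg x))) (Assign t (Sub (Reg t) (Const 1))))))"

definition shl :: "nat \<Rightarrow> nat \<Rightarrow> com" where
  "shl a t = While (Reg t) (Seq (Assign a (Add (Reg a) (Reg a))) (Assign t (Sub (Reg t) (Const 1))))"

lemma ok_add_count_down:
  assumes r: "z < 40" "t < 40" "z \<noteq> t" and x: "f x + f z < B"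
    and k: "f t = Suc i" and Q: "Q (f(z := f z + f x, t := i), m)" and xt: "x \<noteq> t"
  shows "ok A B (Seq (Assign z (Add (Reg z) (Reg x))) (Assign t (Sub (Reg t) (Const 1)))) (f, m) 3 Q"
proof -
  have "ok A B (Seq (Assign z (Add (Reg z) (Reg x))) (Assign t (Sub (Reg t) (Const 1)))) (f, m) (1 + 1 + 1) Q"
  proof (rule ok_Seq, rule ok_Assign[OF r(1)])
    show "ok A B (Assign t (Sub (Reg t) (Const 1))) (f(z := aval (Add (Reg z) (Reg x)) (f, m)), m) 1 Q"
    proof (rule ok_Assign[OF r(2)])
      let ?g = "f(z := aval (Add (Reg z) (Reg x)) (f, m))"
      assume "fits A B (?g, m)"
      then have "?g t < B" by (rule fits_D)
      then show "aval (Sub (Reg t) (Const 1)) (?g, m) < B" by simp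
    next
      show "Q (f(z := aval (Add (Reg z) (Reg x)) (f, m), t := aval (Sub (Reg t) (Const 1)) (f(z := aval (Add (Reg z) (Reg x)) (f, m)), m)), m)"
        using Q r k by simp
    qed
  qed (use x in \<open>simp add: add.commute\<close>)
  then show ?thesis by (simp add: numeral_3_eq_3)
qed

lemma ok_mul:
  assumes r: "z < 40" "t < 40" "z \<noteq> x" "z \<noteq> y" "z \<noteq> t" "t \<noteq> x"
    and B: "f x * f y < B" and Q: "Q (f(z := f x * f y, t := 0), m)"
  shows "ok A B (mul z x y t) (f, m) (5 * f y + 5) Q"
proof -
  let ?W = "While (Reg t) (Seq (Assign z (Add (Reg z) (Reg x))) (Assign t (Sub (Reg t) (Const 1))))"
  let ?Inv = "\<lambda>i s. s = (f(z := (f y - i) * f x, t := i), m) \<and> i \<le> f y"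
  have loop: "ok A B ?W (f(z := 0, t := f y), m) (f y * (3 + 2) + 1) Q"
  proof (rule ok_count_down[where Inv = ?Inv])
    fix i s assume i: "i < f y" "?Inv (Suc i) s" "fst s t = Suc i"
    have "f y - i = Suc (f y - Suc i)" using i(1) by simp
    then have eq: "(f y - i) * f x = (f y - Suc i) * f x + f x" by simp
    have "(f y - i) * f x \<le> f x * f y" by (simp add: mult.commute)
    then have le: "f x + (f y - Suc i) * f x < B" using B eq by simp
    have s: "s = (f(z := (f y - Suc i) * f x, t := Suc i), m)" using i(2) by blast
    show "ok A B (Seq (Assign z (Add (Reg z) (Reg x))) (Assign t (Sub (Reg t) (Const 1)))) s 3
        (\<lambda>s'. fst s' t = i \<and> ?Inv i s')"
      unfolding s by (rule ok_add_count_down) (use r le i(1) eq in \<open>auto simp: fun_upd_twist\<close>)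
  qed (use r Q in \<open>auto simp: mult.commute\<close>)
  have rest: "ok A B (Seq (Assign t (Reg y)) ?W) (f(z := 0), m) (1 + (f y * (3 + 2) + 1) + 1) Q"
  proof (rule ok_Seq, rule ok_Assign[OF r(2)])
    assume "fits A B (f(z := 0), m)"
    from fits_D(1)[OF this, of y] show "aval (Reg y) (f(z := 0), m) < B" using r by simp
  qed (use r loop in simp)
  have "ok A B (mul z x y t) (f, m) (1 + (1 + (f y * (3 + 2) + 1) + 1) + 1) Q"
    unfolding mul_def
  proof (rule ok_Seq, rule ok_Assign[OF r(1)])
    assume "fits A B (f, m)"
    from fits_D(1)[OF this, of z] show "aval (Const 0) (f, m) < B" by simp
  qed (use rest in simp)
  then show ?thesis by (rule ok_le) simp
qed

lemma ok_shl:
  assumes r: "a < 40" "t < 40" "a \<noteq> t"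
    and B: "f a * 2 ^ f t < B" and Q: "Q (f(a := f a * 2 ^ f t, t := 0), m)"
  shows "ok A B (shl a t) (f, m) (5 * f t + 1) Q"
proof -
  let ?k = "f t"
  let ?Inv = "\<lambda>i s. s = (f(a := f a * 2 ^ (?k - i), t := i), m) \<and> i \<le> ?k"
  have "ok A B (shl a t) (f, m) (?k * (3 + 2) + 1) Q"
    unfolding shl_def
  proof (rule ok_count_down[where Inv = ?Inv])
    fix i s assume i: "i < ?k" "?Inv (Suc i) s" "fst s t = Suc i"
    have "?k - i = Suc (?k - Suc i)" using i(1) by simp
    then have eq: "f a * 2 ^ (?k - i) = f a * 2 ^ (?k - Suc i) + f a * 2 ^ (?k - Suc i)" by simp
    have "f a * 2 ^ (?k - i) \<le> f a * 2 ^ ?k" by simp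
    then have le: "f a * 2 ^ (?k - Suc i) + f a * 2 ^ (?k - Suc i) < B" using B eq by simp
    have s: "s = (f(a := f a * 2 ^ (?k - Suc i), t := Suc i), m)" using i(2) by blast
    show "ok A B (Seq (Assign a (Add (Reg a) (Reg a))) (Assign t (Sub (Reg t) (Const 1)))) s 3
        (\<lambda>s'. fst s' t = i \<and> ?Inv i s')"
      unfolding s by (rule ok_add_count_down) (use r le i(1) eq in \<open>auto simp: fun_upd_twist\<close>)
  qed (use Q in auto)
  then show ?thesis by (rule ok_le) simp
qed

lemma ok_mul_le:
  assumes "f y \<le> D" "z < 40" "t < 40" "z \<noteq> x" "z \<noteq> y" "z \<noteq> t" "t \<noteq> x"
    "f x * f y < B" "Q (f(z := f x * f y, t := 0), m)"
  shows "ok A B (mul z x y t) (f, m) (5 * D + 5) Q"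
  using ok_le[OF ok_mul[of z t x y f B Q m A]] assms by simp

lemma ok_shl_le:
  assumes "f t \<le> D" "a < 40" "t < 40" "a \<noteq> t" "f a * 2 ^ f t < B" "Q (f(a := f a * 2 ^ f t, t := 0), m)"
  shows "ok A B (shl a t) (f, m) (5 * D + 5) Q"
  using ok_le[OF ok_shl[of a t f B Q m A]] assms by simp

text \<open>Loop-free code with multiplication and shift as primitives. Its weakest preconditions
  unfold by simplification, so that only genuine loops need invariants.\<close>

datatype block =
    Set nat aexp
  | Put aexp aexp
  | Mul nat nat nat nat
  | Shl nat nat
  | If aexp block block
  | Nop
  | Then block block (infixr ";;" 60)

primrec code :: "block \<Rightarrow> com" where
  "code (Set r a) = Assign r a"
| "code (Put a b) = Store a b"
| "code (Mul z x y t) = mul z x y t"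
| "code (Shl a t) = shl a t"
| "code (If a p q) = Cond a (code p) (code q)"
| "code Nop = Skip"
| "code (p ;; q) = Seq (code p) (code q)"

primrec btime :: "nat \<Rightarrow> block \<Rightarrow> nat" where
  "btime D (Set r a) = 1"
| "btime D (Put a b) = 1"
| "btime D (Mul z x y t) = 5 * D + 5"
| "btime D (Shl a t) = 5 * D + 5"
| "btime D (If a p q) = max (btime D p) (btime D q) + 1"
| "btime D Nop = 0"
| "btime D (p ;; q) = btime D p + btime D q + 1"

primrec wp :: "nat \<Rightarrow> nat \<Rightarrow> nat \<Rightarrow> block \<Rightarrow> (state \<Rightarrow> bool) \<Rightarrow> state \<Rightarrow> bool" where
  "wp A B D (Set r a) Q = (\<lambda>(f, m). r < 40 \<and> aval a (f, m) < B \<and> Q (f(r := aval a (f, m)), m))"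
| "wp A B D (Put a b) Q = (\<lambda>(f, m). aval a (f, m) < A \<and> aval b (f, m) < B \<and> Q (f, m(aval a (f, m) := aval b (f, m))))"
| "wp A B D (Mul z x y t) Q = (\<lambda>(f, m). z < 40 \<and> t < 40 \<and> z \<noteq> x \<and> z \<noteq> y \<and> z \<noteq> t \<and> t \<noteq> x \<and>
     f y \<le> D \<and> f x * f y < B \<and> Q (f(z := f x * f y, t := 0), m))"
| "wp A B D (Shl a t) Q = (\<lambda>(f, m). a < 40 \<and> t < 40 \<and> a \<noteq> t \<and> f t \<le> D \<and> f a * 2 ^ f t < B \<and>
     Q (f(a := f a * 2 ^ f t, t := 0), m))"
| "wp A B D (If a p q) Q = (\<lambda>s. if aval a s \<noteq> 0 then wp A B D p Q s else wp A B D q Q s)"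
| "wp A B D Nop Q = Q"
| "wp A B D (p ;; q) Q = wp A B D p (wp A B D q Q)"

lemma ok_code: "wp A B D p Q s \<Longrightarrow> ok A B (code p) s (btime D p) Q"
proof (induction p arbitrary: s Q)
  case (Then p q)
  have "ok A B (code p) s (btime D p) (\<lambda>s1. ok A B (code q) s1 (btime D q) Q)"
  proof (rule ok_mono[OF Then.IH(1) order_refl])
    show "wp A B D p (wp A B D q Q) s" using Then.prems by simp
  qed (rule Then.IH(2))
  then show ?case by (simp only: code.simps btime.simps ok_Seq)
next
  case (If a p q)
  then show ?case unfolding code.simps btime.simps by (intro ok_Cond) auto
next
  case (Set r a)
  then show ?case by (cases s) (auto simp del: One_nat_def intro: ok_Assign)
next
  case (Put a b)
  then show ?case by (cases s) (auto simp del: One_nat_def intro: ok_Store)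
next
  case (Mul z x y t)
  then show ?case by (cases s) (auto intro: ok_mul_le)
next
  case (Shl a t)
  then show ?case by (cases s) (auto intro: ok_shl_le)
next
  case Nop
  then show ?case by (simp add: ok_Skip)
qed

lemma ok_code_le: "wp A B D p Q s \<Longrightarrow> btime D p \<le> T \<Longrightarrow> ok A B (code p) s T Q"
  using ok_code ok_le by blast

lemma ok_code_Seq:
  "wp A B D p (\<lambda>s. ok A B c s T1 Q) s \<Longrightarrow> btime D p + T1 + 1 \<le> T \<Longrightarrow> ok A B (Seq (code p) c) s T Q"
  using ok_Seq[OF ok_code] ok_le by blast

section \<open>Evaluating the contribution of a vertex\<close>

text \<open>
  Registers: 0--5 hold \<open>n\<close>, \<open>k\<close>, whether vertex 0 is universal, \<open>s\<close>, \<open>m\<close> and the answer; 6--8 and 10, 11 hold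
  \<open>N = n + 1\<close>, \<open>b\<close>, \<open>N\<^sup>2\<close>, \<open>R\<close> and \<open>\<beta>\<close>; 12--16 hold \<open>\<beta> R, \<dots>, \<beta> R\<^sup>5\<close>; 17 and 19--21 hold the addresses of the
  random bits and of three arrays indexed by the vertices: the current state, the incoming product,
  and the sum over the states treated so far. Register 22 accumulates the product, 23 is
  the current vertex, 24 the next candidate for a child and 25 tells whether the search goes on.
  The weight of an edge \<open>(u, v)\<close> has the number \<open>u N + v\<close>, that of a mark at \<open>v\<close> the number \<open>v N + v\<close>.
\<close>

definition read_weight :: com where
  "read_weight =
    Seq (code (Mul 28 26 6 29 ;; Set 28 (Add (Reg 28) (Reg 23)) ;; Mul 30 28 7 29 ;;
      Set 30 (Add (Reg 30) (Reg 17)) ;; Set 29 (Reg 7) ;; Set 31 (Const 0)))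
    (Seq (While (Reg 29) (code (Set 31 (Add (Add (Reg 31) (Reg 31)) (Load (Reg 30))) ;;
       Set 30 (Add (Reg 30) (Const 1)) ;; Set 29 (Sub (Reg 29) (Const 1)))))
    (code (Mul 27 11 31 29)))"

definition absd :: "aexp \<Rightarrow> aexp \<Rightarrow> aexp" where "absd a b = Add (Sub a b) (Sub b a)"

lemma aval_absd [simp]: "aval (absd a b) s = (aval a s - aval b s) + (aval b s - aval a s)"
  by (simp add: absd_def)

text \<open>For a nonzero state \<open>a\<close>, the nested absolute difference
  \<open>||a - 2| - 1|\<close> vanishes iff \<open>a\<close> is 1 or 3, the left states. The final
  assignment starts the walk to the root at the current vertex.\<close>

definition vertex_block :: block where
  "vertex_block =
    Set 27 (Add (Reg 27) (Reg 14)) ;;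
    If (Reg 32)
      (Set 33 (Reg 13) ;; If (Sub (Reg 32) (Const 2)) Nop (Set 33 (Add (Reg 33) (Reg 15))) ;; Shl 22 33 ;;
       If (absd (absd (Reg 32) (Const 2)) (Const 1)) Nop
         (Set 33 (Reg 27) ;; Set 34 (Reg 22) ;; Shl 34 33 ;; Set 22 (Add (Reg 22) (Reg 34))))
      (Set 34 (Reg 22) ;; Set 33 (Add (Reg 13) (Reg 27)) ;; Shl 34 33 ;; Set 22 (Add (Reg 22) (Reg 34)) ;;
       Set 33 (Reg 15) ;; Shl 34 33 ;; Set 22 (Add (Reg 22) (Reg 34))) ;;
    Set 26 (Reg 23)"

text \<open>Vertex \<open>v\<close> of the tree is vertex \<open>v - 1\<close> of the input. Edges
  at the auxiliary vertex are not in the matrix; they all exist or all do not, according to register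
  2.\<close>

definition adjacency_block :: block where
  "adjacency_block =
    If (Reg 26)
      (Set 35 (Sub (Reg 26) (Const 1)) ;; Mul 28 35 0 29 ;;
       Set 35 (Load (Add (Add (Reg 0) (Reg 28)) (Sub (Reg 23) (Const 1)))))
      (Set 35 (Reg 2)) ;;
    Set 36 (Load (Add (Reg 19) (Reg 26)))"

text \<open>The nested absolute difference vanishes iff \<open>|a - c|\<close> is 0 or 2, that is,
  iff the two states have the same parity. Among the states 1 to 4, parity is the side of the
  cut.\<close>

definition add_block :: block where
  "add_block =
    If (Reg 35) (If (Reg 36) (If (Reg 32) (If (absd (absd (absd (Reg 32) (Reg 36)) (Const 1)) (Const 1)) Nop
      (Set 33 (Add (Reg 12) (Reg 27)) ;;
       If (Sub (Reg 36) (Const 2)) (Set 33 (Add (Reg 33) (Reg 15))) Nop ;;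
       If (Sub (Reg 32) (Const 2)) (Set 33 (Add (Reg 33) (Reg 15))) Nop ;;
       Set 34 (Reg 22) ;; Shl 34 33 ;; Set 22 (Add (Reg 22) (Reg 34)))) Nop) Nop) Nop"

definition edge_block :: block where "edge_block = adjacency_block ;; add_block"

text \<open>In the shifted numbering, cell \<open>v - 1\<close> of the input array is the parent of
  \<open>v\<close>: it holds the successor of the old parent, and the value 0 at an old root is the
  auxiliary vertex.\<close>

definition edge_loop :: com where
  "edge_loop = While (Reg 26) (Seq (code (Set 26 (Load (Sub (Reg 26) (Const 1))))) (Seq read_weight (code edge_block)))"

definition local_step :: com where
  "local_step =
    Seq (code (Set 22 (Load (Add (Reg 20) (Reg 23))) ;; Set 32 (Load (Add (Reg 19) (Reg 23))) ;; Set 26 (Reg 23)))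
    (Seq read_weight (Seq (code vertex_block) (Seq edge_loop (code (Set 24 (Const 1))))))"

text \<open>The random bits are a parameter, so that there is one interpretation for each outcome of
  the coin tosses. The result of the search is below \<open>2 ^ D\<close>; the two further bits in
  the bound on \<open>B\<close> leave room for doubling when the result is read.\<close>

locale machine = rooted_tree n H par lvl for n H :: nat and par lvl :: "nat \<Rightarrow> nat" +
  fixes pf ks mk ans b R \<beta> B :: nat and bits :: "nat \<Rightarrow> bool" and pc :: "nat \<Rightarrow> nat" and adj :: "nat \<Rightarrow> nat \<Rightarrow> bool"
  fixes N base0 bst bA bS A D :: nat
  defines "N \<equiv> n + 1" and "base0 \<equiv> n + n * n" and "bst \<equiv> base0 + N * N * b"
    and "bA \<equiv> bst + N" and "bS \<equiv> bA + N" and "A \<equiv> bS + N" and "D \<equiv> \<beta> * R ^ 5"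
  assumes R4: "4 \<le> R" and bR: "2 ^ b \<le> R" and NR: "N * N \<le> R" and \<beta>: "N * N + 4 * N \<le> \<beta>" and AD: "A \<le> D"
    and BD: "2 ^ (D + 2) \<le> B" and pc: "1 \<le> v \<Longrightarrow> v \<le> n \<Longrightarrow> pc (v - 1) = par v"
begin

definition cregs :: "(nat \<Rightarrow> nat) \<Rightarrow> bool" where
  "cregs f \<longleftrightarrow> f 0 = n \<and> f 2 = pf \<and> f 6 = N \<and> f 7 = b \<and> f 10 = R \<and> f 11 = \<beta> \<and> f 12 = \<beta> * R \<and> f 13 = \<beta> * R\<^sup>2 \<and>
     f 14 = \<beta> * R ^ 3 \<and> f 15 = \<beta> * R ^ 4 \<and> f 16 = D \<and> f 17 = base0 \<and> f 19 = bst \<and> f 20 = bA \<and> f 21 = bS \<and>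
     f 3 = ks \<and> f 4 = mk \<and> f 5 = ans"

definition cmem :: "(nat \<Rightarrow> nat) \<Rightarrow> bool" where
  "cmem m \<longleftrightarrow> (\<forall>v<n. m v = pc v) \<and> (\<forall>u<n. \<forall>v<n. m (n + u * n + v) = of_bool (adj u v)) \<and>
     (\<forall>j<N * N * b. m (base0 + j) = of_bool (bits j))"

definition wt :: "nat \<times> nat \<Rightarrow> nat" where "wt = (\<lambda>(u, v). bit_weight bits b (u * N + v))"

lemma D_less_B: "x \<le> D \<Longrightarrow> x < B"
proof -
  have "D < 2 ^ (D + 2)" by (rule less_trans[OF less_exp]) simp
  then show "x \<le> D \<Longrightarrow> x < B" using BD by simp
qed

lemma R_pow_le: "i \<le> 5 \<Longrightarrow> \<beta> * R ^ i \<le> D"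
  unfolding D_def using R4 by (intro mult_le_mono2 power_increasing) auto

lemma b_le_R: "b \<le> R" using less_imp_le[OF less_exp[of b]] bR by (rule order_trans)

lemma R_le_D: "R \<le> D"
proof -
  have "1 \<le> \<beta>" using \<beta> by (simp add: N_def)
  then have "1 * R \<le> \<beta> * R" by (rule mult_le_mono1)
  also have "\<dots> \<le> D" using R_pow_le[of 1] by simp
  finally show ?thesis by simp
qed

lemma \<beta>_le_D: "\<beta> \<le> D" using R_pow_le[of 0] by simp

lemma index_less: "u \<le> n \<Longrightarrow> v \<le> n \<Longrightarrow> u * N + v < N * N"
proof -
  assume uv: "u \<le> n" "v \<le> n"
  then have "u * N + v < u * N + N" by (simp add: N_def)
  also have "\<dots> = Suc u * N" by simp
  also have "\<dots> \<le> N * N" using uv by (intro mult_le_mono1) (simp add: N_def)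
  finally show ?thesis .
qed

lemma bit_index_less: "u \<le> n \<Longrightarrow> v \<le> n \<Longrightarrow> j < b \<Longrightarrow> (u * N + v) * b + j < N * N * b"
proof -
  assume uv: "u \<le> n" "v \<le> n" and j: "j < b"
  have "(u * N + v) * b + j < Suc (u * N + v) * b" using j by simp
  also have "\<dots> \<le> N * N * b" using index_less[OF uv] by (intro mult_le_mono1) simp
  finally show ?thesis .
qed

lemma ok_read_weight:
  assumes f: "cregs f" "cmem m" "f 26 = u" "f 23 = v" "u \<le> n" "v \<le> n"
    and Q: "\<And>f'. f' 27 = \<beta> * wt (u, v) \<Longrightarrow> (\<And>r. r \<notin> {27, 28, 29, 30, 31} \<Longrightarrow> f' r = f r) \<Longrightarrow> Q (f', m)"
  shows "ok A B read_weight (f, m) (25 * D + 50) Q"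
proof -
  let ?i = "u * N + v"
  let ?g = "\<lambda>j. of_bool (bits (?i * b + j)) :: nat"
  have i: "?i < N * N" using index_less f by simp
  have ND: "N \<le> D" "b \<le> D" using b_le_R R_le_D \<beta> \<beta>_le_D by (auto simp: N_def)
  have iD: "?i \<le> D" using i NR R_le_D by simp
  have iuD: "u * N \<le> D" using iD by simp
  have ib: "?i * b + b \<le> N * N * b"
  proof -
    have "Suc ?i * b \<le> N * N * b" using i by (intro mult_le_mono1) simp
    then show ?thesis by simp
  qed
  have A_eq: "base0 + N * N * b \<le> A" by (simp add: A_def bS_def bA_def bst_def)
  have ibD: "base0 + ?i * b + b \<le> D" using ib A_eq AD by simp
  have bv: "binval ?g j < 2 ^ j" for j by (rule binval_less) simp
  have wt_eq: "wt (u, v) = binval ?g b" by (simp add: wt_def bit_weight_def)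
  have wtR: "binval ?g b < R" using bv[of b] bR by simp
  have load: "m (base0 + (?i * b + j)) = ?g j" if "j < b" for j
    using f(2) bit_index_less[OF f(5,6) that] by (simp add: cmem_def)
  let ?f1 = "f(28 := ?i, 30 := base0 + ?i * b, 29 := b, 31 := 0)"
  let ?Inv = "\<lambda>k s. s = (?f1(31 := binval ?g (b - k), 30 := base0 + ?i * b + (b - k), 29 := k), m)"
  let ?body = "code (Set 31 (Add (Add (Reg 31) (Reg 31)) (Load (Reg 30))) ;;
       Set 30 (Add (Reg 30) (Const 1)) ;; Set 29 (Sub (Reg 29) (Const 1)))"
  have fin: "ok A B (code (Mul 27 11 31 29)) (?f1(31 := binval ?g b, 30 := base0 + ?i * b + b, 29 := 0), m) (5 * D + 5) Q"
  proof (rule ok_code_le[where D = D])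
    have "\<beta> * binval ?g b \<le> \<beta> * R" using wtR by (intro mult_le_mono2) simp
    also have "\<dots> \<le> D" using R_pow_le[of 1] by simp
    finally have "\<beta> * binval ?g b < B" by (rule D_less_B)
    moreover have "binval ?g b \<le> D" using wtR R_le_D by simp
    ultimately show "wp A B D (Mul 27 11 31 29) Q (?f1(31 := binval ?g b, 30 := base0 + ?i * b + b, 29 := 0), m)"
      using f(1) by (simp add: cregs_def) (rule Q; auto simp: wt_eq)
  qed simp
  have loop: "ok A B (While (Reg 29) ?body) (?f1, m) (b * (5 + 2) + 1)
      (\<lambda>s. ok A B (code (Mul 27 11 31 29)) s (5 * D + 5) Q)"
  proof (rule ok_count_down[where Inv = ?Inv])
    fix k s assume k: "k < b" "?Inv (Suc k) s"
    then have k': "b - k = Suc (b - Suc k)" "b - Suc k < b" by auto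
    have "binval ?g (Suc (b - Suc k)) < 2 ^ (Suc (b - Suc k))" by (rule bv)
    also have "\<dots> \<le> 2 ^ b" using k by (intro power_increasing) auto
    also have "\<dots> \<le> D" using bR R_le_D by simp
    finally have lt: "binval ?g (Suc (b - Suc k)) < B" using D_less_B by simp
    have s: "s = (?f1(31 := binval ?g (b - Suc k), 30 := base0 + ?i * b + (b - Suc k), 29 := Suc k), m)" using k(2) by blast
    have ltB: "base0 + ?i * b + (b - k) < B" "k < B" using ibD k ND by (auto intro!: D_less_B)
    show "ok A B ?body s 5 (\<lambda>s'. fst s' 29 = k \<and> ?Inv k s')"
      unfolding s
      by (rule ok_code_le[where D = D])
        (use load[OF k'(2)] k' lt ltB in \<open>simp_all add: add.assoc mult_2[symmetric] fun_upd_twist\<close>)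
  qed (use fin in \<open>auto simp: fun_upd_twist\<close>)
  show ?thesis
    unfolding read_weight_def
  proof (rule ok_code_Seq[where D = D])
    have lts: "u * N < B" "?i < B" "?i * b < B" "base0 + ?i * b < B" "b < B" "0 < B"
      using iuD iD ibD ND by (auto intro!: D_less_B)
    have "ok A B (Seq (While (Reg 29) ?body) (code (Mul 27 11 31 29))) (?f1, m) (b * (5 + 2) + 1 + (5 * D + 5) + 1) Q"
      by (rule ok_Seq[OF loop])
    moreover have "f(28 := ?i, 30 := base0 + ?i * b, 29 := b, 31 := 0) = f(28 := ?i, 29 := 0, 30 := base0 + ?i * b, 29 := b, 31 := 0)"
      by (simp add: fun_eq_iff)
    ultimately show "wp A B D (Mul 28 26 6 29 ;; Set 28 (Add (Reg 28) (Reg 23)) ;; Mul 30 28 7 29 ;;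
      Set 30 (Add (Reg 30) (Reg 17)) ;; Set 29 (Reg 7) ;; Set 31 (Const 0))
      (\<lambda>s. ok A B (Seq (While (Reg 29) ?body) (code (Mul 27 11 31 29))) s (b * (5 + 2) + 1 + (5 * D + 5) + 1) Q) (f, m)"
      using f lts ND by (simp add: cregs_def add.commute fun_upd_twist)
  qed (use ND in simp)
qed

definition adjacent :: "nat \<Rightarrow> nat \<Rightarrow> bool" where
  "adjacent u v \<longleftrightarrow> (if u = 0 then pf \<noteq> 0 else adj (u - 1) (v - 1))"

definition EA :: "(nat \<times> nat) set" where
  "EA = {(u, v). v \<le> n \<and> u \<in> set (ancestors v) \<and> adjacent u v}"

sublocale cut_count "{..n}" EA wt R
proof
  show "EA \<subseteq> {..n} \<times> {..n}" "\<And>e. e \<in> EA \<Longrightarrow> fst e \<noteq> snd e"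
    using ancestors_lvl by (force simp: EA_def)+
qed simp

abbreviation "x \<equiv> (2::nat) ^ \<beta>"

definition efactor :: "nat \<Rightarrow> nat \<Rightarrow> nat \<Rightarrow> nat \<Rightarrow> nat" where
  "efactor u v a c = 1 + (if adjacent u v then efac x (u, v) a c else 0)"

text \<open>Each edge is charged to its lower end, where the states of both ends are already
  chosen.\<close>

definition loc :: "nat \<Rightarrow> (nat \<Rightarrow> nat) \<Rightarrow> nat" where
  "loc v \<sigma> = vfac x v (\<sigma> v) * (\<Prod>u\<leftarrow>ancestors v. efactor u v (\<sigma> u) (\<sigma> v))"

lemma wt_less_R: "wt e < R"
  using less_le_trans[OF bit_weight_less bR] by (cases e) (simp add: wt_def)

lemma exponent_le: "e \<le> R ^ 5 \<Longrightarrow> \<beta> * e \<le> D" "e \<le> R ^ 5 \<Longrightarrow> \<beta> * e < B"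
  using D_less_B by (auto simp: D_def)

lemma R_sums: "R + wt e + 2 * R ^ 4 \<le> R ^ 5" "R\<^sup>2 + (R ^ 3 + wt e) + R ^ 4 \<le> R ^ 5"
proof -
  have p: "R ^ i \<le> R ^ 4" if "i \<le> 4" for i using R4 that by (intro power_increasing) auto
  have "4 * R ^ 4 \<le> R * R ^ 4" using R4 by (rule mult_le_mono1)
  also have "\<dots> = R ^ 5" by (simp add: eval_nat_numeral)
  finally have 5: "4 * R ^ 4 \<le> R ^ 5" .
  have w: "wt e \<le> R ^ 4" "R \<le> R ^ 4" using wt_less_R[of e] p[of 1] by auto
  show "R + wt e + 2 * R ^ 4 \<le> R ^ 5" using w 5 by linarith
  show "R\<^sup>2 + (R ^ 3 + wt e) + R ^ 4 \<le> R ^ 5" using w 5 p[of 2] p[of 3] by linarith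
qed

lemma same_side_test:
  assumes "a < 5" "c < 5" "a \<noteq> 0" "c \<noteq> 0"
  shows "(a - c + (c - a) - 1 + (1 - (a - c + (c - a))) - 1 + (1 - (a - c + (c - a) - 1 + (1 - (a - c + (c - a))))) = 0) \<longleftrightarrow> same_side c a"
proof -
  have "a \<in> {1, 2, 3, 4}" "c \<in> {1, 2, 3, 4}" using assms by auto
  then show ?thesis by (elim insertE emptyE) (simp_all add: same_side_def left_def)
qed

lemma wp_adjacency_block:
  assumes f: "cregs f" "cmem m" "f 26 = u" "f 23 = v"
    and uv: "u \<le> n" "1 \<le> v" "v \<le> n" and fit: "fits A B (f, m)"
    and Q: "\<And>f'. (f' 35 \<noteq> 0 \<longleftrightarrow> adjacent u v) \<Longrightarrow> f' 36 = m (bst + u) \<Longrightarrow>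
      (\<And>r. r \<notin> {28, 29, 35, 36} \<Longrightarrow> f' r = f r) \<Longrightarrow> Q (f', m)"
  shows "wp A B D adjacency_block Q (f, m)"
proof -
  have ND: "n \<le> D" using \<beta> \<beta>_le_D by (simp add: N_def)
  have regs: "f 0 = n" "f 2 = pf" "f 19 = bst" using f(1) by (simp_all add: cregs_def)
  have mB: "m a < B" for a using fit by (rule fits_D)
  have pB: "pf < B" using fits_D(1)[OF fit, of 2] regs by simp
  show ?thesis
  proof (cases "u = 0")
    case True
    show ?thesis using True regs f(3,4) mB pB
      by (simp add: adjacency_block_def) (rule Q; simp add: adjacent_def)
  next
    case False
    have "(u - 1) * n \<le> base0" using uv by (simp add: base0_def trans_le_add2)
    also have "\<dots> \<le> A" by (simp add: A_def bS_def bA_def bst_def)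
    finally have uB: "(u - 1) * n < B" "u - 1 < B" using AD uv ND by (auto intro!: D_less_B)
    have "u - 1 < n" "v - 1 < n" using uv False by auto
    then have "m (n + (u - 1) * n + (v - 1)) = of_bool (adj (u - 1) (v - 1))"
      using f(2) unfolding cmem_def by blast
    then have ld: "m (n + (u - 1) * n + (v - 1)) \<noteq> 0 \<longleftrightarrow> adj (u - 1) (v - 1)" by simp
    show ?thesis using False regs f(3,4) mB ND uB uv
      by (simp add: adjacency_block_def) (rule Q; use ld in \<open>simp add: adjacent_def\<close>)
  qed
qed

lemma wp_add_block:
  assumes f: "cregs f" "f 27 = \<beta> * wt (u, v)" "f 32 = a" "f 36 = c" "f 35 \<noteq> 0 \<longleftrightarrow> adjacent u v" "f 22 = y"
    and ac: "a < 5" "c < 5" and B: "y * efactor u v c a < B"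
    and Q: "\<And>f'. f' 22 = y * efactor u v c a \<Longrightarrow> (\<And>r. r \<notin> {22, 33, 34} \<Longrightarrow> f' r = f r) \<Longrightarrow> Q (f', m)"
  shows "wp A B D add_block Q (f, m)"
proof (cases "adjacent u v \<and> same_side c a")
  case False
  then have "efactor u v c a = 1" by (auto simp: efactor_def efac_def)
  then have "Q (f, m)" using Q[of f] f(6) by simp
  moreover have "(a - c + (c - a) - 1 + (1 - (a - c + (c - a))) - 1 + (1 - (a - c + (c - a) - 1 + (1 - (a - c + (c - a))))) \<noteq> 0)"
    if "f 35 \<noteq> 0" "a \<noteq> 0" "c \<noteq> 0"
    unfolding same_side_test[OF ac that(2,3)] using False that(1) f(5) by blast
  ultimately show ?thesis using f(3,4) by (simp add: add_block_def)
next
  case True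
  let ?e = "R + wt (u, v) + R ^ 4 * (high c + high a)"
  have ne: "a \<noteq> 0" "c \<noteq> 0" using True by (auto simp: same_side_def)
  have test: "(a - c + (c - a) - 1 + (1 - (a - c + (c - a))) - 1 + (1 - (a - c + (c - a) - 1 + (1 - (a - c + (c - a))))) = 0)"
    using same_side_test[OF ac ne] True by blast
  have "efactor u v c a = 1 + x ^ ?e" using True by (simp add: efactor_def efac_def)
  then have ef: "y * efactor u v c a = y + y * 2 ^ (\<beta> * ?e)" by (simp add: power_mult)
  have "R ^ 4 * (high c + high a) \<le> R ^ 4 * 2" by (intro mult_le_mono2) (simp add: high_def)
  then have e5: "?e \<le> R ^ 5" using R_sums(1)[of "(u, v)"] by linarith
  have e: "\<beta> * ?e \<le> D" using e5 by (rule exponent_le)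
  have e1: "\<beta> * (R + wt (u, v)) \<le> D" "\<beta> * (R + wt (u, v) + R ^ 4) \<le> D"
    using R_sums(1)[of "(u, v)"] by (intro exponent_le; linarith)+
  have eB: "\<beta> * ?e < B" "\<beta> * (R + wt (u, v)) < B" "\<beta> * (R + wt (u, v) + R ^ 4) < B"
    using e e1 by (auto intro: D_less_B)
  have yB: "y < B" "y * 2 ^ (\<beta> * ?e) < B" "y + y * 2 ^ (\<beta> * ?e) < B"
    using B unfolding ef by linarith+
  have high: "high c = of_bool (c - 2 \<noteq> 0)" "high a = of_bool (a - 2 \<noteq> 0)" by (auto simp: high_def)
  have regs: "f 12 = \<beta> * R" "f 15 = \<beta> * R ^ 4" using f(1) by (simp_all add: cregs_def)
  have Q': "Q (f', m)" if "f' 22 = y + y * 2 ^ (\<beta> * ?e)" "\<And>r. r \<notin> {22, 33, 34} \<Longrightarrow> f' r = f r" for f'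
    using Q[of f'] that unfolding ef by blast
  have f35: "f 35 \<noteq> 0" using f(5) True by simp
  have yB': "y * 2 ^ (\<beta> * ?e) < B" "y * 2 ^ (\<beta> * ?e) + y < B" using yB by auto
  have sums: "\<beta> * R + \<beta> * wt (u, v) = \<beta> * (R + wt (u, v))"
    "\<beta> * (R + wt (u, v)) + \<beta> * R ^ 4 = \<beta> * (R + wt (u, v) + R ^ 4)"
    "\<beta> * (R + wt (u, v) + R ^ 4) + \<beta> * R ^ 4 = \<beta> * (R + wt (u, v) + (R ^ 4 + R ^ 4))"
    by (simp_all add: algebra_simps)
  let ?add = "Set 34 (Reg 22) ;; Shl 34 33 ;; Set 22 (Add (Reg 22) (Reg 34))"
  have tail: "wp A B D ?add Q (g, m)" if "g 33 = \<beta> * ?e" "\<And>r. r \<noteq> 33 \<Longrightarrow> g r = f r" for g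
    using that f(6) yB e by simp (rule Q'; auto)
  have head: "wp A B D (Set 33 (Add (Reg 12) (Reg 27)) ;;
       If (Sub (Reg 36) (Const 2)) (Set 33 (Add (Reg 33) (Reg 15))) Nop ;;
       If (Sub (Reg 32) (Const 2)) (Set 33 (Add (Reg 33) (Reg 15))) Nop ;; T) Q (f, m)"
    if T: "\<And>g. g 33 = \<beta> * ?e \<Longrightarrow> (\<And>r. r \<noteq> 33 \<Longrightarrow> g r = f r) \<Longrightarrow> wp A B D T Q (g, m)" for T
  proof -
    have high2: "high c = (if c \<le> 2 then 0 else 1)" "high a = (if a \<le> 2 then 0 else 1)"
      by (auto simp: high_def)
    consider "c \<le> 2" "a \<le> 2" | "c \<le> 2" "\<not> a \<le> 2" | "\<not> c \<le> 2" "a \<le> 2" | "\<not> c \<le> 2" "\<not> a \<le> 2" by blast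
    then show ?thesis
    proof cases
      case 1
      show ?thesis using 1 f(2,3,4) regs eB high2
        apply (simp add: sums)
        apply (rule T)
        apply simp_all
        done
    next
      case 2
      show ?thesis using 2 f(2,3,4) regs eB high2
        apply (simp add: sums)
        apply (rule T)
        apply simp_all
        done
    next
      case 3
      show ?thesis using 3 f(2,3,4) regs eB high2
        apply (simp add: sums)
        apply (rule T)
        apply simp_all
        done
    next
      case 4
      show ?thesis using 4 f(2,3,4) regs eB high2
        apply (simp add: sums)
        apply (rule T)
        apply simp_all
        done
    qed
  qed
  have "wp A B D (Set 33 (Add (Reg 12) (Reg 27)) ;;
       If (Sub (Reg 36) (Const 2)) (Set 33 (Add (Reg 33) (Reg 15))) Nop ;;
       If (Sub (Reg 32) (Const 2)) (Set 33 (Add (Reg 33) (Reg 15))) Nop ;; ?add) Q (f, m)"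
    by (rule head, rule tail)
  then show ?thesis using f35 f(3,4) ne test by (simp add: add_block_def del: wp.simps(1,4,7))
qed

lemma ok_edge_block:
  assumes f: "cregs f" "cmem m" "f 26 = u" "f 23 = v" "f 27 = \<beta> * wt (u, v)" "f 32 = a" "m (bst + u) = c" "f 22 = y"
    and uv: "u \<le> n" "1 \<le> v" "v \<le> n" "a < 5" "c < 5"
    and B: "y * efactor u v c a < B"
    and Q: "\<And>f'. f' 22 = y * efactor u v c a \<Longrightarrow> (\<And>r. r < 22 \<or> r \<in> {23, 24, 25, 26, 27, 32} \<Longrightarrow> f' r = f r) \<Longrightarrow> Q (f', m)"
  shows "ok A B (code edge_block) (f, m) (10 * D + 50) Q"
proof (rule ok_fits, rule ok_code_le[where D = D])
  assume fit: "fits A B (f, m)"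
  show "wp A B D edge_block Q (f, m)"
    unfolding edge_block_def wp.simps
  proof (rule wp_adjacency_block[OF f(1-4) uv(1-3) fit])
    fix f' assume f': "f' 35 \<noteq> 0 \<longleftrightarrow> adjacent u v" "f' 36 = m (bst + u)" "\<And>r. r \<notin> {28, 29, 35, 36} \<Longrightarrow> f' r = f r"
    show "wp A B D add_block Q (f', m)"
    proof (rule wp_add_block)
      show "cregs f'" using f(1) f'(3) by (simp add: cregs_def)
      show "f' 27 = \<beta> * wt (u, v)" "f' 32 = a" "f' 36 = c" "f' 22 = y" "f' 35 \<noteq> 0 \<longleftrightarrow> adjacent u v"
        using f f' by simp_all
      show "Q (g, m)" if "g 22 = y * efactor u v c a" "\<And>r. r \<notin> {22, 33, 34} \<Longrightarrow> g r = f' r" for g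
        using that f'(3) by (intro Q) auto
    qed (use uv B in auto)
  qed
qed (simp add: edge_block_def adjacency_block_def add_block_def)

lemma ok_vertex_block:
  assumes f: "cregs f" "f 23 = v" "f 27 = \<beta> * wt (v, v)" "f 32 = a" "f 22 = y"
    and v: "v \<le> n" "a < 5" and B: "y * vfac x v a < B"
    and Q: "\<And>f'. f' 22 = y * vfac x v a \<Longrightarrow> f' 26 = v \<Longrightarrow> (\<And>r. r \<notin> {22, 26, 27, 33, 34} \<Longrightarrow> f' r = f r) \<Longrightarrow> Q (f', m)"
  shows "ok A B (code vertex_block) (f, m) (15 * D + 50) Q"
proof (rule ok_code_le[where D = D])
  let ?mc = "mcost v"
  have regs: "f 13 = \<beta> * R\<^sup>2" "f 14 = \<beta> * R ^ 3" "f 15 = \<beta> * R ^ 4" using f(1) by (simp_all add: cregs_def)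
  have mc: "\<beta> * wt (v, v) + \<beta> * R ^ 3 = \<beta> * ?mc" by (simp add: mcost_def algebra_simps)
  have es: "\<beta> * ?mc \<le> D" "\<beta> * (R\<^sup>2 + ?mc) \<le> D" "\<beta> * R ^ 4 \<le> D" "\<beta> * R\<^sup>2 \<le> D" "\<beta> * (R\<^sup>2 + R ^ 4) \<le> D"
    using R_sums(2)[of "(v, v)"] unfolding mcost_def by (intro exponent_le; linarith)+
  have vB: "v < B" using v \<beta> \<beta>_le_D by (intro D_less_B) (simp add: N_def)
  have esB: "\<beta> * ?mc < B" "\<beta> * (R\<^sup>2 + ?mc) < B" "\<beta> * R ^ 4 < B" "\<beta> * R\<^sup>2 < B" "\<beta> * (R\<^sup>2 + R ^ 4) < B"
    using es by (auto intro: D_less_B)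
  have pw: "x ^ e = 2 ^ (\<beta> * e)" for e by (simp add: power_mult)
  show "wp A B D vertex_block Q (f, m)"
  proof (cases "a = 0")
    case True
    let ?p = "2 ^ (\<beta> * (R\<^sup>2 + ?mc))" and ?q = "2 ^ (\<beta> * R ^ 4)"
    have eq: "y * vfac x v a = y + y * ?p + y * ?p * ?q"
      using True by (simp add: vfac_def pw algebra_simps)
    have le: "y < B" "y * ?p < B" "y + y * ?p < B" "y * ?p * ?q < B" "y + y * ?p + y * ?p * ?q < B"
      using B unfolding eq by linarith+
    have sum: "\<beta> * R\<^sup>2 + \<beta> * ?mc = \<beta> * (R\<^sup>2 + ?mc)" by (simp add: algebra_simps)
    show ?thesis using f True regs es esB le vB
      by (simp add: vertex_block_def mc sum) (rule Q; simp add: eq[symmetric])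
  next
    case False
    let ?e = "R\<^sup>2 + R ^ 4 * of_bool (a < 3)"
    let ?y = "y * 2 ^ (\<beta> * ?e)"
    have eq: "y * vfac x v a = (if left a then ?y + ?y * 2 ^ (\<beta> * ?mc) else ?y)"
      using False by (simp add: vfac_def pw algebra_simps)
    have le: "?y < B" "left a \<Longrightarrow> ?y * 2 ^ (\<beta> * ?mc) < B" "left a \<Longrightarrow> ?y + ?y * 2 ^ (\<beta> * ?mc) < B"
      using B unfolding eq by (auto split: if_splits)
    have sum: "\<beta> * R\<^sup>2 + \<beta> * R ^ 4 = \<beta> * (R\<^sup>2 + R ^ 4)" by (simp add: algebra_simps)
    have a: "a = 1 \<or> a = 2 \<or> a = 3 \<or> a = 4" using False v(2) by auto
    have left: "left 1" "\<not> left 2" "left 3" "\<not> left 4" by (auto simp: left_def)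
    from a show ?thesis
    proof (elim disjE)
      assume a: "a = 1"
      show ?thesis using f a regs es esB le vB left eq
        by (simp add: vertex_block_def mc sum) (rule Q; auto)
    next
      assume a: "a = 2"
      show ?thesis using f a regs es esB le vB left eq
        by (simp add: vertex_block_def mc sum) (rule Q; auto)
    next
      assume a: "a = 3"
      show ?thesis using f a regs es esB le vB left eq
        by (simp add: vertex_block_def mc sum) (rule Q; auto)
    next
      assume a: "a = 4"
      show ?thesis using f a regs es esB le vB left eq
        by (simp add: vertex_block_def mc sum) (rule Q; auto)
    qed
  qed
qed (simp add: vertex_block_def)

text \<open>No factor is zero, hence every partial product is bounded by the final one, and overflow
  has to be excluded for the final one only.\<close>

lemma prod_efactor_ge_1: "1 \<le> (\<Prod>t\<leftarrow>ts. efactor t v (h t) a)"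
proof (induction ts)
  case (Cons t ts)
  have "1 * 1 \<le> efactor t v (h t) a * (\<Prod>t\<leftarrow>ts. efactor t v (h t) a)"
    by (rule mult_le_mono) (use Cons in \<open>simp_all add: efactor_def\<close>)
  then show ?case by simp
qed simp

lemma ok_edge_loop:
  assumes "u \<le> n" "cregs f" "cmem m" "f 26 = u" "f 23 = v" "f 32 = a" "1 \<le> v \<or> u = 0" "v \<le> n" "a < 5"
    and "\<And>t. t \<in> set (ancestors u) \<Longrightarrow> m (bst + t) < 5"
    and "f 22 * (\<Prod>t\<leftarrow>ancestors u. efactor t v (m (bst + t)) a) < B"
    and "\<And>f'. f' 22 = f 22 * (\<Prod>t\<leftarrow>ancestors u. efactor t v (m (bst + t)) a) \<Longrightarrow>
      (\<And>r. r < 22 \<or> r \<in> {23, 24, 25, 32} \<Longrightarrow> f' r = f r) \<Longrightarrow> Q (f', m)"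
  shows "ok A B edge_loop (f, m) (length (ancestors u) * (35 * D + 110) + 1) Q"
  using assms
proof (induction arbitrary: f rule: tree_induct)
  case root
  have "Q (f, m)" using root by simp
  then show ?case using root(3) unfolding edge_loop_def by (simp del: One_nat_def) (rule ok_While_end; simp)
next
  case (child u)
  let ?p = "par u" and ?L = "length (ancestors (par u)) * (35 * D + 110) + 1"
  have p: "?p \<le> n" using par_le child by simp
  have v1: "1 \<le> v" using child by auto
  have anc: "ancestors u = ?p # ancestors ?p" using ancestors_Suc child by simp
  have load: "m (u - 1) = ?p" using child pc[of u] by (simp add: cmem_def)
  have pB: "?p < B" using p \<beta> \<beta>_le_D by (intro D_less_B) (simp add: N_def)
  let ?e = "efactor ?p v (m (bst + ?p)) a"
  let ?r = "\<Prod>t\<leftarrow>ancestors ?p. efactor t v (m (bst + t)) a"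
  have r1: "1 \<le> ?r" by (rule prod_efactor_ge_1)
  have bnd: "f 22 * ?e * ?r < B" using child.prems(10) anc by (simp add: mult.assoc)
  have bnd1: "f 22 * ?e < B"
  proof -
    have "f 22 * ?e * 1 \<le> f 22 * ?e * ?r" using r1 by (rule mult_le_mono2)
    also note bnd
    finally show ?thesis by simp
  qed
  have "ok A B (Seq (code (Set 26 (Load (Sub (Reg 26) (Const 1))))) (Seq read_weight (code edge_block))) (f, m)
      (35 * D + 108) (\<lambda>s. ok A B edge_loop s ?L Q)"
  proof (rule ok_code_Seq[where D = D])
    have reads: "ok A B (Seq read_weight (code edge_block)) (f(26 := ?p), m) ((25 * D + 50) + (10 * D + 50) + 1) (\<lambda>s. ok A B edge_loop s ?L Q)"
    proof (rule ok_Seq, rule ok_read_weight)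
      show "cregs (f(26 := ?p))" using child.prems(1) by (simp add: cregs_def)
      fix f' assume f': "f' 27 = \<beta> * wt (?p, v)" "\<And>r. r \<notin> {27, 28, 29, 30, 31} \<Longrightarrow> f' r = (f(26 := ?p)) r"
      show "ok A B (code edge_block) (f', m) (10 * D + 50) (\<lambda>s. ok A B edge_loop s ?L Q)"
      proof (rule ok_edge_block[where u = ?p and v = v and a = a and c = "m (bst + ?p)" and y = "f 22"])
        show "cregs f'" using child.prems(1) f'(2) by (simp add: cregs_def)
        fix g assume g: "g 22 = f 22 * ?e" "\<And>r. r < 22 \<or> r \<in> {23, 24, 25, 26, 27, 32} \<Longrightarrow> g r = f' r"
        have gf: "g r = f r" if "r < 22 \<or> r \<in> {23, 24, 25, 32}" for r
          using g(2)[of r] f'(2)[of r] that by auto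
        show "ok A B edge_loop (g, m) ?L Q"
        proof (rule child.IH)
          show "cregs g" using child.prems(1) gf by (simp add: cregs_def)
          show "g 26 = ?p" using g(2)[of 26] f'(2)[of 26] by simp
          show "g 22 * ?r < B" using g(1) bnd by simp
          fix h assume h: "h 22 = g 22 * ?r" "\<And>r. r < 22 \<or> r \<in> {23, 24, 25, 32} \<Longrightarrow> h r = g r"
          show "Q (h, m)"
            by (rule child.prems(11)) (use h gf g(1) anc in \<open>auto simp: mult.assoc\<close>)
        qed (use child.prems gf v1 anc in auto)
      qed (use f' child.prems p v1 anc bnd1 in auto)
    qed (use child.prems p in auto)
    show "wp A B D (Set 26 (Load (Sub (Reg 26) (Const 1))))
        (\<lambda>s. ok A B (Seq read_weight (code edge_block)) s ((25 * D + 50) + (10 * D + 50) + 1) (\<lambda>s. ok A B edge_loop s ?L Q)) (f, m)"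
      using reads load pB child.prems(3) by simp
  qed simp
  then have "ok A B edge_loop (f, m) ((35 * D + 108) + ?L + 2) Q"
    unfolding edge_loop_def by (intro ok_While_step) (use child in auto)
  then show ?case by (rule ok_le) (simp add: anc)
qed

lemma length_ancestors: "v \<le> n \<Longrightarrow> length (ancestors v) \<le> n"
proof -
  assume v: "v \<le> n"
  have "set (ancestors v) \<subseteq> {..n} - {v}" using ancestors_lvl[OF v] by fastforce
  then have "card (set (ancestors v)) \<le> card ({..n} - {v})" by (intro card_mono) auto
  then show ?thesis using v distinct_card[OF distinct_ancestors[OF v]] by simp
qed

definition TL :: nat where "TL = N * (40 * D + 200)"

lemma ok_local_step:
  assumes f: "cregs f" "cmem m" "f 23 = v" "v \<le> n" and a: "m (bA + v) = y"
    and st: "\<And>u. u \<in> set (v # ancestors v) \<Longrightarrow> m (bst + u) < 5"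
    and B: "y * loc v (\<lambda>u. m (bst + u)) < B"
    and Q: "\<And>f'. f' 22 = y * loc v (\<lambda>u. m (bst + u)) \<Longrightarrow> f' 24 = 1 \<Longrightarrow>
      (\<And>r. r < 22 \<or> r \<in> {23, 25} \<Longrightarrow> f' r = f r) \<Longrightarrow> Q (f', m)"
  shows "ok A B local_step (f, m) TL Q"
proof (rule ok_fits)
  assume fit: "fits A B (f, m)"
  let ?a = "m (bst + v)"
  let ?r = "\<Prod>t\<leftarrow>ancestors v. efactor t v (m (bst + t)) ?a"
  have regs: "f 19 = bst" "f 20 = bA" using f(1) by (simp_all add: cregs_def)
  have r1: "1 \<le> ?r" by (rule prod_efactor_ge_1)
  have bnd: "y * vfac x v ?a * ?r < B" using B by (simp add: loc_def mult.assoc)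
  have bnd1: "y * vfac x v ?a < B"
  proof -
    have "y * vfac x v ?a * 1 \<le> y * vfac x v ?a * ?r" using r1 by (rule mult_le_mono2)
    also note bnd
    finally show ?thesis by simp
  qed
  let ?T4 = "1"
  let ?T3 = "(length (ancestors v) * (35 * D + 110) + 1) + ?T4 + 1"
  let ?T2 = "(15 * D + 50) + ?T3 + 1"
  let ?T1 = "(25 * D + 50) + ?T2 + 1"
  have len: "length (ancestors v) * (35 * D + 110) \<le> n * (35 * D + 110)"
    using length_ancestors[OF f(4)] by (rule mult_le_mono1)
  have one_B: "1 < B" using R4 R_le_D by (intro D_less_B) simp
  have main: "ok A B (Seq read_weight (Seq (code vertex_block) (Seq edge_loop (code (Set 24 (Const 1))))))
      (f(22 := y, 32 := ?a, 26 := v), m) ?T1 Q"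
  proof (rule ok_Seq, rule ok_read_weight)
    show "cregs (f(22 := y, 32 := ?a, 26 := v))" using f(1) by (simp add: cregs_def)
    fix f1 assume f1: "f1 27 = \<beta> * wt (v, v)" "\<And>r. r \<notin> {27, 28, 29, 30, 31} \<Longrightarrow> f1 r = (f(22 := y, 32 := ?a, 26 := v)) r"
    show "ok A B (Seq (code vertex_block) (Seq edge_loop (code (Set 24 (Const 1))))) (f1, m) ?T2 Q"
    proof (rule ok_Seq, rule ok_vertex_block)
      show "cregs f1" using f(1) f1(2) by (simp add: cregs_def)
      show "y * vfac x v ?a < B" by (rule bnd1)
      fix f2 assume f2: "f2 22 = y * vfac x v ?a" "f2 26 = v" "\<And>r. r \<notin> {22, 26, 27, 33, 34} \<Longrightarrow> f2 r = f1 r"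
      have f2': "f2 r = f r" if "r < 22 \<or> r \<in> {23, 24, 25}" for r
        using f2(3)[of r] f1(2)[of r] that by auto
      have f32: "f2 32 = ?a" using f2(3)[of 32] f1(2)[of 32] by simp
      show "ok A B (Seq edge_loop (code (Set 24 (Const 1)))) (f2, m) ?T3 Q"
      proof (rule ok_Seq, rule ok_edge_loop)
        show "cregs f2" using f(1) f2' by (simp add: cregs_def)
        show "f2 22 * ?r < B" using f2(1) bnd by simp
        fix f3 assume f3: "f3 22 = f2 22 * ?r" "\<And>r. r < 22 \<or> r \<in> {23, 24, 25, 32} \<Longrightarrow> f3 r = f2 r"
        have "Q (f3(24 := 1), m)"
        proof (rule Q)
          show "(f3(24 := 1)) 22 = y * loc v (\<lambda>u. m (bst + u))"
            using f3(1) f2(1) by (simp add: loc_def mult.assoc)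
          show "(f3(24 := 1)) r = f r" if "r < 22 \<or> r \<in> {23, 25}" for r
            using that f3(2)[of r] f2'[of r] by auto
        qed simp
        then show "ok A B (code (Set 24 (Const 1))) (f3, m) 1 Q"
          using one_B by (intro ok_code_le[where D = D]) simp_all
      qed (use f f2' f2(2) f32 st in auto)
    qed (use f f1 st in auto)
  qed (use f in auto)
  show "ok A B local_step (f, m) TL Q"
    unfolding local_step_def
  proof (rule ok_code_Seq[where D = D])
    have "y < B" "?a < B" "v < B" using fits_D(2)[OF fit] a fits_D(1)[OF fit, of 23] f(3) by blast+
    then show "wp A B D (Set 22 (Load (Add (Reg 20) (Reg 23))) ;; Set 32 (Load (Add (Reg 19) (Reg 23))) ;; Set 26 (Reg 23))
       (\<lambda>s. ok A B (Seq read_weight (Seq (code vertex_block) (Seq edge_loop (code (Set 24 (Const 1)))))) s ?T1 Q) (f, m)"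
      using main regs f(3) a by simp
    show "btime D (Set 22 (Load (Add (Reg 20) (Reg 23))) ;; Set 32 (Load (Add (Reg 19) (Reg 23))) ;; Set 26 (Reg 23)) + ?T1 + 1 \<le> TL"
      using len by (simp add: TL_def N_def algebra_simps)
  qed
qed

end

section \<open>The depth-first search\<close>

text \<open>Two large numbers cannot be multiplied in acceptable time. Therefore a subtree does not
  return its sum: it receives the product \<open>y\<close> computed so far and returns
  \<open>y\<close> times its sum. All multiplications are then by factors which are sums of few
  powers of two.\<close>

definition enter :: com where
  "enter = Seq (code (Put (Add (Reg 20) (Reg 23)) (Reg 22) ;; Put (Add (Reg 21) (Reg 23)) (Const 0) ;;
     Put (Add (Reg 19) (Reg 23)) (Const 0))) local_step"

definition finish_state :: com where
  "finish_state =
    Seq (code (Put (Add (Reg 21) (Reg 23)) (Add (Load (Add (Reg 21) (Reg 23))) (Reg 22))))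
      (Cond (Sub (Const 4) (Load (Add (Reg 19) (Reg 23))))
        (Seq (code (Put (Add (Reg 19) (Reg 23)) (Add (Load (Add (Reg 19) (Reg 23))) (Const 1)))) local_step)
        (code (Set 22 (Load (Add (Reg 21) (Reg 23))) ;;
          If (Reg 23) (Set 24 (Add (Reg 23) (Const 1)) ;; Set 23 (Load (Sub (Reg 23) (Const 1)))) (Set 25 (Const 0)))))"

text \<open>When a child is left, the scan at its parent resumes at the next number. Together with
  the parent array and the entries of the ancestors in the three arrays, this replaces a
  stack.\<close>

definition traverse_body :: com where
  "traverse_body =
    Cond (Sub (Reg 6) (Reg 24))
      (Cond (absd (Load (Sub (Reg 24) (Const 1))) (Reg 23))
        (code (Set 24 (Add (Reg 24) (Const 1))))
        (Seq (code (Set 23 (Reg 24))) enter))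
      finish_state"

definition traverse :: com where "traverse = While (Reg 25) traverse_body"

section \<open>Correctness of the search\<close>

context machine
begin

definition live :: "(nat \<Rightarrow> nat) \<Rightarrow> (nat \<Rightarrow> nat) \<Rightarrow> bool" where
  "live f m \<longleftrightarrow> cregs f \<and> cmem m \<and> f 25 = 1"

text \<open>The search below a vertex may change the entries of deeper vertices in all three arrays.
  Levels suffice to say what is preserved, since only the entries of ancestors, on smaller levels,
  are still needed.\<close>

definition frame :: "nat \<Rightarrow> (nat \<Rightarrow> nat) \<Rightarrow> (nat \<Rightarrow> nat) \<Rightarrow> bool" where
  "frame l m m' \<longleftrightarrow> (\<forall>a. (\<forall>u\<le>n. l \<le> lvl u \<longrightarrow> a \<noteq> bst + u \<and> a \<noteq> bA + u \<and> a \<noteq> bS + u) \<longrightarrow> m' a = m a)"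

lemma frame_refl: "frame l m m" by (simp add: frame_def)

lemma frame_trans: "frame l m1 m2 \<Longrightarrow> frame l m2 m3 \<Longrightarrow> frame l m1 m3"
  by (auto simp: frame_def)

lemma frame_mono: "frame l m m' \<Longrightarrow> l' \<le> l \<Longrightarrow> frame l' m m'"
  unfolding frame_def by (meson le_trans)

lemma frame_upd:
  assumes "frame l m m'" "u \<le> n" "l \<le> lvl u" "a = bst + u \<or> a = bA + u \<or> a = bS + u"
  shows "frame l m (m'(a := y))"
  using assms by (auto simp: frame_def)

lemma frame_static:
  assumes "frame l m m'" "a < bst" shows "m' a = m a"
  using assms unfolding frame_def by (auto simp: bA_def bS_def)

lemma frame_cells:
  assumes "frame l m m'" "u \<le> n" "lvl u < l"
  shows "m' (bst + u) = m (bst + u)" "m' (bA + u) = m (bA + u)" "m' (bS + u) = m (bS + u)"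
proof -
  have "(u' = u \<longleftrightarrow> bst + u = bst + u') \<and> bst + u \<noteq> bA + u' \<and> bst + u \<noteq> bS + u' \<and>
      bA + u \<noteq> bst + u' \<and> (u' = u \<longleftrightarrow> bA + u = bA + u') \<and> bA + u \<noteq> bS + u' \<and>
      bS + u \<noteq> bst + u' \<and> bS + u \<noteq> bA + u' \<and> (u' = u \<longleftrightarrow> bS + u = bS + u')" if "u' \<le> n" for u'
    using assms(2) that by (auto simp: bA_def bS_def N_def)
  then show "m' (bst + u) = m (bst + u)" "m' (bA + u) = m (bA + u)" "m' (bS + u) = m (bS + u)"
    using assms(1,3) unfolding frame_def by (metis not_le)+
qed

lemma cmem_frame: "cmem m \<Longrightarrow> frame l m m' \<Longrightarrow> cmem m'"
proof -
  assume m: "cmem m" and fr: "frame l m m'"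
  have "v < bst" if "v < n" for v using that by (simp add: bst_def base0_def)
  moreover have "n + u * n + v < bst" if "u < n" "v < n" for u v
  proof -
    have "u * n + v < Suc u * n" using that by simp
    also have "\<dots> \<le> n * n" using that by (intro mult_le_mono1) simp
    finally show ?thesis by (simp add: bst_def base0_def)
  qed
  moreover have "base0 + j < bst" if "j < N * N * b" for j using that by (simp add: bst_def)
  ultimately show "cmem m'" using m frame_static[OF fr] unfolding cmem_def by metis
qed

lemma loc_cong: "(\<And>u. u \<in> set (v # ancestors v) \<Longrightarrow> \<tau> u = \<sigma> u) \<Longrightarrow> loc v \<tau> = loc v \<sigma>"
  unfolding loc_def by (intro arg_cong2[where f = times] arg_cong[where f = prod_list] map_cong) auto

abbreviation "tsum \<equiv> tree_sum loc"

lemma tsum_simps: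
  "tsum 0 v \<sigma> = (\<Sum>a<5. loc v (\<sigma>(v := a)))"
  "tsum (Suc h) v \<sigma> = (\<Sum>a<5. loc v (\<sigma>(v := a)) * (\<Prod>c\<in>children v. tsum h c (\<sigma>(v := a))))"
  by (rule tree_sum.simps, rule loc_cong, blast)+

lemma tsum_cong:
  "v \<le> n \<Longrightarrow> (\<And>u. u \<in> set (ancestors v) \<Longrightarrow> \<tau> u = \<sigma> u) \<Longrightarrow> tsum h v \<tau> = tsum h v \<sigma>"
proof (induction h arbitrary: v \<sigma> \<tau>)
  case 0
  have "loc v (\<tau>(v := a)) = loc v (\<sigma>(v := a))" for a by (rule loc_cong) (use 0 in auto)
  then show ?case by (simp add: tsum_simps)
next
  case (Suc h)
  have "loc v (\<tau>(v := a)) = loc v (\<sigma>(v := a))" for a by (rule loc_cong) (use Suc.prems in auto)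
  moreover have "tsum h c (\<tau>(v := a)) = tsum h c (\<sigma>(v := a))" if "c \<in> children v" for c a
    by (rule Suc.IH) (use that Suc.prems(2) in \<open>auto simp: children_def ancestors_Suc\<close>)
  ultimately show ?case by (simp add: tsum_simps)
qed

lemma vfac_pos: "0 < vfac x v a" by (simp add: vfac_def)

lemma loc_pos: "0 < loc v \<sigma>"
  using prod_efactor_ge_1[of v \<sigma> "\<sigma> v" "ancestors v"] vfac_pos by (simp add: loc_def)

lemma tsum_pos: "0 < tsum h v \<sigma>"
proof (induction h arbitrary: v \<sigma>)
  case 0
  have "loc v (\<sigma>(v := 0)) \<le> tsum 0 v \<sigma>"
    unfolding tsum_simps by (rule member_le_sum) auto
  then show ?case using loc_pos[of v "\<sigma>(v := 0)"] by simp
next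
  case (Suc h)
  have "loc v (\<sigma>(v := 0)) * (\<Prod>c\<in>children v. tsum h c (\<sigma>(v := 0))) \<le> tsum (Suc h) v \<sigma>"
    unfolding tsum_simps
    by (rule member_le_sum[of 0 _ "\<lambda>a. loc v (\<sigma>(v := a)) * (\<Prod>c\<in>children v. tsum h c (\<sigma>(v := a)))"]) auto
  moreover have "0 < loc v (\<sigma>(v := 0)) * (\<Prod>c\<in>children v. tsum h c (\<sigma>(v := 0)))"
    using loc_pos Suc.IH by (auto intro!: prod_pos)
  ultimately show ?case by linarith
qed

text \<open>The value of a child when \<open>h\<close> levels remain below its parent. The default 1
  at \<open>h = 0\<close> only occurs in an empty product, as vertices on level \<open>H\<close>
  have no children.\<close>

definition sub :: "nat \<Rightarrow> nat \<Rightarrow> (nat \<Rightarrow> nat) \<Rightarrow> nat" where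
  "sub h c \<sigma> = (case h of 0 \<Rightarrow> 1 | Suc h' \<Rightarrow> tsum h' c \<sigma>)"

lemma children_empty: "v \<le> n \<Longrightarrow> lvl v = H \<Longrightarrow> children v = {}"
  using children_lvl lvl_le by (fastforce simp: children_def)

lemma tsum_unfold:
  "v \<le> n \<Longrightarrow> lvl v + h = H \<Longrightarrow> tsum h v \<sigma> = (\<Sum>a<5. loc v (\<sigma>(v := a)) * (\<Prod>c\<in>children v. sub h c (\<sigma>(v := a))))"
  by (cases h) (auto simp: sub_def children_empty tsum_simps)

lemma sub_pos: "0 < sub h c \<sigma>" using tsum_pos by (simp add: sub_def split: nat.split)

definition branch :: "nat \<Rightarrow> nat \<Rightarrow> (nat \<Rightarrow> nat) \<Rightarrow> nat \<Rightarrow> nat" where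
  "branch h v \<sigma> t = loc v (\<sigma>(v := t)) * (\<Prod>c\<in>children v. sub h c (\<sigma>(v := t)))"

lemma sub_cong:
  "c \<in> children v \<Longrightarrow> (\<And>u. u \<in> set (v # ancestors v) \<Longrightarrow> \<tau> u = \<sigma> u) \<Longrightarrow> sub h c \<tau> = sub h c \<sigma>"
  unfolding sub_def by (cases h) (auto simp: children_def ancestors_Suc intro!: tsum_cong)

lemma branch_cong:
  assumes "\<And>u. u \<in> set (ancestors v) \<Longrightarrow> \<tau> u = \<sigma> u"
  shows "branch h v \<tau> t = branch h v \<sigma> t"
proof -
  have "loc v (\<tau>(v := t)) = loc v (\<sigma>(v := t))" by (rule loc_cong) (use assms in auto)
  moreover have "sub h c (\<tau>(v := t)) = sub h c (\<sigma>(v := t))" if "c \<in> children v" for c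
    by (rule sub_cong[OF that]) (use assms in auto)
  ultimately show ?thesis by (simp add: branch_def)
qed

text \<open>\<open>CT\<close> pays for one state of a vertex apart from its children: the scan of
  all candidates at 20 steps each and the evaluation of the next state. \<open>TE\<close> pays for
  entering a vertex, including the evaluation of state 0.\<close>

definition CT :: nat where "CT = TL + N * 20 + 60"
definition TE :: nat where "TE = TL + 20"

primrec vtime :: "nat \<Rightarrow> nat \<Rightarrow> nat" where
  "vtime 0 v = 5 * CT"
| "vtime (Suc h) v = 5 * (CT + (\<Sum>c\<in>children v. TE + vtime h c))"

definition subtime :: "nat \<Rightarrow> nat \<Rightarrow> nat" where
  "subtime h c = (case h of 0 \<Rightarrow> 0 | Suc h' \<Rightarrow> TE + vtime h' c)"

lemma vtime_unfold: "v \<le> n \<Longrightarrow> lvl v + h = H \<Longrightarrow> vtime h v = 5 * (CT + (\<Sum>c\<in>children v. subtime h c))"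
  by (cases h) (auto simp: subtime_def children_empty)

definition exits :: "nat \<Rightarrow> nat \<Rightarrow> (nat \<Rightarrow> nat) \<Rightarrow> (nat \<Rightarrow> nat) \<Rightarrow> (nat \<Rightarrow> nat) \<Rightarrow> bool" where
  "exits v y m f' m' \<longleftrightarrow> cregs f' \<and> frame (lvl v) m m' \<and> f' 22 = y \<and>
     (if v = 0 then f' 25 = 0 else f' 25 = 1 \<and> f' 23 = par v \<and> f' 24 = v + 1)"

text \<open>In continuation-passing style: \<open>Q\<close> holds at the end if it does when the search goes on from an exit of \<open>v\<close>.\<close>

definition vertex_ok :: "nat \<Rightarrow> bool" where
  "vertex_ok h \<longleftrightarrow> (\<forall>v f m T2 Q. v \<le> n \<longrightarrow> lvl v + h = H \<longrightarrow> live f m \<longrightarrow> f 23 = v \<longrightarrow>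
     (\<forall>u\<in>set (ancestors v). m (bst + u) < 5) \<longrightarrow> f 22 * tsum h v (\<lambda>u. m (bst + u)) < B \<longrightarrow>
     (\<forall>f' m'. exits v (f 22 * tsum h v (\<lambda>u. m (bst + u))) m f' m' \<longrightarrow> ok A B traverse (f', m') T2 Q) \<longrightarrow>
     ok A B enter (f, m) TE (\<lambda>s. ok A B traverse s (vtime h v + T2) Q))"

lemma traverse_stepI:
  "f 25 = 1 \<Longrightarrow> ok A B traverse_body (f, m) T1 (\<lambda>s. ok A B traverse s T2 Q) \<Longrightarrow> T1 + T2 + 2 \<le> T \<Longrightarrow>
    ok A B traverse (f, m) T Q"
  unfolding traverse_def by (rule ok_le[OF ok_While_step]) auto

lemma N_less_B: "i \<le> N \<Longrightarrow> i < B"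
  using \<beta> \<beta>_le_D by (intro D_less_B) simp

text \<open>Each child gets the product of the values of its predecessors as incoming product, so
  after the last candidate register 22 holds \<open>y\<close> times the product over all
  children.\<close>

lemma ok_scan:
  assumes V: "\<And>h'. h = Suc h' \<Longrightarrow> vertex_ok h'"
    and v: "v \<le> n" "lvl v + h = H"
  shows "1 \<le> c \<Longrightarrow> c \<le> N \<Longrightarrow> live f m \<Longrightarrow> f 23 = v \<Longrightarrow> f 24 = c \<Longrightarrow> f 22 = y \<Longrightarrow>
     (\<And>u. u \<in> set (v # ancestors v) \<Longrightarrow> m (bst + u) < 5) \<Longrightarrow>
     y * (\<Prod>c'\<in>children v \<inter> {c..}. sub h c' (\<lambda>u. m (bst + u))) < B \<Longrightarrow>
     (\<And>f' m'. live f' m' \<Longrightarrow> f' 23 = v \<Longrightarrow> f' 24 = N \<Longrightarrow> frame (Suc (lvl v)) m m' \<Longrightarrow>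
        f' 22 = y * (\<Prod>c'\<in>children v \<inter> {c..}. sub h c' (\<lambda>u. m (bst + u))) \<Longrightarrow> ok A B traverse (f', m') T2 Q) \<Longrightarrow>
     ok A B traverse (f, m) ((N - c) * 20 + (\<Sum>c'\<in>children v \<inter> {c..}. subtime h c') + T2) Q"
proof (induction "N - c" arbitrary: c f m y)
  case 0
  then have "children v \<inter> {c..} = {}" by (auto simp: children_def N_def)
  then have "ok A B traverse (f, m) T2 Q"
    using 0 by (intro "0.prems"(9)) (auto simp: frame_refl)
  then show ?case by (rule ok_le) simp
next
  case (Suc d)
  let ?\<sigma> = "\<lambda>u. m (bst + u)"
  let ?C = "children v \<inter> {c..}" and ?C' = "children v \<inter> {Suc c..}"
  have c: "1 \<le> c" "c \<le> n" "c < N" using Suc by (auto simp: N_def)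
  have regs: "f 6 = N" "f 25 = 1" using Suc.prems(3) by (simp_all add: live_def cregs_def)
  have load: "m (c - 1) = par c" using Suc.prems(3) pc[OF c(1,2)] c by (simp add: live_def cmem_def)
  have d: "d = N - Suc c" using Suc(2) by simp
  show ?case
  proof (cases "par c = v")
    case False
    then have C: "?C = ?C'" by (auto simp: children_def Suc_le_eq le_less)
    have "ok A B traverse (f(24 := Suc c), m) ((N - Suc c) * 20 + (\<Sum>c'\<in>?C'. subtime h c') + T2) Q"
      by (rule Suc.hyps(1)[OF d, of _ _ y]) (use Suc.prems c C in \<open>auto simp: live_def cregs_def\<close>)
    then have "ok A B (code (Set 24 (Add (Reg 24) (Const 1)))) (f, m) 1 (\<lambda>s. ok A B traverse s ((N - Suc c) * 20 + (\<Sum>c'\<in>?C'. subtime h c') + T2) Q)"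
      by (intro ok_code_le[where D = D]) (use Suc.prems(5) c N_less_B in auto)
    then have "ok A B traverse_body (f, m) (max (max 1 1 + 1) 1 + 1) (\<lambda>s. ok A B traverse s ((N - Suc c) * 20 + (\<Sum>c'\<in>?C'. subtime h c') + T2) Q)"
      unfolding traverse_body_def
      by (intro ok_Cond) (use regs Suc.prems(4,5) c load False in auto)
    then show ?thesis
      by (rule traverse_stepI[of f, OF regs(2)]) (use c C in \<open>simp add: Suc_diff_Suc[symmetric] C\<close>)
  next
    case True
    then have cv: "c \<in> children v" using c by (simp add: children_def)
    then have C: "?C = insert c ?C'" by auto
    have lc: "lvl c = Suc (lvl v)" using children_lvl[OF cv] .
    then obtain h' where h: "h = Suc h'" using v(2) lvl_le[OF c(2)] by (cases h) auto
    have anc: "ancestors c = v # ancestors v" using ancestors_Suc[OF c(1,2)] True by simp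
    have sub: "sub h c \<tau> = tsum h' c \<tau>" for \<tau> by (simp add: sub_def h)
    have st: "subtime h c = TE + vtime h' c" by (simp add: subtime_def h)
    have prod: "(\<Prod>c'\<in>?C. sub h c' ?\<sigma>) = sub h c ?\<sigma> * (\<Prod>c'\<in>?C'. sub h c' ?\<sigma>)"
      unfolding C by (subst prod.insert) auto
    let ?y = "y * sub h c ?\<sigma>"
    have bnd: "?y * (\<Prod>c'\<in>?C'. sub h c' ?\<sigma>) < B" using Suc.prems(8) unfolding prod by (simp add: mult.assoc)
    have "?y * 1 \<le> ?y * (\<Prod>c'\<in>?C'. sub h c' ?\<sigma>)"
      using prod_pos[of ?C' "\<lambda>c'. sub h c' ?\<sigma>"] sub_pos by (intro mult_le_mono2) (simp add: Suc_le_eq)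
    also note bnd
    finally have yB: "?y < B" by simp
    let ?T = "(N - Suc c) * 20 + (\<Sum>c'\<in>?C'. subtime h c') + T2"
    have "ok A B enter (f(23 := c), m) TE (\<lambda>s. ok A B traverse s (vtime h' c + ?T) Q)"
    proof (rule V[OF h, unfolded vertex_ok_def, rule_format])
      show "live (f(23 := c)) m" using Suc.prems(3) by (simp add: live_def cregs_def)
      show "m (bst + u) < 5" if "u \<in> set (ancestors c)" for u using that Suc.prems(7) anc by simp
      show "(f(23 := c)) 22 * tsum h' c ?\<sigma> < B" using yB Suc.prems(6) sub by simp
      fix f' m' assume "exits c ((f(23 := c)) 22 * tsum h' c ?\<sigma>) m f' m'"
      then have f': "cregs f'" "frame (Suc (lvl v)) m m'" "f' 22 = ?y" "f' 25 = 1" "f' 23 = v" "f' 24 = Suc c"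
        using c True Suc.prems(6) lc sub by (auto simp: exits_def)
      have agree: "m' (bst + u) = m (bst + u)" if "u \<in> set (v # ancestors v)" for u
        using frame_cells(1)[OF f'(2), of u] that ancestors_lvl[OF v(1), of u] v(1) by auto
      \<comment> \<open>The visit of \<open>c\<close> changed deeper levels only, so the remaining
        children still have the values they had at the start of the scan.\<close>
      have subs: "(\<Prod>c'\<in>?C'. sub h c' (\<lambda>u. m' (bst + u))) = (\<Prod>c'\<in>?C'. sub h c' ?\<sigma>)"
        using agree by (intro prod.cong refl sub_cong) auto
      show "ok A B traverse (f', m') ?T Q"
      proof (rule Suc.hyps(1)[OF d, of _ _ ?y])
        show "live f' m'" using f' cmem_frame[OF _ f'(2)] Suc.prems(3) by (simp add: live_def)
        show "m' (bst + u) < 5" if "u \<in> set (v # ancestors v)" for u using agree[OF that] Suc.prems(7)[OF that] by simp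
        show "?y * (\<Prod>c'\<in>?C'. sub h c' (\<lambda>u. m' (bst + u))) < B" using bnd subs by simp
        fix f'' m'' assume g: "live f'' m''" "f'' 23 = v" "f'' 24 = N" "frame (Suc (lvl v)) m' m''"
          "f'' 22 = ?y * (\<Prod>c'\<in>?C'. sub h c' (\<lambda>u. m' (bst + u)))"
        show "ok A B traverse (f'', m'') T2 Q"
          by (rule Suc.prems(9)) (use g frame_trans[OF f'(2) g(4)] subs prod in \<open>auto simp: mult.assoc\<close>)
      qed (use f' c in auto)
    qed (use c lc v h in auto)
    then have "ok A B (Seq (code (Set 23 (Reg 24))) enter) (f, m) (1 + TE + 1) (\<lambda>s. ok A B traverse s (vtime h' c + ?T) Q)"
      by (intro ok_code_Seq[where D = D]) (use Suc.prems(5) c N_less_B in auto)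
    then have "ok A B traverse_body (f, m) (max (max 1 (1 + TE + 1) + 1) 1 + 1) (\<lambda>s. ok A B traverse s (vtime h' c + ?T) Q)"
      unfolding traverse_body_def
      by (intro ok_Cond) (use regs Suc.prems(4,5) c load True in auto)
    then show ?thesis
      by (rule traverse_stepI[of f, OF regs(2)]) (use c in \<open>simp add: C st Suc_diff_Suc[symmetric]\<close>)
  qed
qed

end

context machine
begin

text \<open>The states are treated in increasing order, and \<open>S\<close> is the contribution of
  those already done. The hypothesis bounds the final sum; all intermediate values are at most that,
  because every contribution is nonnegative and every factor positive.\<close>

lemma ok_states:
  assumes V: "\<And>h'. h = Suc h' \<Longrightarrow> vertex_ok h'"
    and v: "v \<le> n" "lvl v + h = H"
  shows "a \<le> 4 \<Longrightarrow> live f m \<Longrightarrow> f 23 = v \<Longrightarrow> f 24 = 1 \<Longrightarrow> m (bst + v) = a \<Longrightarrow> m (bA + v) = y \<Longrightarrow> m (bS + v) = S \<Longrightarrow>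
     f 22 = y * loc v (\<lambda>u. m (bst + u)) \<Longrightarrow> (\<And>u. u \<in> set (ancestors v) \<Longrightarrow> m (bst + u) < 5) \<Longrightarrow>
     S + y * (\<Sum>t\<in>{a..<5}. branch h v (\<lambda>u. m (bst + u)) t) < B \<Longrightarrow>
     (\<And>f' m'. exits v (S + y * (\<Sum>t\<in>{a..<5}. branch h v (\<lambda>u. m (bst + u)) t)) m f' m' \<Longrightarrow> ok A B traverse (f', m') T2 Q) \<Longrightarrow>
     ok A B traverse (f, m) ((5 - a) * (CT + (\<Sum>c\<in>children v. subtime h c)) + T2) Q"
proof (induction "4 - a" arbitrary: a f m S rule: less_induct)
  case less
  note prems = less.prems
  let ?\<sigma> = "\<lambda>u. m (bst + u)"
  let ?ch = "\<Sum>c\<in>children v. subtime h c"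
  have ch: "children v \<inter> {1..} = children v" by (auto simp: children_def)
  let ?z = "y * branch h v ?\<sigma> a"
  have br: "branch h v ?\<sigma> a = loc v ?\<sigma> * (\<Prod>c\<in>children v. sub h c ?\<sigma>)"
    using prems(5) by (simp add: branch_def fun_upd_idem)
  have split: "{a..<5} = insert a {Suc a..<5}" using prems(1) by auto
  have sum: "S + y * (\<Sum>t\<in>{a..<5}. branch h v ?\<sigma> t) = (S + ?z) + y * (\<Sum>t\<in>{Suc a..<5}. branch h v ?\<sigma> t)"
    unfolding split by (simp add: distrib_left)
  have SzB: "S + ?z < B" using prems(10) unfolding sum by linarith
  have z: "y * loc v ?\<sigma> * (\<Prod>c\<in>children v \<inter> {1..}. sub h c ?\<sigma>) = ?z" unfolding ch br by (simp add: mult.assoc)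
  let ?T = "(5 - Suc a) * (CT + ?ch) + T2"
  have bases: "bst + v < A" "bS + v < A" "bst + v < B" "bS + v < B"
  proof -
    show 1: "bst + v < A" "bS + v < A" using v(1) by (simp_all add: A_def bS_def bA_def N_def)
    show "bst + v < B" "bS + v < B" using 1 AD by (auto intro!: D_less_B)
  qed
  have "ok A B traverse (f, m) ((N - 1) * 20 + (\<Sum>c'\<in>children v \<inter> {1..}. subtime h c') + (TL + 40 + ?T)) Q"
  proof (rule ok_scan[OF V v, of _ _ _ "y * loc v ?\<sigma>"])
    show "y * loc v ?\<sigma> * (\<Prod>c'\<in>children v \<inter> {1..}. sub h c' ?\<sigma>) < B" unfolding z using SzB by simp
    show "m (bst + u) < 5" if "u \<in> set (v # ancestors v)" for u using that prems(1,5,9) by auto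
    fix f1 m1 assume f1: "live f1 m1" "f1 23 = v" "f1 24 = N" "frame (Suc (lvl v)) m m1"
      "f1 22 = y * loc v ?\<sigma> * (\<Prod>c'\<in>children v \<inter> {1..}. sub h c' ?\<sigma>)"
    have z1: "f1 22 = ?z" using f1(5) z by simp
    have regs: "f1 6 = N" "f1 25 = 1" "f1 19 = bst" "f1 21 = bS" "cregs f1" "cmem m1"
      using f1(1) by (simp_all add: live_def cregs_def)
    have m1: "m1 (bst + u) = m (bst + u)" if "u \<in> set (v # ancestors v)" for u
      using frame_cells(1)[OF f1(4), of u] that ancestors_lvl[OF v(1), of u] v(1) by auto
    have m1v: "m1 (bA + v) = y" "m1 (bS + v) = S" "m1 (bst + v) = a"
      using frame_cells[OF f1(4) v(1)] prems(5-7) by auto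
    define m2 where "m2 = m1(bS + v := S + ?z)"
    have ne: "bst + u \<noteq> bS + v" "bA + v \<noteq> bS + v" "bst + u \<noteq> bA + v" if "u \<le> n" for u
      using that by (auto simp: bS_def bA_def N_def)
    have fr2: "frame (lvl v) m m2"
      unfolding m2_def by (rule frame_upd[OF frame_mono[OF f1(4)] v(1)]) auto
    have tail: "ok A B (Cond (Sub (Const 4) (Load (Add (Reg 19) (Reg 23))))
        (Seq (code (Put (Add (Reg 19) (Reg 23)) (Add (Load (Add (Reg 19) (Reg 23))) (Const 1)))) local_step)
        (code (Set 22 (Load (Add (Reg 21) (Reg 23))) ;;
          If (Reg 23) (Set 24 (Add (Reg 23) (Const 1)) ;; Set 23 (Load (Sub (Reg 23) (Const 1)))) (Set 25 (Const 0)))))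
        (f1, m2) (max (1 + TL + 1) 10 + 1) (\<lambda>s. ok A B traverse s ?T Q)"
    proof (rule ok_Cond)
      assume "aval (Sub (Const 4) (Load (Add (Reg 19) (Reg 23)))) (f1, m2) \<noteq> 0"
      then have a4: "a < 4" using regs f1(2) m1v ne[OF v(1)] by (simp add: m2_def)
      define m3 where "m3 = m2(bst + v := Suc a)"
      have fr3: "frame (lvl v) m m3"
        unfolding m3_def by (rule frame_upd[OF fr2 v(1)]) auto
      have m3v: "m3 (bst + v) = Suc a" "m3 (bA + v) = y" "m3 (bS + v) = S + ?z"
        using m1v ne[OF v(1)] by (auto simp: m3_def m2_def)
      have m3u: "m3 (bst + u) = m (bst + u)" if "u \<in> set (ancestors v)" for u
        using frame_cells(1)[OF fr3, of u] that ancestors_lvl[OF v(1), of u] by auto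
      have brs: "branch h v (\<lambda>u. m3 (bst + u)) t = branch h v ?\<sigma> t" for t
        using m3u by (rule branch_cong)
      have brB: "y * branch h v ?\<sigma> (Suc a) < B"
      proof -
        have "branch h v ?\<sigma> (Suc a) \<le> (\<Sum>t\<in>{Suc a..<5}. branch h v ?\<sigma> t)"
          using a4 by (intro member_le_sum) auto
        then have "y * branch h v ?\<sigma> (Suc a) \<le> y * (\<Sum>t\<in>{Suc a..<5}. branch h v ?\<sigma> t)" by (rule mult_le_mono2)
        then show ?thesis using prems(10) unfolding sum by linarith
      qed
      have br3: "branch h v ?\<sigma> (Suc a) = loc v (\<lambda>u. m3 (bst + u)) * (\<Prod>c\<in>children v. sub h c (\<lambda>u. m3 (bst + u)))"
        unfolding brs[symmetric] using m3v(1) by (simp add: branch_def fun_upd_idem)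
      have locB: "y * loc v (\<lambda>u. m3 (bst + u)) < B"
      proof -
        have "y * loc v (\<lambda>u. m3 (bst + u)) * 1 \<le> y * loc v (\<lambda>u. m3 (bst + u)) * (\<Prod>c\<in>children v. sub h c (\<lambda>u. m3 (bst + u)))"
          using prod_pos[of "children v" "\<lambda>c. sub h c (\<lambda>u. m3 (bst + u))"] sub_pos by (intro mult_le_mono2) (simp add: Suc_le_eq)
        also have "\<dots> = y * branch h v ?\<sigma> (Suc a)" unfolding br3 by (simp add: mult.assoc)
        also note brB
        finally show ?thesis by simp
      qed
      have "ok A B local_step (f1, m3) TL (\<lambda>s. ok A B traverse s ?T Q)"
      proof (rule ok_local_step[OF regs(5) cmem_frame[OF _ fr3] f1(2) v(1) m3v(2) _ locB])
        show "cmem m" using prems(2) by (simp add: live_def)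
        show "m3 (bst + u) < 5" if "u \<in> set (v # ancestors v)" for u
          using that m3u m3v(1) a4 prems(9) by auto
        fix f4 assume f4: "f4 22 = y * loc v (\<lambda>u. m3 (bst + u))" "f4 24 = 1" "\<And>r. r < 22 \<or> r \<in> {23, 25} \<Longrightarrow> f4 r = f1 r"
        show "ok A B traverse (f4, m3) ?T Q"
        proof (rule less.hyps[of "Suc a" _ _ "S + ?z"])
          show "live f4 m3" using f4(3) f1(1) cmem_frame[OF _ fr3] prems(2) by (simp add: live_def cregs_def)
          show "S + ?z + y * (\<Sum>t\<in>{Suc a..<5}. branch h v (\<lambda>u. m3 (bst + u)) t) < B"
            using prems(10) unfolding sum brs .
          fix f' m' assume e: "exits v (S + ?z + y * (\<Sum>t\<in>{Suc a..<5}. branch h v (\<lambda>u. m3 (bst + u)) t)) m3 f' m'"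
          show "ok A B traverse (f', m') T2 Q"
          proof (rule prems(11))
            show "exits v (S + y * (\<Sum>t\<in>{a..<5}. branch h v ?\<sigma> t)) m f' m'"
              using e frame_trans[OF fr3] unfolding sum brs exits_def by auto
          qed
        qed (use a4 f4 f1(2) m3v m3u prems(9) in auto)
      qed
      then show "ok A B (Seq (code (Put (Add (Reg 19) (Reg 23)) (Add (Load (Add (Reg 19) (Reg 23))) (Const 1)))) local_step)
          (f1, m2) (1 + TL + 1) (\<lambda>s. ok A B traverse s ?T Q)"
        by (intro ok_code_Seq[where D = D])
          (use regs f1(2) bases m1v ne[OF v(1)] a4 m3_def R4 R_le_D D_less_B[of "Suc a"] in \<open>auto simp: m2_def add.commute\<close>)
    next
      assume "aval (Sub (Const 4) (Load (Add (Reg 19) (Reg 23)))) (f1, m2) = 0"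
      then have a4: "a = 4" using regs f1(2) m1v ne[OF v(1)] prems(1) by (simp add: m2_def)
      have leave: "ok A B traverse (f', m2) ?T Q"
        if "exits v (S + y * (\<Sum>t\<in>{a..<5}. branch h v ?\<sigma> t)) m f' m2" for f'
        using prems(11)[OF that] a4 by (simp add: eval_nat_numeral)
      have total: "S + y * (\<Sum>t\<in>{a..<5}. branch h v ?\<sigma> t) = S + ?z"
        unfolding sum using a4 by simp
      have load: "m2 (bS + v) = S + ?z" by (simp add: m2_def)
      have lp: "m2 (v - 1) = par v" if "v \<noteq> 0"
        using that cmem_frame[OF _ fr2] prems(2) pc[of v] v(1) by (auto simp: live_def cmem_def)
      have B0: "0 < B" "Suc v < B" "v \<noteq> 0 \<Longrightarrow> par v < B"
        using N_less_B[of 0] N_less_B[of "Suc v"] N_less_B[of "par v"] v(1) par_le[of v] by (auto simp: N_def)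
      show "ok A B (code (Set 22 (Load (Add (Reg 21) (Reg 23))) ;;
          If (Reg 23) (Set 24 (Add (Reg 23) (Const 1)) ;; Set 23 (Load (Sub (Reg 23) (Const 1)))) (Set 25 (Const 0))))
          (f1, m2) 10 (\<lambda>s. ok A B traverse s ?T Q)"
      proof (rule ok_code_le[where D = D])
        show "wp A B D (Set 22 (Load (Add (Reg 21) (Reg 23))) ;;
          If (Reg 23) (Set 24 (Add (Reg 23) (Const 1)) ;; Set 23 (Load (Sub (Reg 23) (Const 1)))) (Set 25 (Const 0)))
          (\<lambda>s. ok A B traverse s ?T Q) (f1, m2)"
        proof (cases "v = 0")
          case True
          have "ok A B traverse (f1(22 := S + ?z, 25 := 0), m2) ?T Q"
            by (rule leave) (use True regs(5) fr2 total in \<open>auto simp: exits_def cregs_def\<close>)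
          then show ?thesis using True regs f1(2) load SzB B0 by simp
        next
          case False
          have "ok A B traverse (f1(22 := S + ?z, 24 := Suc v, 23 := par v), m2) ?T Q"
            by (rule leave) (use False regs fr2 total in \<open>auto simp: exits_def cregs_def\<close>)
          then show ?thesis using False regs f1(2) load lp SzB B0 by simp
        qed
      qed simp
    qed
    have body: "ok A B finish_state (f1, m1) (1 + (max (1 + TL + 1) 10 + 1) + 1) (\<lambda>s. ok A B traverse s ?T Q)"
      unfolding finish_state_def
      by (intro ok_code_Seq[where D = D]) (use tail regs f1(2) m1v z1 bases SzB in \<open>auto simp: m2_def\<close>)
    have "ok A B traverse_body (f1, m1) (max 1 (1 + (max (1 + TL + 1) 10 + 1) + 1) + 1) (\<lambda>s. ok A B traverse s ?T Q)"
      unfolding traverse_body_def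
      by (rule ok_Cond) (use body regs f1(3) in auto)
    then show "ok A B traverse (f1, m1) (TL + 40 + ?T) Q"
      by (rule traverse_stepI[of f1, OF regs(2)]) simp
  qed (use prems N_def in auto)
  then show ?case
  proof (rule ok_le)
    have "5 - a = Suc (5 - Suc a)" using prems(1) by simp
    then show "(N - 1) * 20 + (\<Sum>c'\<in>children v \<inter> {1..}. subtime h c') + (TL + 40 + ?T) \<le> (5 - a) * (CT + ?ch) + T2"
    proof -
      assume eq: "5 - a = Suc (5 - Suc a)"
      have "(N - 1) * 20 + TL + 40 \<le> CT" by (simp add: CT_def)
      then show ?thesis unfolding ch eq mult_Suc by linarith
    qed
  qed
qed

lemma vertex_ok_step:
  assumes V: "\<And>h'. h = Suc h' \<Longrightarrow> vertex_ok h'"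
  shows "vertex_ok h"
  unfolding vertex_ok_def
proof (intro allI impI)
  fix v f m T2 Q
  assume v: "v \<le> n" "lvl v + h = H" and f: "live f m" "f 23 = v"
    and st: "\<forall>u\<in>set (ancestors v). m (bst + u) < 5"
    and B: "f 22 * tsum h v (\<lambda>u. m (bst + u)) < B"
    and Q: "\<forall>f' m'. exits v (f 22 * tsum h v (\<lambda>u. m (bst + u))) m f' m' \<longrightarrow> ok A B traverse (f', m') T2 Q"
  let ?\<sigma> = "\<lambda>u. m (bst + u)" and ?y = "f 22"
  let ?m = "m(bA + v := ?y, bS + v := 0, bst + v := 0)"
  have regs: "f 19 = bst" "f 20 = bA" "f 21 = bS" "cregs f" "cmem m" using f by (simp_all add: live_def cregs_def)
  have bases: "bst + v < A" "bA + v < A" "bS + v < A" using v(1) by (simp_all add: A_def bS_def bA_def N_def)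
  have fr: "frame (lvl v) m ?m" by (intro frame_upd[OF _ v(1)] frame_refl) auto
  have ne: "bst + u \<noteq> bS + v" "bA + v \<noteq> bS + v" "bst + u \<noteq> bA + v" if "u \<le> n" for u
    using that by (auto simp: bS_def bA_def N_def)
  have mu: "?m (bst + u) = m (bst + u)" if "u \<in> set (ancestors v)" for u
    using frame_cells(1)[OF fr, of u] that ancestors_lvl[OF v(1), of u] by auto
  have brs: "branch h v (\<lambda>u. ?m (bst + u)) t = branch h v ?\<sigma> t" for t using mu by (rule branch_cong)
  have tot: "0 + ?y * (\<Sum>t\<in>{0..<5}. branch h v (\<lambda>u. ?m (bst + u)) t) = ?y * tsum h v ?\<sigma>"
  proof -
    have "(\<Sum>t\<in>{0..<5}. branch h v (\<lambda>u. ?m (bst + u)) t) = (\<Sum>t\<in>{0..<5}. branch h v ?\<sigma> t)"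
      by (rule sum.cong[OF refl brs])
    also have "\<dots> = tsum h v ?\<sigma>"
      by (simp only: tsum_unfold[OF v] branch_def atLeast0LessThan)
    finally show ?thesis by simp
  qed
  have locB: "?y * loc v (\<lambda>u. ?m (bst + u)) < B"
  proof -
    have br0: "branch h v (\<lambda>u. ?m (bst + u)) 0 = loc v (\<lambda>u. ?m (bst + u)) * (\<Prod>c\<in>children v. sub h c (\<lambda>u. ?m (bst + u)))"
    proof -
      have "(\<lambda>u. ?m (bst + u))(v := 0) = (\<lambda>u. ?m (bst + u))" by (simp add: fun_upd_idem)
      then show ?thesis by (simp only: branch_def)
    qed
    have "?y * loc v (\<lambda>u. ?m (bst + u)) * 1 \<le> ?y * loc v (\<lambda>u. ?m (bst + u)) * (\<Prod>c\<in>children v. sub h c (\<lambda>u. ?m (bst + u)))"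
      using prod_pos[of "children v" "\<lambda>c. sub h c (\<lambda>u. ?m (bst + u))"] sub_pos by (intro mult_le_mono2) (simp add: Suc_le_eq)
    also have "\<dots> = ?y * branch h v (\<lambda>u. ?m (bst + u)) 0" unfolding br0 by (simp add: mult.assoc)
    also have "\<dots> \<le> ?y * (\<Sum>t\<in>{0..<5}. branch h v (\<lambda>u. ?m (bst + u)) t)"
      by (intro mult_le_mono2 member_le_sum) auto
    also have "\<dots> = ?y * tsum h v ?\<sigma>" using tot by simp
    also note B
    finally show ?thesis by simp
  qed
  have "ok A B local_step (f, ?m) TL (\<lambda>s. ok A B traverse s (vtime h v + T2) Q)"
  proof (rule ok_local_step[OF regs(4) cmem_frame[OF regs(5) fr] f(2) v(1) _ _ locB])
    show "?m (bA + v) = ?y" using ne[OF v(1)] by auto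
    show "?m (bst + u) < 5" if "u \<in> set (v # ancestors v)" for u
    proof (cases "u = v")
      case False
      then have "u \<in> set (ancestors v)" using that by simp
      then show ?thesis unfolding mu[OF \<open>u \<in> set (ancestors v)\<close>] using st by blast
    qed simp
    fix f4 assume f4: "f4 22 = ?y * loc v (\<lambda>u. ?m (bst + u))" "f4 24 = 1" "\<And>r. r < 22 \<or> r \<in> {23, 25} \<Longrightarrow> f4 r = f r"
    have "ok A B traverse (f4, ?m) ((5 - 0) * (CT + (\<Sum>c\<in>children v. subtime h c)) + T2) Q"
    proof (rule ok_states[OF V v, of _ _ _ ?y 0])
      show "live f4 ?m" using f4(3) f(1) cmem_frame[OF regs(5) fr] by (simp add: live_def cregs_def)
      show "?m (bA + v) = ?y" "?m (bS + v) = 0" using ne[OF v(1)] by auto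
      show "?m (bst + u) < 5" if "u \<in> set (ancestors v)" for u unfolding mu[OF that] using that st by blast
      show "0 + ?y * (\<Sum>t\<in>{0..<5}. branch h v (\<lambda>u. ?m (bst + u)) t) < B" unfolding tot by (rule B)
      fix f' m' assume e: "exits v (0 + ?y * (\<Sum>t\<in>{0..<5}. branch h v (\<lambda>u. ?m (bst + u)) t)) ?m f' m'"
      have "exits v (?y * tsum h v ?\<sigma>) m f' m'"
        using e frame_trans[OF fr] unfolding tot exits_def by auto
      then show "ok A B traverse (f', m') T2 Q" using Q by blast
    qed (use f4 f(2) in auto)
    then show "ok A B traverse (f4, ?m) (vtime h v + T2) Q" unfolding vtime_unfold[OF v] by simp
  qed
  note loc = this
  show "ok A B enter (f, m) TE (\<lambda>s. ok A B traverse s (vtime h v + T2) Q)"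
  proof (rule ok_fits)
    assume fit: "fits A B (f, m)"
    show "ok A B enter (f, m) TE (\<lambda>s. ok A B traverse s (vtime h v + T2) Q)"
      unfolding enter_def
    proof (rule ok_code_Seq[where D = D])
      show "wp A B D (Put (Add (Reg 20) (Reg 23)) (Reg 22) ;; Put (Add (Reg 21) (Reg 23)) (Const 0) ;;
     Put (Add (Reg 19) (Reg 23)) (Const 0)) (\<lambda>s. ok A B local_step s TL (\<lambda>s. ok A B traverse s (vtime h v + T2) Q)) (f, m)"
        using loc regs f(2) bases fits_D(1)[OF fit, of 22] N_less_B[of 0] by simp
    qed (simp add: TE_def)
  qed
qed

lemma vertex_ok: "vertex_ok h"
  by (induction h) (rule vertex_ok_step; simp)+

text \<open>Costs are summed over a whole level, so that the children of one level fall into the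
  next one without repetition. A vertex on level \<open>j\<close> is entered \<open>5 ^ j\<close>
  times and has five states at each visit; over all vertices this gives \<open>5 ^ (h + 1)\<close>
  times their number instead of a product of branching degrees.\<close>

lemma vtime_sum:
  "l + h = H \<Longrightarrow> (\<Sum>v | v \<le> n \<and> lvl v = l. TE + vtime h v) \<le> (CT + TE) * 5 ^ (h + 1) * card {v. v \<le> n \<and> l \<le> lvl v}"
proof (induction h arbitrary: l)
  case 0
  have "(\<Sum>v | v \<le> n \<and> lvl v = l. TE + vtime 0 v) \<le> (CT + TE) * 5 * card {v. v \<le> n \<and> lvl v = l}"
    by (simp add: algebra_simps)
  also have "\<dots> \<le> (CT + TE) * 5 * card {v. v \<le> n \<and> l \<le> lvl v}"
    by (intro mult_le_mono2 card_mono) auto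
  finally show ?case by simp
next
  case (Suc h)
  let ?L = "{v. v \<le> n \<and> lvl v = l}" and ?L' = "{v. v \<le> n \<and> lvl v = Suc l}" and ?U = "{v. v \<le> n \<and> Suc l \<le> lvl v}"
  have "(\<Sum>v\<in>?L. \<Sum>c\<in>children v. TE + vtime h c) = (\<Sum>c\<in>(\<Union>v\<in>?L. children v). TE + vtime h c)"
    by (subst sum.UNION_disjoint) (auto simp: children_def)
  also have "(\<Union>v\<in>?L. children v) \<subseteq> ?L'" using children_lvl by (auto simp: children_def lvl_Suc)
  then have "(\<Sum>c\<in>(\<Union>v\<in>?L. children v). TE + vtime h c) \<le> (\<Sum>c\<in>?L'. TE + vtime h c)"
    by (intro sum_mono2) auto
  also have "\<dots> \<le> (CT + TE) * 5 ^ (h + 1) * card ?U" using Suc by simp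
  finally have ch: "(\<Sum>v\<in>?L. \<Sum>c\<in>children v. TE + vtime h c) \<le> (CT + TE) * 5 ^ (h + 1) * card ?U" .
  have "(\<Sum>v\<in>?L. TE + vtime (Suc h) v) = card ?L * (TE + 5 * CT) + 5 * (\<Sum>v\<in>?L. \<Sum>c\<in>children v. TE + vtime h c)"
    by (simp add: sum.distrib sum_distrib_left algebra_simps)
  also have "\<dots> \<le> card ?L * ((CT + TE) * 5 ^ (Suc h + 1)) + 5 * ((CT + TE) * 5 ^ (h + 1) * card ?U)"
  proof (intro add_mono mult_le_mono2 ch)
    have "TE + 5 * CT \<le> (CT + TE) * 5" by simp
    also have "\<dots> \<le> (CT + TE) * 5 ^ (Suc h + 1)" by (intro mult_le_mono2) simp
    finally show "TE + 5 * CT \<le> (CT + TE) * 5 ^ (Suc h + 1)" .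
  qed
  also have "\<dots> = (CT + TE) * 5 ^ (Suc h + 1) * (card ?L + card ?U)" by (simp add: algebra_simps)
  also have "card ?L + card ?U = card {v. v \<le> n \<and> l \<le> lvl v}"
    by (subst card_Un_disjoint[symmetric]) (auto intro!: arg_cong[where f = card])
  finally show ?case .
qed

lemma vtime_root: "TE + vtime H 0 \<le> (CT + TE) * 5 ^ (H + 1) * N"
proof -
  have "TE + vtime H 0 \<le> (\<Sum>v | v \<le> n \<and> lvl v = 0. TE + vtime H v)"
    by (rule member_le_sum[of 0 _ "\<lambda>v. TE + vtime H v"]) (auto simp: lvl_0)
  also have "\<dots> \<le> (CT + TE) * 5 ^ (H + 1) * card {v. v \<le> n \<and> 0 \<le> lvl v}"
    by (rule vtime_sum) simp
  also have "card {v. v \<le> n \<and> 0 \<le> lvl v} = N"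
  proof -
    have "{v. v \<le> n \<and> 0 \<le> lvl v} = {..n}" by auto
    then show ?thesis by (simp add: N_def)
  qed
  finally show ?thesis .
qed

end

section \<open>Reading off the answer\<close>

text \<open>Without division, a bit is read by doubling modulo \<open>2 ^ D\<close> until it is the leading one.\<close>

definition mod_shift :: com where
  "mod_shift = While (Reg 31) (code (Set 22 (Add (Reg 22) (Reg 22)) ;;
     If (Sub (Add (Reg 22) (Const 1)) (Reg 23)) (Set 22 (Sub (Reg 22) (Reg 23))) Nop ;;
     Set 31 (Sub (Reg 31) (Const 1))))"

definition scan_digits :: com where
  "scan_digits = While (Reg 32)
     (Seq (code (If (Sub (Add (Reg 22) (Const 1)) (Reg 24)) (Set 5 (Const 1)) Nop ;; Set 31 (Reg 11)))
     (Seq mod_shift (code (Set 32 (Sub (Reg 32) (Const 1))))))"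

text \<open>The weight is the lowest digit of the exponent, so the weight classes occupy consecutive
  coefficients, \<open>\<beta>\<close> bits apart. The initial shift is \<open>D - 1\<close> minus
  the position of the highest relevant bit, \<open>\<beta> * (target + R - 1)\<close>, written
  without negative intermediate values.\<close>

definition read_answer :: com where
  "read_answer =
    Seq (code (Mul 26 12 3 29 ;; Mul 27 13 3 29 ;; Mul 28 14 4 29 ;; Mul 30 15 3 29 ;;
      Set 31 (Sub (Sub (Add (Reg 16) (Reg 11)) (Add (Add (Add (Reg 26) (Reg 27)) (Add (Reg 28) (Reg 30))) (Reg 12))) (Const 1)) ;;
      Set 23 (Const 1) ;; Set 29 (Reg 16) ;; Shl 23 29 ;;
      Set 24 (Const 1) ;; Set 29 (Sub (Reg 16) (Const 1)) ;; Shl 24 29 ;; Set 32 (Reg 10)))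
    (Seq mod_shift (Seq scan_digits (code (Set 0 (Reg 5)))))"

definition main_phase :: com where
  "main_phase = Seq (code (Set 23 (Const 0) ;; Set 22 (Const 1) ;; Set 25 (Const 1)))
     (Seq enter (Seq traverse read_answer))"

lemma double_mod: "(y::nat) < M \<Longrightarrow> (y + y) mod M = (if M \<le> y + y then y + y - M else y + y)"
  by (simp add: le_mod_geq)

text \<open>Doubling \<open>e\<close> times modulo \<open>2 ^ d\<close> drops all higher bits and
  brings bit \<open>d - 1 - e\<close> to the top, where a comparison reads it.\<close>

lemma top_bit:
  fixes Z :: nat
  assumes "e < d"
  shows "2 ^ (d - 1) \<le> Z * 2 ^ e mod 2 ^ d \<longleftrightarrow> odd (Z div 2 ^ (d - 1 - e))"
proof -
  define k where "k = d - 1 - e"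
  have d: "d = e + Suc k" using assms by (simp add: k_def)
  have "Z * 2 ^ e mod 2 ^ d = 2 ^ e * Z mod (2 ^ e * (2 ^ k * 2))"
    unfolding d by (simp only: power_add power_Suc mult_ac)
  also have "\<dots> = 2 ^ e * (Z mod (2 ^ k * 2))" by (rule mod_mult_mult1)
  also have "Z mod (2 ^ k * 2) = 2 ^ k * (Z div 2 ^ k mod 2) + Z mod 2 ^ k" by (rule mod_mult2_eq)
  finally have eq: "Z * 2 ^ e mod 2 ^ d = 2 ^ e * (2 ^ k * (Z div 2 ^ k mod 2) + Z mod 2 ^ k)" .
  have "2 ^ (d - 1) = 2 ^ e * (2::nat) ^ k" unfolding d by (simp add: power_add)
  then have "2 ^ (d - 1) \<le> Z * 2 ^ e mod 2 ^ d \<longleftrightarrow> 2 ^ k \<le> 2 ^ k * (Z div 2 ^ k mod 2) + Z mod 2 ^ k"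
    unfolding eq by simp
  also have "\<dots> \<longleftrightarrow> odd (Z div 2 ^ k)"
    by (cases "even (Z div 2 ^ k)") (simp_all add: odd_iff_mod_2_eq_one not_le)
  finally show ?thesis by (simp add: k_def)
qed

section \<open>From the value of the search to the parities of the weight classes\<close>

context machine
begin

text \<open>An edge joins a vertex to one of its ancestors, so grouping the edges by their lower
  ends turns the product over \<open>EA\<close> into local factors.\<close>

lemma tsum_eq_total: "tsum H 0 \<sigma> = total x"
proof -
  have edge: "(\<Prod>v\<le>n. \<Prod>u\<leftarrow>ancestors v. efactor u v (\<tau> u) (\<tau> v)) = (\<Prod>e\<in>EA. 1 + efac x e (\<tau> (fst e)) (\<tau> (snd e)))" for \<tau>
  proof -
    let ?g = "\<lambda>v u. efactor u v (\<tau> u) (\<tau> v)"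
    have "(\<Prod>u\<leftarrow>ancestors v. ?g v u) = (\<Prod>u\<in>{u \<in> set (ancestors v). adjacent u v}. 1 + efac x (u, v) (\<tau> u) (\<tau> v))"
      if "v \<le> n" for v
    proof -
      have "(\<Prod>u\<leftarrow>ancestors v. ?g v u) = (\<Prod>u\<in>set (ancestors v). ?g v u)"
        using distinct_ancestors[OF that] by (rule prod.distinct_set_conv_list[symmetric])
      also have "\<dots> = (\<Prod>u\<in>set (ancestors v). if adjacent u v then 1 + efac x (u, v) (\<tau> u) (\<tau> v) else 1)"
        by (rule prod.cong) (auto simp: efactor_def)
      also have "\<dots> = (\<Prod>u\<in>{u \<in> set (ancestors v). adjacent u v}. 1 + efac x (u, v) (\<tau> u) (\<tau> v))"
        by (rule prod.inter_filter[symmetric]) simp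
      finally show ?thesis .
    qed
    then have "(\<Prod>v\<le>n. \<Prod>u\<leftarrow>ancestors v. ?g v u) = (\<Prod>v\<le>n. \<Prod>u\<in>{u \<in> set (ancestors v). adjacent u v}. 1 + efac x (u, v) (\<tau> u) (\<tau> v))"
      by (intro prod.cong) auto
    also have "\<dots> = (\<Prod>(v, u)\<in>(SIGMA v:{..n}. {u \<in> set (ancestors v). adjacent u v}). 1 + efac x (u, v) (\<tau> u) (\<tau> v))"
      by (rule prod.Sigma) auto
    also have "\<dots> = (\<Prod>e\<in>EA. 1 + efac x e (\<tau> (fst e)) (\<tau> (snd e)))"
      by (rule prod.reindex_bij_witness[of _ "\<lambda>(u, v). (v, u)" "\<lambda>(v, u). (u, v)"]) (auto simp: EA_def)
    finally show ?thesis .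
  qed
  have "tsum H 0 \<sigma> = state_sum (subtree H 0) (\<lambda>\<tau>. \<Prod>u\<in>subtree H 0. loc u \<tau>) \<sigma>"
    by (rule tree_sum_eq_state_sum) (rule loc_cong, blast, simp)
  also have "\<dots> = total x"
    unfolding state_sum_def total_def subtree_root
  proof (rule sum.cong[OF refl])
    fix \<tau>
    let ?\<tau> = "\<lambda>x. if x \<in> {..n} then \<tau> x else \<sigma> x"
    have "(\<Prod>u\<le>n. loc u ?\<tau>) = (\<Prod>u\<le>n. loc u \<tau>)"
      by (intro prod.cong refl loc_cong) (use ancestors_lvl in auto)
    also have "\<dots> = (\<Prod>v\<le>n. vfac x v (\<tau> v)) * (\<Prod>e\<in>EA. 1 + efac x e (\<tau> (fst e)) (\<tau> (snd e)))"
      unfolding edge[symmetric] loc_def by (rule prod.distrib)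
    finally show "(\<Prod>u\<le>n. loc u ?\<tau>) = (\<Prod>v\<le>n. vfac x v (\<tau> v)) * (\<Prod>e\<in>EA. 1 + efac x e (\<tau> (fst e)) (\<tau> (snd e)))" .
  qed
  finally show ?thesis .
qed

lemma ok_mod_shift:
  assumes f: "f 23 = 2 ^ D" "f 22 = Z * 2 ^ e mod 2 ^ D" "f 31 = c" "c \<le> 2 * D"
    and Q: "Q (f(22 := Z * 2 ^ (e + c) mod 2 ^ D, 31 := 0), m)"
  shows "ok A B mod_shift (f, m) (c * 10 + 1) Q"
proof -
  have M: "4 * 2 ^ D \<le> B" using BD by simp
  let ?Inv = "\<lambda>i s. i \<le> c \<and> s = (f(22 := Z * 2 ^ (e + (c - i)) mod 2 ^ D, 31 := i), m)"
  have "ok A B mod_shift (f, m) (c * (8 + 2) + 1) Q"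
    unfolding mod_shift_def
  proof (rule ok_count_down[where Inv = ?Inv])
    fix i s assume i: "i < c" "?Inv (Suc i) s"
    let ?y = "Z * 2 ^ (e + (c - Suc i)) mod 2 ^ D"
    have s: "s = (f(22 := ?y, 31 := Suc i), m)" using i(2) by simp
    have y: "?y < 2 ^ D" by simp
    have iB: "i < B"
    proof -
      have "D < 2 ^ D" by (rule less_exp)
      then show ?thesis using i(1) f(4) M by linarith
    qed
    have ci: "c - i = Suc (c - Suc i)" using i(1) by simp
    have "Z * 2 ^ (e + Suc j) = Z * 2 ^ (e + j) + Z * 2 ^ (e + j)" for j by simp
    then have "Z * 2 ^ (e + (c - i)) mod 2 ^ D = (Z * 2 ^ (e + (c - Suc i)) + Z * 2 ^ (e + (c - Suc i))) mod 2 ^ D"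
      unfolding ci by (rule arg_cong)
    also have "\<dots> = (?y + ?y) mod 2 ^ D" by (simp add: mod_add_eq)
    also have "\<dots> = (if 2 ^ D \<le> ?y + ?y then ?y + ?y - 2 ^ D else ?y + ?y)"
      using y by (rule double_mod)
    finally have next_val: "Z * 2 ^ (e + (c - i)) mod 2 ^ D = (if 2 ^ D \<le> ?y + ?y then ?y + ?y - 2 ^ D else ?y + ?y)" .
    have yy: "?y + ?y < B" using y M by linarith
    show "ok A B (code (Set 22 (Add (Reg 22) (Reg 22)) ;;
     If (Sub (Add (Reg 22) (Const 1)) (Reg 23)) (Set 22 (Sub (Reg 22) (Reg 23))) Nop ;;
     Set 31 (Sub (Reg 31) (Const 1)))) s 8 (\<lambda>s'. fst s' 31 = i \<and> ?Inv i s')"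
    proof (rule ok_code_le[where D = D])
      define y0 where "y0 = ?y"
      show "wp A B D (Set 22 (Add (Reg 22) (Reg 22)) ;;
     If (Sub (Add (Reg 22) (Const 1)) (Reg 23)) (Set 22 (Sub (Reg 22) (Reg 23))) Nop ;;
     Set 31 (Sub (Reg 31) (Const 1))) (\<lambda>s'. fst s' 31 = i \<and> ?Inv i s') s"
        unfolding s using yy iB i(1) f(1) unfolding next_val y0_def[symmetric]
        by (auto simp: fun_upd_twist)
    qed simp
  qed (use f Q in \<open>auto simp: fun_upd_idem\<close>)
  then show ?thesis by simp
qed

lemma ok_scan_digits:
  assumes f: "f 23 = 2 ^ D" "f 24 = 2 ^ (D - 1)" "f 11 = \<beta>"
    and T: "\<beta> * (T0 + R) \<le> D"
  shows "f 32 = k \<Longrightarrow> k \<le> R \<Longrightarrow> f 22 = Z * 2 ^ (D + \<beta> - 1 - \<beta> * (T0 + k)) mod 2 ^ D \<Longrightarrow>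
     f 5 \<noteq> 0 \<longleftrightarrow> ans \<noteq> 0 \<or> (\<exists>j. k \<le> j \<and> j < R \<and> odd (Z div 2 ^ (\<beta> * (T0 + j)))) \<Longrightarrow>
     (\<And>f'. (f' 5 \<noteq> 0 \<longleftrightarrow> ans \<noteq> 0 \<or> (\<exists>j<R. odd (Z div 2 ^ (\<beta> * (T0 + j))))) \<Longrightarrow> Q (f', m)) \<Longrightarrow>
     ok A B scan_digits (f, m) (k * (\<beta> * 10 + 20) + 1) Q"
  using f
proof (induction k arbitrary: f)
  case 0
  then have "Q (f, m)" by simp
  then show ?case using 0 unfolding scan_digits_def by (simp del: One_nat_def) (rule ok_While_end; simp)
next
  case (Suc k)
  have b0: "0 < \<beta>" using \<beta> by (simp add: N_def)
  let ?e = "D + \<beta> - 1 - \<beta> * (T0 + Suc k)" and ?e' = "D + \<beta> - 1 - \<beta> * (T0 + k)"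
  have "\<beta> * (T0 + Suc k) \<le> \<beta> * (T0 + R)" using Suc.prems(2) by (intro mult_le_mono2) simp
  then have le: "\<beta> * (T0 + k) + \<beta> \<le> D" using T by simp
  have e': "?e' = ?e + \<beta>" and e: "?e < D" "D - 1 - ?e = \<beta> * (T0 + k)" using le b0 by auto
  have odd: "2 ^ (D - 1) \<le> f 22 \<longleftrightarrow> odd (Z div 2 ^ (\<beta> * (T0 + k)))"
    unfolding Suc.prems(3) top_bit[OF e(1)] e(2) ..
  define g where "g = (if 2 ^ (D - 1) \<le> f 22 then f(5 := 1) else f)(31 := \<beta>)"
  have g: "g 23 = 2 ^ D" "g 24 = 2 ^ (D - 1)" "g 11 = \<beta>" "g 22 = Z * 2 ^ ?e mod 2 ^ D" "g 31 = \<beta>" "g 32 = Suc k"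
    using Suc.prems(1,3,6-8) by (simp_all add: g_def)
  have ex: "(\<exists>j. k \<le> j \<and> j < R \<and> P j) \<longleftrightarrow> P k \<or> (\<exists>j. Suc k \<le> j \<and> j < R \<and> P j)" for P
  proof -
    have "k \<le> j \<longleftrightarrow> j = k \<or> Suc k \<le> j" for j by auto
    then show ?thesis using Suc.prems(2) by auto
  qed
  have g5: "g 5 \<noteq> 0 \<longleftrightarrow> ans \<noteq> 0 \<or> (\<exists>j. k \<le> j \<and> j < R \<and> odd (Z div 2 ^ (\<beta> * (T0 + j))))"
    unfolding ex[of "\<lambda>j. odd (Z div 2 ^ (\<beta> * (T0 + j)))"] odd[symmetric] using Suc.prems(4) by (auto simp: g_def)
  have "\<beta> \<le> 2 * D" using \<beta>_le_D by simp
  let ?h = "g(22 := Z * 2 ^ ?e' mod 2 ^ D, 31 := 0)"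
  have kB: "k < B" using Suc.prems(2) R_le_D by (intro D_less_B) simp
  have "ok A B scan_digits (?h(32 := k), m) (k * (\<beta> * 10 + 20) + 1) Q"
  proof (rule Suc.IH)
    show "Q (f', m)" if "f' 5 \<noteq> 0 \<longleftrightarrow> ans \<noteq> 0 \<or> (\<exists>j<R. odd (Z div 2 ^ (\<beta> * (T0 + j))))" for f'
      using that by (rule Suc.prems(5))
    show "(?h(32 := k)) 5 \<noteq> 0 \<longleftrightarrow> ans \<noteq> 0 \<or> (\<exists>j. k \<le> j \<and> j < R \<and> odd (Z div 2 ^ (\<beta> * (T0 + j))))"
      using g5 by simp
  qed (use g Suc.prems(2) in simp_all)
  then have "ok A B (code (Set 32 (Sub (Reg 32) (Const 1)))) (?h, m) 1 (\<lambda>s. ok A B scan_digits s (k * (\<beta> * 10 + 20) + 1) Q)"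
    by (intro ok_code_le[where D = D]) (use g kB in auto)
  then have "ok A B mod_shift (g, m) (\<beta> * 10 + 1) (\<lambda>s. ok A B (code (Set 32 (Sub (Reg 32) (Const 1)))) s 1 (\<lambda>s. ok A B scan_digits s (k * (\<beta> * 10 + 20) + 1) Q))"
    by (intro ok_mod_shift[OF g(1,4,5) \<open>\<beta> \<le> 2 * D\<close>]) (simp only: e')
  then have body: "ok A B (Seq mod_shift (code (Set 32 (Sub (Reg 32) (Const 1))))) (g, m) ((\<beta> * 10 + 1) + 1 + 1) (\<lambda>s. ok A B scan_digits s (k * (\<beta> * 10 + 20) + 1) Q)"
    by (rule ok_Seq)
  have "ok A B (Seq (code (If (Sub (Add (Reg 22) (Const 1)) (Reg 24)) (Set 5 (Const 1)) Nop ;; Set 31 (Reg 11)))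
     (Seq mod_shift (code (Set 32 (Sub (Reg 32) (Const 1)))))) (f, m) (\<beta> * 10 + 10) (\<lambda>s. ok A B scan_digits s (k * (\<beta> * 10 + 20) + 1) Q)"
  proof (rule ok_code_Seq[where D = D])
    have B1: "1 < B" "\<beta> < B" using R4 R_le_D \<beta>_le_D by (auto intro: D_less_B)
    have t: "Suc (f 22) - 2 ^ (D - 1) \<noteq> 0 \<longleftrightarrow> 2 ^ (D - 1) \<le> f 22" by auto
    show "wp A B D (If (Sub (Add (Reg 22) (Const 1)) (Reg 24)) (Set 5 (Const 1)) Nop ;; Set 31 (Reg 11))
      (\<lambda>s. ok A B (Seq mod_shift (code (Set 32 (Sub (Reg 32) (Const 1))))) s ((\<beta> * 10 + 1) + 1 + 1) (\<lambda>s. ok A B scan_digits s (k * (\<beta> * 10 + 20) + 1) Q)) (f, m)"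
      using body B1 Suc.prems(6-8) t by (cases "2 ^ (D - 1) \<le> f 22") (simp_all add: g_def)
  qed simp
  then have "ok A B scan_digits (f, m) ((\<beta> * 10 + 10) + (k * (\<beta> * 10 + 20) + 1) + 2) Q"
    unfolding scan_digits_def by (intro ok_While_step) (use Suc.prems(1) in auto)
  then show ?case by (rule ok_le) simp
qed

definition target :: nat where "target = R * ks + R\<^sup>2 * ks + R ^ 3 * mk + R ^ 4 * ks"

lemma ok_read_answer:
  assumes f: "cregs f" "f 22 = Z" and Z: "Z < 2 ^ D" and T: "\<beta> * (target + R) \<le> D"
    and Q: "\<And>f'. (f' 0 \<noteq> 0 \<longleftrightarrow> ans \<noteq> 0 \<or> (\<exists>j<R. odd (Z div 2 ^ (\<beta> * (target + j))))) \<Longrightarrow> Q (f', m)"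
  shows "ok A B read_answer (f, m) (100 * (D + 1) * (D + 1)) Q"
proof -
  let ?s = "\<beta> * target + \<beta> * R"
  let ?c = "D + \<beta> - ?s - 1"
  have s: "\<beta> * R * ks + \<beta> * R\<^sup>2 * ks + (\<beta> * R ^ 3 * mk + \<beta> * R ^ 4 * ks) + \<beta> * R = ?s"
    by (simp add: target_def algebra_simps)
  have sD: "?s \<le> D" using T by (simp add: distrib_left)
  have b: "1 \<le> \<beta>" using \<beta> by (simp add: N_def)
  have DB: "2 * D < B" "D < B" "D - 1 < B" "R < B" "2 ^ D < B" "2 ^ (D - 1) < B" "1 < B"
  proof -
    have "D < 2 ^ D" by (rule less_exp)
    moreover have "4 * 2 ^ D \<le> B" using BD by simp
    moreover have "(2::nat) ^ (D - 1) \<le> 2 ^ D" by (intro power_increasing) auto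
    ultimately show "2 * D < B" "D < B" "D - 1 < B" "R < B" "2 ^ D < B" "2 ^ (D - 1) < B" "1 < B"
      using R_le_D by linarith+
  qed
  have le: "\<beta> * R * ks \<le> D" "\<beta> * R\<^sup>2 * ks \<le> D" "\<beta> * R ^ 3 * mk \<le> D" "\<beta> * R ^ 4 * ks \<le> D"
    using s sD by linarith+
  have lt: "\<beta> * R * ks < B" "\<beta> * R\<^sup>2 * ks < B" "\<beta> * R ^ 3 * mk < B" "\<beta> * R ^ 4 * ks < B"
    using le DB(2) by linarith+
  have "1 * ks \<le> \<beta> * R * ks" "1 * mk \<le> \<beta> * R ^ 3 * mk"
    using b R4 by (intro mult_le_mono1; simp)+
  then have kD: "ks \<le> D" "mk \<le> D" using le by linarith+
  have regs: "f 3 = ks" "f 4 = mk" "f 5 = ans" "f 10 = R" "f 11 = \<beta>" "f 12 = \<beta> * R" "f 13 = \<beta> * R\<^sup>2"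
    "f 14 = \<beta> * R ^ 3" "f 15 = \<beta> * R ^ 4" "f 16 = D"
    using f(1) by (simp_all add: cregs_def)
  have cB: "?c \<le> 2 * D" "?c < B" using \<beta>_le_D DB(1) by linarith+
  have fin: "ok A B (Seq mod_shift (Seq scan_digits (code (Set 0 (Reg 5))))) (g, m)
      ((?c * 10 + 1) + ((R * (\<beta> * 10 + 20) + 1) + 1 + 1) + 1) Q"
    if g: "g 23 = 2 ^ D" "g 24 = 2 ^ (D - 1)" "g 11 = \<beta>" "g 22 = Z" "g 31 = ?c" "g 32 = R" "g 5 = ans" for g
  proof (rule ok_Seq, rule ok_mod_shift[OF g(1) _ g(5) cB(1), of Z 0])
    show "g 22 = Z * 2 ^ 0 mod 2 ^ D" using g(4) Z by simp
    have e: "?c = D + \<beta> - 1 - \<beta> * (target + R)" by (simp add: distrib_left)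
    show "ok A B (Seq scan_digits (code (Set 0 (Reg 5)))) (g(22 := Z * 2 ^ (0 + ?c) mod 2 ^ D, 31 := 0), m)
        ((R * (\<beta> * 10 + 20) + 1) + 1 + 1) Q"
    proof (rule ok_Seq, rule ok_scan_digits[OF _ _ _ T])
      show "(g(22 := Z * 2 ^ (0 + ?c) mod 2 ^ D, 31 := 0)) 22 = Z * 2 ^ (D + \<beta> - 1 - \<beta> * (target + R)) mod 2 ^ D"
        unfolding e by simp
      fix f' :: "nat \<Rightarrow> nat" assume f': "f' 5 \<noteq> 0 \<longleftrightarrow> ans \<noteq> 0 \<or> (\<exists>j<R. odd (Z div 2 ^ (\<beta> * (target + j))))"
      show "ok A B (code (Set 0 (Reg 5))) (f', m) 1 Q"
      proof (rule ok_fits)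
        assume fit: "fits A B (f', m)"
        have "Q (f'(0 := f' 5), m)" by (rule Q) (use f' in simp)
        then show "ok A B (code (Set 0 (Reg 5))) (f', m) 1 Q"
          by (intro ok_code_le[where D = D]) (use fits_D(1)[OF fit, of 5] in simp_all)
      qed
    qed (use g in auto)
  qed
  show ?thesis
    unfolding read_answer_def
  proof (rule ok_code_Seq[where D = D])
    show "wp A B D (Mul 26 12 3 29 ;; Mul 27 13 3 29 ;; Mul 28 14 4 29 ;; Mul 30 15 3 29 ;;
      Set 31 (Sub (Sub (Add (Reg 16) (Reg 11)) (Add (Add (Add (Reg 26) (Reg 27)) (Add (Reg 28) (Reg 30))) (Reg 12))) (Const 1)) ;;
      Set 23 (Const 1) ;; Set 29 (Reg 16) ;; Shl 23 29 ;;
      Set 24 (Const 1) ;; Set 29 (Sub (Reg 16) (Const 1)) ;; Shl 24 29 ;; Set 32 (Reg 10))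
      (\<lambda>s. ok A B (Seq mod_shift (Seq scan_digits (code (Set 0 (Reg 5))))) s
      ((?c * 10 + 1) + ((R * (\<beta> * 10 + 20) + 1) + 1 + 1) + 1) Q) (f, m)"
      using regs f(2) lt kD cB DB fin by (simp add: s)
    have "R * \<beta> \<le> D * D" "R \<le> D" using R_le_D \<beta>_le_D by (auto intro: mult_le_mono)
    then show "btime D (Mul 26 12 3 29 ;; Mul 27 13 3 29 ;; Mul 28 14 4 29 ;; Mul 30 15 3 29 ;;
      Set 31 (Sub (Sub (Add (Reg 16) (Reg 11)) (Add (Add (Add (Reg 26) (Reg 27)) (Add (Reg 28) (Reg 30))) (Reg 12))) (Const 1)) ;;
      Set 23 (Const 1) ;; Set 29 (Reg 16) ;; Shl 23 29 ;;
      Set 24 (Const 1) ;; Set 29 (Sub (Reg 16) (Const 1)) ;; Shl 24 29 ;; Set 32 (Reg 10)) +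
      ((?c * 10 + 1) + ((R * (\<beta> * 10 + 20) + 1) + 1 + 1) + 1) + 1 \<le> 100 * (D + 1) * (D + 1)"
      using cB(1) by (simp add: algebra_simps)
  qed
qed

lemma ok_main_phase:
  assumes f: "cregs f" "cmem m" and R: "R = N * N * 2 ^ b" "4 * (N * N) \<le> 2 ^ b" and k: "ks < R" "mk < R"
    and Q: "\<And>f' m'. (f' 0 \<noteq> 0 \<longleftrightarrow> ans \<noteq> 0 \<or> (\<exists>a. odd (card {Y \<in> good ks mk. weight Y = a}))) \<Longrightarrow> Q (f', m')"
  shows "ok A B main_phase (f, m) ((CT + TE) * 5 ^ (H + 1) * N + 100 * (D + 1) * (D + 1) + 20) Q"
proof -
  let ?\<sigma> = "\<lambda>u. m (bst + u)"
  have N1: "1 \<le> N" by (simp add: N_def)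
  then have NN: "N \<le> N * N" "1 \<le> N * N" by simp_all
  have cV: "card {..n} = N" by (simp add: N_def)
  have EA_sub: "EA \<subseteq> {..n} \<times> {..n} - (\<lambda>v. (v, v)) ` {..n}" using EA irr by fastforce
  have cEA: "card EA \<le> N * N" using card_mono[OF finite_cartesian_product[OF finite_atMost finite_atMost] EA]
    unfolding card_cartesian_product cV .
  have big: "4 * (N * N) \<le> R"
  proof -
    have "1 * (4 * (N * N)) \<le> N * N * 2 ^ b" using NN(2) R(2) by (rule mult_le_mono)
    then show ?thesis using R(1) by simp
  qed
  \<comment> \<open>Edges and diagonal pairs are disjoint sets of pairs, so at most
    \<open>N * N\<close> weights are added, each at most \<open>2 ^ b - 1\<close>. This explains the
    value of \<open>R\<close>.\<close>
  have wsum: "sum wt EA + (\<Sum>v\<le>n. wt (v, v)) < R"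
  proof -
    have fin: "finite ({..n} \<times> {..n})" by simp
    have "(\<Sum>v\<le>n. wt (v, v)) = sum wt ((\<lambda>v. (v, v)) ` {..n})" by (subst sum.reindex) (auto simp: inj_on_def)
    then have "sum wt EA + (\<Sum>v\<le>n. wt (v, v)) = sum wt (EA \<union> (\<lambda>v. (v, v)) ` {..n})"
      using EA_sub by (subst sum.union_disjoint) (auto intro: finite_subset[OF EA])
    also have "\<dots> \<le> sum wt ({..n} \<times> {..n})" using EA by (intro sum_mono2) auto
    also have "\<dots> \<le> (\<Sum>e\<in>{..n} \<times> {..n}. 2 ^ b - 1)"
      using bit_weight_less[of bits b] by (intro sum_mono) (auto simp: wt_def less_eq_Suc_le[symmetric] Suc_le_eq less_Suc_eq_le[symmetric])
    also have "\<dots> = N * N * (2 ^ b - 1)" using cV by (simp add: card_cartesian_product)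
    also have "\<dots> < R" unfolding R(1) using N1 by (intro mult_strict_left_mono) auto
    finally show ?thesis .
  qed
  have cond: "{..n} \<noteq> {}" "4 * card {..n} + card EA \<le> \<beta>" "card EA < R" "card {..n} < R" "card {..n} + 2 * card EA < R"
  proof -
    show "{..n} \<noteq> {}" by simp
    show "4 * card {..n} + card EA \<le> \<beta>" "card EA < R" "card {..n} < R" "card {..n} + 2 * card EA < R"
      unfolding cV using cEA \<beta> big NN by linarith+
  qed
  have dig: "odd (total x div 2 ^ (\<beta> * (target + j))) \<longleftrightarrow> odd (card {Y \<in> good ks mk. weight Y = j})" if "j < R" for j
    using odd_total_digit[OF cond(1,2,3,4) wsum that k] by (simp add: target_def add_ac)
  \<comment> \<open>Weight classes from \<open>R\<close> on are empty, so scanning \<open>R\<close>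
    coefficients misses nothing.\<close>
  have wlt: "weight Y < R" if "Y \<in> good ks mk" for Y
  proof -
    obtain X M where Y: "Y = (X, M)" "X \<subseteq> EA" "M \<subseteq> touched X" using \<open>Y \<in> _\<close> by (auto simp: good_def)
    have "sum wt X \<le> sum wt EA" using Y(2) finEA by (intro sum_mono2) auto
    moreover have "(\<Sum>v\<in>M. wt (v, v)) \<le> (\<Sum>v\<le>n. wt (v, v))"
      using Y(3) touched_V[OF Y(2)] by (intro sum_mono2) auto
    ultimately show ?thesis using wsum Y(1) by (simp add: weight_def)
  qed
  have ans: "(\<exists>j<R. odd (total x div 2 ^ (\<beta> * (target + j)))) \<longleftrightarrow> (\<exists>a. odd (card {Y \<in> good ks mk. weight Y = a}))"
  proof
    assume "\<exists>a. odd (card {Y \<in> good ks mk. weight Y = a})"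
    then obtain a where a: "odd (card {Y \<in> good ks mk. weight Y = a})" by blast
    then have "{Y \<in> good ks mk. weight Y = a} \<noteq> {}" by (metis card.empty even_zero)
    then have "a < R" using wlt by blast
    then show "\<exists>j<R. odd (total x div 2 ^ (\<beta> * (target + j)))" using dig a by blast
  qed (use dig in blast)
  have Z: "total x < 2 ^ D" unfolding D_def by (rule total_less[OF cond(1,2,3,4) wsum cond(5)])
  have TD: "\<beta> * (target + R) \<le> D"
  proof -
    \<comment> \<open>Putting the largest digit \<open>R - 1\<close> below the digits of
      \<open>target\<close> bounds all scanned positions at once.\<close>
    have "(R - 1) + R * ks + R\<^sup>2 * ks + R ^ 3 * mk < R ^ 4" by (rule radix_less) (use k R4 in auto)
    moreover have "R ^ 4 * ks + R ^ 4 \<le> R ^ 5"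
    proof -
      have "R ^ 4 * Suc ks \<le> R ^ 4 * R" using k(1) by (intro mult_le_mono2) simp
      then show ?thesis by (simp add: eval_nat_numeral)
    qed
    ultimately have "target + R \<le> R ^ 5" using R4 by (simp add: target_def)
    then show ?thesis by (rule exponent_le)
  qed
  have B0: "0 < B" "1 < B" using N_less_B[of 0] N_less_B[of 1] N1 by auto
  have DB: "2 ^ D < B"
  proof -
    have "4 * 2 ^ D \<le> B" using BD by simp
    moreover have "0 < (2::nat) ^ D" by simp
    ultimately show ?thesis by linarith
  qed
  let ?T3 = "100 * (D + 1) * (D + 1)"
  let ?f = "f(23 := 0, 22 := 1, 25 := 1)"
  have "ok A B enter (?f, m) TE (\<lambda>s. ok A B traverse s (vtime H 0 + 1) (\<lambda>s. ok A B read_answer s ?T3 Q))"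
  proof (rule vertex_ok[of H, unfolded vertex_ok_def, rule_format])
    show "?f 22 * tsum H 0 ?\<sigma> < B" using Z DB unfolding tsum_eq_total by simp
    show "live ?f m" using f by (simp add: live_def cregs_def)
    fix f' m' assume "exits 0 (?f 22 * tsum H 0 ?\<sigma>) m f' m'"
    then have f': "cregs f'" "f' 22 = total x" "f' 25 = 0" unfolding tsum_eq_total by (auto simp: exits_def)
    have "ok A B read_answer (f', m') ?T3 Q"
      by (rule ok_read_answer[OF f'(1,2) Z TD]) (rule Q, simp only: ans)
    then show "ok A B traverse (f', m') 1 (\<lambda>s. ok A B read_answer s ?T3 Q)"
      unfolding traverse_def using f'(3) by (intro ok_While_end) auto
  qed (auto simp: lvl_0)
  then have "ok A B enter (?f, m) TE (\<lambda>s. ok A B (Seq traverse read_answer) s (vtime H 0 + 1 + ?T3 + 1) Q)"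
    by (rule ok_mono[OF _ order_refl]) (rule ok_Seq)
  then have "ok A B (Seq enter (Seq traverse read_answer)) (?f, m) (TE + (vtime H 0 + 1 + ?T3 + 1) + 1) Q"
    by (rule ok_Seq)
  note seq = this
  have "ok A B main_phase (f, m) (5 + (TE + (vtime H 0 + 1 + ?T3 + 1) + 1) + 1) Q"
    unfolding main_phase_def
  proof (rule ok_code_Seq[where D = D])
    show "wp A B D (Set 23 (Const 0) ;; Set 22 (Const 1) ;; Set 25 (Const 1))
      (\<lambda>s. ok A B (Seq enter (Seq traverse read_answer)) s (TE + (vtime H 0 + 1 + ?T3 + 1) + 1) Q) (f, m)"
      using seq B0 by simp
    show "btime D (Set 23 (Const 0) ;; Set 22 (Const 1) ;; Set 25 (Const 1)) + (TE + (vtime H 0 + 1 + ?T3 + 1) + 1) + 1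
      \<le> 5 + (TE + (vtime H 0 + 1 + ?T3 + 1) + 1) + 1"
      unfolding btime.simps by linarith
  qed
  then show ?thesis by (rule ok_le) (use vtime_root in simp)
qed

end

section \<open>The whole program\<close>

text \<open>This finds the least \<open>b\<close> with \<open>4 * N\<^sup>2 \<le> 2 ^ b\<close>.
  Isolation among \<open>N\<^sup>2\<close> weights asks for \<open>2 * N\<^sup>2\<close>; the factor
  4 also yields \<open>N + 2 * N\<^sup>2 < R\<close>.\<close>

definition log_loop :: com where
  "log_loop = While (Sub (Add (Add (Reg 8) (Reg 8)) (Add (Reg 8) (Reg 8))) (Reg 9))
     (code (Set 9 (Add (Reg 9) (Reg 9)) ;; Set 7 (Add (Reg 7) (Const 1))))"

definition constants_block :: block where
  "constants_block =
    Mul 10 8 9 29 ;; Set 11 (Add (Reg 8) (Add (Add (Reg 6) (Reg 6)) (Add (Reg 6) (Reg 6)))) ;;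
    Mul 12 11 10 29 ;; Mul 13 12 10 29 ;; Mul 14 13 10 29 ;; Mul 15 14 10 29 ;; Mul 16 15 10 29 ;;
    Mul 28 0 0 29 ;; Set 17 (Add (Reg 0) (Reg 28)) ;; Mul 18 8 7 29 ;; Set 19 (Add (Reg 17) (Reg 18)) ;;
    Set 20 (Add (Reg 19) (Reg 6)) ;; Set 21 (Add (Reg 20) (Reg 6)) ;; Set 29 (Reg 18) ;; Set 28 (Const 0)"

definition constants :: com where
  "constants =
    Seq (code (Set 6 (Add (Reg 0) (Const 1)) ;; Mul 8 6 6 29 ;; Set 9 (Const 1) ;; Set 7 (Const 0)))
    (Seq log_loop (code constants_block))"

definition toss_block :: block where
  "toss_block = Set 29 (Sub (Reg 29) (Const 1)) ;; Put (Add (Reg 17) (Reg 29)) (Reg 28) ;; Set 28 (Const 0)"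

definition toss_loop :: com where
  "toss_loop = While (Reg 29) (Seq (Toss 28) (code toss_block))"

definition program :: "block \<Rightarrow> com" where
  "program pre = Seq (code pre) (Seq constants (Seq toss_loop main_phase))"

lemma ok_log_loop:
  assumes f: "f 8 = k" and B: "2 ^ b < B" "b < B" and b: "4 * k \<le> 2 ^ b" "\<And>i. i < b \<Longrightarrow> 2 ^ i < 4 * k"
    and Q: "Q (f(7 := b, 9 := 2 ^ b), m)"
  shows "i \<le> b \<Longrightarrow> ok A B log_loop (f(7 := i, 9 := 2 ^ i), m) ((b - i) * 10 + 1) Q"
proof (induction "b - i" arbitrary: i)
  case 0
  then have "i = b" by simp
  have "ok A B log_loop (f(7 := b, 9 := 2 ^ b), m) 1 Q"
    unfolding log_loop_def by (rule ok_While_end) (use f b(1) Q in simp_all)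
  then show ?case unfolding \<open>i = b\<close> by (rule ok_le) simp
next
  case (Suc d)
  then have i: "i < b" by simp
  let ?body = "Set 9 (Add (Reg 9) (Reg 9)) ;; Set 7 (Add (Reg 7) (Const 1))"
  have "(2::nat) ^ Suc i \<le> 2 ^ b" using i by (intro power_increasing) auto
  then have lt: "(2::nat) ^ i + 2 ^ i < B" "Suc i < B" using B i by auto
  have "ok A B log_loop (f(7 := Suc i, 9 := 2 ^ Suc i), m) ((b - Suc i) * 10 + 1) Q"
    by (rule Suc.hyps(1)) (use Suc.hyps(2) i in auto)
  moreover have "f(7 := i, 9 := 2 ^ i, 9 := 2 ^ i + 2 ^ i, 7 := Suc i) = f(7 := Suc i, 9 := 2 ^ Suc i)"
    by (simp add: fun_eq_iff mult_2)
  ultimately have "ok A B (code ?body) (f(7 := i, 9 := 2 ^ i), m) 3 (\<lambda>s. ok A B log_loop s ((b - Suc i) * 10 + 1) Q)"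
    using lt by (intro ok_code_le[where D = 0]) simp_all
  then have "ok A B log_loop (f(7 := i, 9 := 2 ^ i), m) (3 + ((b - Suc i) * 10 + 1) + 2) Q"
    unfolding log_loop_def by (intro ok_While_step) (use b(2)[OF i] f in auto)
  then show ?case by (rule ok_le) (use i in simp)
qed

lemma reach_Seq_context: "reach I (c, s) T (c', s') \<Longrightarrow> reach I (Seq c d, s) T (Seq c' d, s')"
  unfolding reach_def using path_Seq by fastforce

section \<open>Random bits from coin tosses\<close>

definition fill :: "nat \<Rightarrow> nat \<Rightarrow> (nat \<Rightarrow> bool) \<Rightarrow> (nat \<Rightarrow> nat) \<Rightarrow> nat \<Rightarrow> nat" where
  "fill base k g m = (\<lambda>a. if base \<le> a \<and> a < base + k then of_bool (g (a - base)) else m a)"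

lemma fill_Suc: "fill base (Suc k) (g(k := y)) m = fill base k g (m(base + k := of_bool y))"
  by (auto simp: fill_def fun_eq_iff)

text \<open>The cells are filled from the last to the first, and each toss splits one independent
  coordinate off the product distribution. The rest of the program is a continuation whose outcome
  may depend on all the bits.\<close>

lemma halts_as_toss_loop:
  assumes base: "f 17 = base" and A: "base + K \<le> A" "1 < B" "K < B"
  shows "k \<le> K \<Longrightarrow> fits A B (f(28 := 0, 29 := k), m) \<Longrightarrow>
    (\<And>g. halts_as (fits A B) (rest, (f(28 := 0, 29 := 0), fill base k g m)) T (E g)) \<Longrightarrow>
    halts_as (fits A B) (Seq toss_loop rest, (f(28 := 0, 29 := k), m)) (k * 20 + 2 + T)
      (bind_pmf (Pi_pmf {..<k} False (\<lambda>_. bernoulli_pmf (1 / 2))) E)"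
proof (induction k arbitrary: m E)
  case 0
  have fill_0: "fill base 0 g m = m" for g by (simp add: fill_def fun_eq_iff)
  have rest: "halts_as (fits A B) (rest, (f(28 := 0, 29 := 0), m)) T (E (\<lambda>_. False))"
    using 0(3)[of "\<lambda>_. False"] unfolding fill_0 .
  have "ex (fits A B) toss_loop (f(28 := 0, 29 := 0), m) 1 (f(28 := 0, 29 := 0), m)"
    unfolding toss_loop_def by (rule ex_While_end) (simp, rule 0(2), simp)
  from reach_halts_as[OF reach_Seq[OF this] rest] show ?case
    unfolding lessThan_0 pmf_Pi_empty bind_return_pmf by (rule halts_as_mono) simp
next
  case (Suc k)
  let ?W = toss_loop and ?body = "Seq (Toss 28) (code toss_block)"
  let ?s = "(f(28 := 0, 29 := Suc k), m)"
  let ?s1 = "\<lambda>y. (f(28 := of_bool y, 29 := Suc k), m)"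
  let ?c = "\<lambda>c. Seq (Seq (Seq c (code toss_block)) ?W) rest"
  let ?Pi = "Pi_pmf {..<k} False (\<lambda>_. bernoulli_pmf (1 / 2))"
  have fit: "fits A B ?s" by (rule Suc.prems(2))
  have fit1: "fits A B (?s1 y)" for y
  proof -
    have "fits A B ((f(28 := 0, 29 := Suc k))(28 := of_bool y), m)"
      by (rule fits_reg[OF fit]) (use A(2) in auto)
    moreover have "(f(28 := 0, 29 := Suc k))(28 := of_bool y) = f(28 := of_bool y, 29 := Suc k)"
      by (simp add: fun_eq_iff)
    ultimately show ?thesis by (simp only:)
  qed
  have blk: "ex (fits A B) (code toss_block) (?s1 y) 5 (f(28 := 0, 29 := k), m(base + k := of_bool y))" for y
  proof -
    have "ok A B (code toss_block) (?s1 y) 5 (\<lambda>s. s = (f(28 := 0, 29 := k), m(base + k := of_bool y)))"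
      using base A Suc.prems(1)
      by (intro ok_code_le[where D = 0]) (auto simp: toss_block_def fun_upd_twist)
    then show ?thesis using fit1[of y] by (auto simp: ok_def)
  qed
  have after: "reach (fits A B) (?c Skip, ?s1 y) 7 (Seq ?W rest, (f(28 := 0, 29 := k), m(base + k := of_bool y)))" for y
  proof -
    have "reach (fits A B) (Seq Skip (code toss_block), ?s1 y) 1 (code toss_block, ?s1 y)"
      by (rule reach_step) (use fit1 in auto)
    from reach_trans[OF this blk[of y]] have "ex (fits A B) (Seq Skip (code toss_block)) (?s1 y) 6 (f(28 := 0, 29 := k), m(base + k := of_bool y))"
      by simp
    from reach_Seq_context[OF reach_Seq[OF this]] show ?thesis by (simp add: numeral_eq_Suc)
  qed
  have IH: "halts_as (fits A B) (Seq ?W rest, (f(28 := 0, 29 := k), m(base + k := of_bool y))) (k * 20 + 2 + T)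
      (bind_pmf ?Pi (\<lambda>g. E (g(k := y))))" for y
  proof (rule Suc.IH)
    show "fits A B (f(28 := 0, 29 := k), m(base + k := of_bool y))" using reach_inv[OF blk[of y]] by simp
    show "halts_as (fits A B) (rest, f(28 := 0, 29 := 0), fill base k g (m(base + k := of_bool y))) T (E (g(k := y)))" for g
      using Suc.prems(3)[of "g(k := y)"] unfolding fill_Suc .
  qed (use Suc.prems in simp)
  note tail = reach_halts_as[OF after IH]
  \<comment> \<open>The outcome of the toss is recovered from register 28, since the continuation
    may only depend on the configuration.\<close>
  let ?D = "\<lambda>x :: com \<times> state. bind_pmf ?Pi (\<lambda>g. E (g(k := (fst (snd x) 28 \<noteq> 0))))"
  have step: "step (?c (Toss 28)) ?s = map_pmf (\<lambda>y. (?c Skip, ?s1 y)) (bernoulli_pmf (1 / 2))"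
    by (simp add: pmf.map_comp comp_def fun_upd_twist)
  have "halts_as (fits A B) (?c (Toss 28), ?s) (Suc (7 + (k * 20 + 2 + T))) (bind_pmf (step (?c (Toss 28)) ?s) ?D)"
  proof (rule halts_as_step)
    show "fits A B ?s" by (rule fit)
    fix x assume "x \<in> set_pmf (step (?c (Toss 28)) ?s)"
    then obtain y where x: "x = (?c Skip, ?s1 y)" unfolding step by auto
    have "(of_bool y :: nat) \<noteq> 0 \<longleftrightarrow> y" by simp
    then show "halts_as (fits A B) x (7 + (k * 20 + 2 + T)) (?D x)"
      using tail[of y] unfolding x by simp
  qed
  also have "bind_pmf (step (?c (Toss 28)) ?s) ?D = bind_pmf (Pi_pmf {..<Suc k} False (\<lambda>_. bernoulli_pmf (1 / 2))) E"
    unfolding step lessThan_Suc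
    by (subst Pi_pmf_insert) (auto simp: bind_map_pmf map_pmf_def pair_pmf_def bind_assoc_pmf bind_return_pmf)
  finally have main: "halts_as (fits A B) (?c (Toss 28), ?s) (Suc (7 + (k * 20 + 2 + T))) \<dots>" .
  have "reach (fits A B) (?W, ?s) 1 (Seq ?body ?W, ?s)"
    unfolding toss_loop_def by (rule reach_step) (use fit in auto)
  from reach_halts_as[OF reach_Seq_context[OF this] main] show ?case
    by (rule halts_as_mono) simp
qed

context machine
begin

definition wts :: "(nat \<Rightarrow> bool) \<Rightarrow> nat \<times> nat \<Rightarrow> nat" where
  "wts g = (\<lambda>(u, v). bit_weight g b (u * N + v))"

text \<open>A pair is identified with a set of weight numbers: those of its edges and those of the
  diagonal pairs of its marks. Edges are never diagonal, so this is injective.\<close>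

lemma good_isolation:
  assumes ne: "good ks mk \<noteq> {}" and b: "2 * (N * N) \<le> 2 ^ b"
  shows "measure_pmf.prob (Pi_pmf {..<N * N * b} False (\<lambda>_. bernoulli_pmf (1 / 2)))
    {g. \<forall>a. even (card {Y \<in> good ks mk. cut_count.weight (wts g) Y = a})} \<le> 1 / 2"
proof -
  let ?G = "good ks mk"
  define ix where "ix = (\<lambda>(u, v). u * N + v)"
  define S where "S = (\<lambda>(X, M). ix ` (X \<union> (\<lambda>v. (v, v)) ` M))"
  have inj: "inj_on ix ({..n} \<times> {..n})"
  proof (rule inj_onI)
    fix e e' assume e: "e \<in> {..n} \<times> {..n}" "e' \<in> {..n} \<times> {..n}" "ix e = ix e'"
    obtain u v u' v' where uv: "e = (u, v)" "e' = (u', v')" by (cases e, cases e')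
    have h: "u \<in> {..n}" "v \<in> {..n}" "u' \<in> {..n}" "v' \<in> {..n}" "ix (u, v) = ix (u', v')"
      using e unfolding uv by auto
    have "(p * N + c) div N = p" "(p * N + c) mod N = c" if "c \<le> n" for p c
    proof -
      have "c < N" using that by (simp add: N_def)
      then show "(p * N + c) div N = p" "(p * N + c) mod N = c" by simp_all
    qed
    then have "(u * N + v) div N = u" "(u * N + v) mod N = v" "(u' * N + v') div N = u'" "(u' * N + v') mod N = v'"
      using h by auto
    then have "u = u' \<and> v = v'" using h(5) by (simp add: ix_def)
    then show "e = e'" unfolding uv by simp
  qed
  have sub: "X \<subseteq> EA" "M \<subseteq> {..n}" "X \<union> (\<lambda>v. (v, v)) ` M \<subseteq> {..n} \<times> {..n}" if "(X, M) \<in> ?G" for X M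
    using that EA touched_V[of X] by (auto simp: good_def)
  have fin: "finite ?G"
  proof (rule finite_subset)
    show "?G \<subseteq> Pow EA \<times> Pow {..n}"
    proof
      fix Y assume "Y \<in> ?G"
      then show "Y \<in> Pow EA \<times> Pow {..n}" using sub(1,2)[of "fst Y" "snd Y"] by (cases Y) simp
    qed
  qed (use finEA in simp)
  have injS: "inj_on S ?G"
  proof (rule inj_onI, clarify)
    fix X M X' M' assume g: "(X, M) \<in> ?G" "(X', M') \<in> ?G" "S (X, M) = S (X', M')"
    have eq: "X \<union> (\<lambda>v. (v, v)) ` M = X' \<union> (\<lambda>v. (v, v)) ` M'"
      using inj_on_image_eq_iff[OF inj sub(3)[OF g(1)] sub(3)[OF g(2)]] g(3) by (simp add: S_def)
    have off: "fst e \<noteq> snd e" if "e \<in> X \<union> X'" for e using that sub(1)[OF g(1)] sub(1)[OF g(2)] irr by blast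
    have "e \<in> X \<longleftrightarrow> e \<in> X'" for e using eq off[of e] by (cases e) auto
    moreover have "v \<in> M \<longleftrightarrow> v \<in> M'" for v using eq off[of "(v, v)"] by auto
    ultimately show "X = X' \<and> M = M'" by blast
  qed
  have Sq: "S Y \<subseteq> {..<N * N}" if "Y \<in> ?G" for Y
  proof -
    obtain X M where Y: "Y = (X, M)" by (cases Y)
    have "ix e < N * N" if e: "e \<in> X \<union> (\<lambda>v. (v, v)) ` M" for e
    proof -
      have "e \<in> {..n} \<times> {..n}" using sub(3)[of X M] that \<open>Y \<in> ?G\<close> unfolding Y by blast
      then show ?thesis using index_less by (auto simp: ix_def)
    qed
    then show ?thesis unfolding Y S_def by auto
  qed
  have W: "(\<Sum>i\<in>S Y. bit_weight g b i) = cut_count.weight (wts g) Y" if Y: "Y \<in> ?G" for g Y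
  proof -
    obtain X M where XM: "Y = (X, M)" by (cases Y)
    have fXM: "finite X" "finite M" using sub(1,2)[of X M] Y finEA finite_subset unfolding XM by blast+
    have disj: "X \<inter> (\<lambda>v. (v, v)) ` M = {}" using sub(1)[of X M] irr Y unfolding XM by fastforce
    have "(\<Sum>i\<in>S Y. bit_weight g b i) = (\<Sum>e\<in>X \<union> (\<lambda>v. (v, v)) ` M. bit_weight g b (ix e))"
      unfolding XM S_def prod.case
      by (subst sum.reindex[OF inj_on_subset[OF inj sub(3)]]) (use Y XM in auto)
    also have "\<dots> = sum (wts g) (X \<union> (\<lambda>v. (v, v)) ` M)"
      by (rule sum.cong) (auto simp: wts_def ix_def)
    also have "\<dots> = sum (wts g) X + sum (wts g) ((\<lambda>v. (v, v)) ` M)"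
      using fXM disj by (intro sum.union_disjoint) auto
    also have "sum (wts g) ((\<lambda>v. (v, v)) ` M) = (\<Sum>v\<in>M. wts g (v, v))"
      by (subst sum.reindex) (auto simp: inj_on_def)
    finally show ?thesis unfolding XM cut_count.weight_def[OF cut_count_axioms] by simp
  qed
  have "{Y \<in> ?G. cut_count.weight (wts g) Y = a} = {Y \<in> ?G. (\<Sum>i\<in>S Y. bit_weight g b i) = a}" for g a
    using W by auto
  then show ?thesis using isolation[OF fin ne injS Sq b] by simp
qed

lemma ok_constants:
  assumes R: "R = N * N * 2 ^ b" "4 * (N * N) \<le> 2 ^ b" "\<And>i. i < b \<Longrightarrow> 2 ^ i < 4 * (N * N)"
    and \<beta>_eq: "\<beta> = N * N + 4 * N"
    and g: "g 0 = n" "g 2 = pf" "g 3 = ks" "g 4 = mk" "g 5 = ans"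
  shows "ok A B constants (g, m) (100 * D + 200) (\<lambda>s. \<exists>f. s = (f, m) \<and> cregs f \<and> f 28 = 0 \<and> f 29 = N * N * b)"
proof -
  let ?Q = "\<lambda>s. \<exists>f. s = (f, m) \<and> cregs f \<and> f 28 = 0 \<and> f 29 = N * N * b"
  let ?h = "g(6 := N, 8 := N * N, 29 := 0)"
  have N1: "1 \<le> N" by (simp add: N_def)
  have bD: "b \<le> D" "2 ^ b \<le> D" using b_le_R bR R_le_D by simp_all
  have ND: "N \<le> D" "N * N \<le> D" "N * N + 4 * N \<le> D" using \<beta> \<beta>_le_D by simp_all
  have Ds: "\<beta> * R \<le> D" "\<beta> * R\<^sup>2 \<le> D" "\<beta> * R ^ 3 \<le> D" "\<beta> * R ^ 4 \<le> D"
    using R_pow_le[of 1] R_pow_le[of 2] R_pow_le[of 3] R_pow_le[of 4] by simp_all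
  have areas: "n * n \<le> D" "base0 \<le> D" "N * N * b \<le> D" "bst \<le> D" "bA \<le> D" "bS \<le> D" "n \<le> D"
    using AD by (simp_all add: A_def bS_def bA_def bst_def base0_def)
  have block: "ok A B (code constants_block) (?h(7 := b, 9 := 2 ^ b), m) (50 * D + 100) ?Q"
  proof (rule ok_code_le[where D = D])
    have P: "\<beta> * R * R = \<beta> * R\<^sup>2" "\<beta> * R\<^sup>2 * R = \<beta> * R ^ 3" "\<beta> * R ^ 3 * R = \<beta> * R ^ 4" "\<beta> * R ^ 4 * R = D"
      by (simp_all add: eval_nat_numeral D_def)
    have R': "N * N * 2 ^ b = R" using R(1) by simp
    have \<beta>': "N * N + (N + N + (N + N)) = \<beta>" using \<beta>_eq by simp
    have lts: "R < B" "\<beta> < B" "\<beta> * R < B" "\<beta> * R\<^sup>2 < B" "\<beta> * R ^ 3 < B" "\<beta> * R ^ 4 < B" "D < B" "n * n < B" "base0 < B"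
      "N * N * b < B" "bst < B" "bA < B" "bS < B" "0 < B"
      using R_le_D \<beta>_le_D Ds areas by (auto intro!: D_less_B)
    have sums: "n + n * n = base0" "base0 + N * N * b = bst" "bst + N = bA" "bA + N = bS"
      by (simp_all add: base0_def bst_def bA_def bS_def)
    show "wp A B D constants_block ?Q (?h(7 := b, 9 := 2 ^ b), m)"
      unfolding constants_block_def using bD areas R_le_D lts g
      by (simp add: R' \<beta>' P sums cregs_def)
  qed (simp add: constants_block_def)
  have log: "ok A B log_loop (?h(7 := 0, 9 := 2 ^ 0), m) ((b - 0) * 10 + 1) (\<lambda>s. ok A B (code constants_block) s (50 * D + 100) ?Q)"
    by (rule ok_log_loop[where k = "N * N"]) (use bD R block in \<open>auto intro!: D_less_B\<close>)
  have "ok A B (Seq log_loop (code constants_block)) (?h(7 := 0, 9 := 2 ^ 0), m) (((b - 0) * 10 + 1) + (50 * D + 100) + 1) ?Q"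
    using log by (rule ok_Seq)
  moreover have "g(6 := N, 8 := N * N, 29 := 0, 9 := 1, 7 := 0) = ?h(7 := 0, 9 := 2 ^ 0)" by (simp add: fun_eq_iff)
  ultimately have rest: "ok A B (Seq log_loop (code constants_block)) (g(6 := N, 8 := N * N, 29 := 0, 9 := 1, 7 := 0), m) (((b - 0) * 10 + 1) + (50 * D + 100) + 1) ?Q"
    by (simp only:)
  have B: "Suc n < B" "N * N < B" "N < B" "1 < B" "0 < B" using ND N1 by (auto intro!: D_less_B simp: N_def)
  have Sn: "Suc n = N" by (simp add: N_def)
  show ?thesis
    unfolding constants_def
  proof (rule ok_code_Seq[where D = D])
    show "wp A B D (Set 6 (Add (Reg 0) (Const 1)) ;; Mul 8 6 6 29 ;; Set 9 (Const 1) ;; Set 7 (Const 0))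
      (\<lambda>s. ok A B (Seq log_loop (code constants_block)) s (((b - 0) * 10 + 1) + (50 * D + 100) + 1) ?Q) (g, m)"
      using rest B ND g(1) by (simp add: Sn del: mult_Suc mult_Suc_right)
  qed (use bD in simp)
qed

lemma program_halts:
  assumes R: "R = N * N * 2 ^ b" "4 * (N * N) \<le> 2 ^ b" "\<And>i. i < b \<Longrightarrow> 2 ^ i < 4 * (N * N)"
    and \<beta>_eq: "\<beta> = N * N + 4 * N" and k: "ks < R" "mk < R"
    and fit: "fits A B s0"
    and pre: "wp A B D pre (\<lambda>s. \<exists>g. s = (g, m0) \<and> g 0 = n \<and> g 2 = pf \<and> g 3 = ks \<and> g 4 = mk \<and> g 5 = ans) s0"
    and m0: "\<And>v. v < n \<Longrightarrow> m0 v = pc v" "\<And>u v. u < n \<Longrightarrow> v < n \<Longrightarrow> m0 (n + u * n + v) = of_bool (adj u v)"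
  shows "\<exists>out. halts_as (fits A B) (program pre, s0)
      (btime D pre + 200 * (D + 1) * (D + 1) + (CT + TE) * 5 ^ (H + 1) * N)
      (map_pmf out (Pi_pmf {..<N * N * b} False (\<lambda>_. bernoulli_pmf (1 / 2)))) \<and>
    (\<forall>g. fst (out g) 0 \<noteq> 0 \<longleftrightarrow> ans \<noteq> 0 \<or> (\<exists>a. odd (card {Y \<in> good ks mk. cut_count.weight (wts g) Y = a})))"
proof -
  let ?Pi = "Pi_pmf {..<N * N * b} False (\<lambda>_. bernoulli_pmf (1 / 2))"
  let ?T = "(CT + TE) * 5 ^ (H + 1) * N + 100 * (D + 1) * (D + 1) + 20"
  obtain g where g: "ex (fits A B) (code pre) s0 (btime D pre) (g, m0)"
    "g 0 = n" "g 2 = pf" "g 3 = ks" "g 4 = mk" "g 5 = ans"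
    using ok_code[OF pre] fit unfolding ok_def by blast
  have fg: "fits A B (g, m0)" using reach_inv[OF g(1)] by simp
  obtain f where f: "ex (fits A B) constants (g, m0) (100 * D + 200) (f, m0)" "cregs f" "f 28 = 0" "f 29 = N * N * b"
    using ok_constants[OF R \<beta>_eq g(2-6), of m0] fg unfolding ok_def by blast
  have ff: "fits A B (f, m0)" using reach_inv[OF f(1)] by simp
  have KD: "N * N * b \<le> D" using AD by (simp add: A_def bS_def bA_def bst_def)
  have D4: "4 \<le> D" using R4 R_le_D by simp
  have KA: "base0 + N * N * b \<le> A" by (simp add: A_def bS_def bA_def bst_def)
  let ?s = "\<lambda>h. (f(28 := 0, 29 := 0), fill base0 (N * N * b) h m0)"
  let ?yes = "\<lambda>h. ans \<noteq> 0 \<or> (\<exists>a. odd (card {Y \<in> good ks mk. cut_count.weight (wts h) Y = a}))"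
  have fits_s: "fits A B (?s h)" for h
  proof -
    have "1 < B" "0 < B" using D4 by (auto intro!: D_less_B)
    then show ?thesis using ff KA by (auto simp: fits_def fill_def)
  qed
  have "\<exists>s'. ex (fits A B) main_phase (?s h) ?T s' \<and> (fst s' 0 \<noteq> 0 \<longleftrightarrow> ?yes h)" for h
  proof -
    \<comment> \<open>The locale is instantiated with the tossed bits \<open>h\<close>. The good
      pairs do not depend on them; only the weights do.\<close>
    have cm: "machine.cmem n b h pc adj (fill base0 (N * N * b) h m0)"
      unfolding machine.cmem_def[OF machine_axioms]
    proof (intro conjI allI impI)
      fix v assume "v < n"
      then show "fill base0 (N * N * b) h m0 v = pc v" using m0(1) by (simp add: fill_def base0_def)
    next
      fix u v assume uv: "u < n" "v < n"
      have "u * n + v < Suc u * n" using uv by simp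
      also have "\<dots> \<le> n * n" using uv by (intro mult_le_mono1) simp
      finally show "fill base0 (N * N * b) h m0 (n + u * n + v) = of_bool (adj u v)"
        using m0(2)[OF uv] by (simp add: fill_def base0_def)
    next
      fix j assume "j < (n + 1) * (n + 1) * b"
      then show "fill base0 (N * N * b) h m0 (n + n * n + j) = of_bool (h j)" by (simp add: fill_def base0_def N_def)
    qed
    have cr: "cregs (f(28 := 0, 29 := 0))" using f(2) by (simp add: cregs_def)
    have wt: "machine.wt n b h = wts h" unfolding machine.wt_def[OF machine_axioms] wts_def N_def ..
    have "ok A B main_phase (?s h) ?T (\<lambda>s'. fst s' 0 \<noteq> 0 \<longleftrightarrow> ?yes h)"
      by (rule machine.ok_main_phase[OF machine_axioms, where bits = h and ks = ks and mk = mk and pf = pf and ans = ans and adj = adj,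
            folded N_def, folded base0_def, folded bst_def, folded bA_def, folded bS_def, folded A_def, folded D_def, OF cr cm R(1,2) k])
        (simp add: wt)
    from this[unfolded ok_def] fits_s[of h] show ?thesis by (rule mp)
  qed
  then have "\<exists>out. \<forall>h. ex (fits A B) main_phase (?s h) ?T (out h) \<and> (fst (out h) 0 \<noteq> 0 \<longleftrightarrow> ?yes h)"
    by (intro choice allI)
  then obtain out where outs: "\<forall>h. ex (fits A B) main_phase (?s h) ?T (out h) \<and> (fst (out h) 0 \<noteq> 0 \<longleftrightarrow> ?yes h)" ..
  note out = conjunct1[OF spec[OF outs]] conjunct2[OF spec[OF outs]]
  have fin: "halts_as (fits A B) (main_phase, ?s h) (?T + 0) (return_pmf (out h))" for h
    using reach_inv[OF out(1)[of h]] by (intro reach_halts_as[OF out(1)] halts_as_Skip) simp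
  have "f(28 := 0, 29 := N * N * b) = f" using f(3,4) by (simp add: fun_eq_iff)
  then have toss: "halts_as (fits A B) (Seq toss_loop main_phase, (f, m0)) (N * N * b * 20 + 2 + (?T + 0)) (bind_pmf ?Pi (\<lambda>h. return_pmf (out h)))"
    using halts_as_toss_loop[of f base0 "N * N * b" A B "N * N * b" m0 main_phase "?T + 0" "\<lambda>h. return_pmf (out h)"] ff fin KA KD D4 f(2)
    by (simp add: cregs_def D_less_B)
  have "halts_as (fits A B) (program pre, s0)
      ((btime D pre + 1) + ((100 * D + 200 + 1) + (N * N * b * 20 + 2 + (?T + 0)))) (bind_pmf ?Pi (\<lambda>h. return_pmf (out h)))"
    unfolding program_def
    by (rule reach_halts_as[OF reach_Seq[OF g(1)] reach_halts_as[OF reach_Seq[OF f(1)] toss]])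
  then have "halts_as (fits A B) (program pre, s0)
      (btime D pre + 200 * (D + 1) * (D + 1) + (CT + TE) * 5 ^ (H + 1) * N) (map_pmf out ?Pi)"
    unfolding map_pmf_def
  proof (rule halts_as_mono)
    have "4 * D \<le> D * D" using D4 by simp
    define P where "P = (D + 1) * (D + 1)"
    have "P = D * D + 2 * D + 1" by (simp add: P_def)
    then have "120 * D + 226 \<le> 100 * P" using \<open>4 * D \<le> D * D\<close> D4 by linarith
    moreover have "N * N * b * 20 \<le> 20 * D" using KD by simp
    moreover have "100 * (D + 1) * (D + 1) = 100 * P" "200 * (D + 1) * (D + 1) = 200 * P"
      unfolding P_def by (simp_all only: mult.assoc)
    ultimately show "(btime D pre + 1) + ((100 * D + 200 + 1) + (N * N * b * 20 + 2 + (?T + 0)))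
      \<le> btime D pre + 200 * (D + 1) * (D + 1) + (CT + TE) * 5 ^ (H + 1) * N"
      by linarith
  qed
  then show ?thesis using out(2) by blast
qed

end

section \<open>Elimination forests and cycle covers of the extended graph\<close>

definition level :: "(nat \<times> nat) set \<Rightarrow> nat \<Rightarrow> nat" where
  "level F v = (if v = 0 then 0 else card {u. (v - 1, u) \<in> F\<^sup>*})"

lemma rtrancl_forest_step:
  assumes "single_valued F" "(a, u) \<in> F"
  shows "{x. (a, x) \<in> F\<^sup>*} = insert a {x. (u, x) \<in> F\<^sup>*}"
  using assms by (auto elim: converse_rtranclE dest: single_valuedD intro: converse_rtrancl_into_rtrancl)

lemma finite_forest_ancestors:
  assumes F: "F \<subseteq> {..<n::nat} \<times> {..<n}"
  shows "finite {x. (a, x) \<in> F\<^sup>*}"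
proof -
  have "{x. (a, x) \<in> F\<^sup>*} \<subseteq> insert a {..<n}"
  proof
    fix x assume "x \<in> {x. (a, x) \<in> F\<^sup>*}"
    then have "(a, x) \<in> F\<^sup>*" by simp
    then show "x \<in> insert a {..<n}" by cases (use F in auto)
  qed
  then show ?thesis by (rule finite_subset) simp
qed

lemma rtrancl_no_return:
  assumes "acyclic F" "(a, u) \<in> F" shows "(u, a) \<notin> F\<^sup>*"
  using assms rtrancl_into_trancl2[of a u F a] by (auto simp: acyclic_def)

lemma parent_code_Suc: "single_valued F \<Longrightarrow> (a, u) \<in> F \<Longrightarrow> parent_code F a = Suc u"
  unfolding parent_code_def by (auto dest: single_valuedD intro!: the_equality)

text \<open>Depth is measured by directed paths and \<open>level\<close> by a cardinality. The path
  to the root connects them, as it lists exactly the ancestors.\<close>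

lemma forest_path:
  assumes F: "rooted_forest {..<n::nat} F" and a: "a < n"
  shows "\<exists>p. p \<noteq> [] \<and> hd p = a \<and> set p = {x. (a, x) \<in> F\<^sup>*} \<and> set p \<subseteq> {..<n} \<and> distinct p \<and>
    successively (\<lambda>u v. (u, v) \<in> F) p"
proof -
  have FV: "F \<subseteq> {..<n} \<times> {..<n}" "acyclic F" "single_valued F" using F by (auto simp: rooted_forest_def)
  have "finite F" by (rule finite_subset[OF FV(1)]) simp
  then have "wf (F\<inverse>)" using FV(2) by (rule finite_acyclic_wf_converse)
  then show ?thesis using a
  proof (induction a rule: wf_induct_rule)
    case (less a)
    show ?case
    proof (cases "a \<in> Domain F")
      case False
      then have "{x. (a, x) \<in> F\<^sup>*} = {a}" by (auto elim: converse_rtranclE)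
      then show ?thesis using less.prems by (intro exI[of _ "[a]"]) auto
    next
      case True
      then obtain u where u: "(a, u) \<in> F" by blast
      then obtain p where p: "p \<noteq> []" "hd p = u" "set p = {x. (u, x) \<in> F\<^sup>*}" "set p \<subseteq> {..<n}" "distinct p"
        "successively (\<lambda>u v. (u, v) \<in> F) p"
        using less.IH[of u] FV(1) by blast
      have "set (a # p) = {x. (a, x) \<in> F\<^sup>*}"
        unfolding rtrancl_forest_step[OF FV(3) u] by (simp add: p(3))
      moreover have "distinct (a # p)" using p(3,5) rtrancl_no_return[OF FV(2) u] by simp
      moreover have "successively (\<lambda>u v. (u, v) \<in> F) (a # p)"
        using p(1,2,6) u by (simp add: successively_Cons)
      moreover have "set (a # p) \<subseteq> {..<n}" using p(4) less.prems by simp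
      ultimately show ?thesis by (metis list.sel(1) list.distinct(1))
    qed
  qed
qed

lemma level_le_depth:
  assumes F: "rooted_forest {..<n::nat} F" and a: "a < n"
  shows "card {x. (a, x) \<in> F\<^sup>*} \<le> forest_depth {..<n} F"
proof -
  let ?P = "\<lambda>p::nat list. set p \<subseteq> {..<n} \<and> distinct p \<and> successively (\<lambda>u v. (u, v) \<in> F) p"
  obtain p where p: "set p = {x. (a, x) \<in> F\<^sup>*}" "?P p"
    using forest_path[OF F a] by blast
  have "card {x. (a, x) \<in> F\<^sup>*} = length p" using p by (metis distinct_card)
  moreover have "finite {length p | p. ?P p}"
  proof (rule finite_subset)
    show "{length p | p. ?P p} \<subseteq> {..n}"
    proof
      fix l assume "l \<in> {length p | p. ?P p}"
      then obtain q where q: "l = length q" "set q \<subseteq> {..<n}" "distinct q" by blast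
      then show "l \<in> {..n}" using card_mono[OF _ q(2)] distinct_card[OF q(3)] by simp
    qed
  qed simp
  then have "length p \<le> forest_depth {..<n} F"
    unfolding forest_depth_def using p(2) by (intro Max_ge) auto
  ultimately show ?thesis by simp
qed

lemma forest_rooted_tree:
  assumes F: "rooted_forest {..<n} F"
  shows "rooted_tree n (forest_depth {..<n} F) (\<lambda>c. parent_code F (c - 1)) (level F)"
proof
  have FV: "F \<subseteq> {..<n} \<times> {..<n}" "acyclic F" "single_valued F" using F by (auto simp: rooted_forest_def)
  show "level F 0 = 0" by (simp add: level_def)
  show "level F v \<le> forest_depth {..<n} F" if "v \<le> n" for v
    using level_le_depth[OF F, of "v - 1"] that by (simp add: level_def)
  fix v assume v: "1 \<le> v" "v \<le> n"
  show "parent_code F (v - 1) \<le> n"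
  proof (cases "v - 1 \<in> Domain F")
    case True
    then obtain u where "(v - 1, u) \<in> F" by blast
    then show ?thesis using parent_code_Suc[OF FV(3)] FV(1) by (auto simp: Suc_le_eq)
  qed (simp add: parent_code_def)
  show "level F v = Suc (level F (parent_code F (v - 1)))"
  proof (cases "v - 1 \<in> Domain F")
    case False
    then have "{x. (v - 1, x) \<in> F\<^sup>*} = {v - 1}" by (auto elim: converse_rtranclE)
    then show ?thesis using False v by (simp add: level_def parent_code_def)
  next
    case True
    then obtain u where u: "(v - 1, u) \<in> F" by blast
    have "card {x. (v - 1, x) \<in> F\<^sup>*} = Suc (card {x. (u, x) \<in> F\<^sup>*})"
      unfolding rtrancl_forest_step[OF FV(3) u]
      using finite_forest_ancestors[OF FV(1)] rtrancl_no_return[OF FV(2) u] by simp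
    then show ?thesis using v unfolding parent_code_Suc[OF FV(3) u] by (simp add: level_def)
  qed
qed

lemma forest_ancestors:
  assumes F: "rooted_forest {..<n} F" and "(a, b) \<in> F\<^sup>*" "a < n"
  shows "a = b \<or> Suc b \<in> set (rooted_tree.ancestors (\<lambda>c. parent_code F (c - 1)) (level F) (Suc a))"
  using assms(2,3)
proof (induction rule: converse_rtrancl_induct)
  case (step a c)
  interpret rooted_tree n "forest_depth {..<n} F" "\<lambda>c. parent_code F (c - 1)" "level F"
    by (rule forest_rooted_tree[OF F])
  have FV: "F \<subseteq> {..<n} \<times> {..<n}" "single_valued F" using F by (auto simp: rooted_forest_def)
  have "c < n" using FV(1) step(1) by auto
  then show ?case using step ancestors_Suc[of "Suc a"] parent_code_Suc[OF FV(2) step(1)] by auto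
qed simp

text \<open>The graph on \<open>0, \<dots>, n\<close> in which vertex \<open>v\<close> of the input becomes \<open>Suc v\<close>; the new vertex 0 is
  isolated, or adjacent to all others.\<close>

definition extended :: "nat \<Rightarrow> nat set set \<Rightarrow> bool \<Rightarrow> nat set set" where
  "extended n E universal = image Suc ` E \<union> (if universal then {{0, v} | v. 1 \<le> v \<and> v \<le> n} else {})"

lemma Suc_edge_iff: "{Suc a, Suc b} \<in> extended n E universal \<longleftrightarrow> {a, b} \<in> E"
proof -
  have "{Suc a, Suc b} = Suc ` e \<longleftrightarrow> {a, b} = e" for e
    using inj_image_eq_iff[of Suc "{a, b}" e] by simp
  then have "{Suc a, Suc b} \<in> image Suc ` E \<longleftrightarrow> {a, b} \<in> E" by (auto simp: image_iff)
  then show ?thesis by (auto simp: extended_def doubleton_eq_iff)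
qed

lemma zero_edge_iff: "{0, v} \<in> extended n E universal \<longleftrightarrow> universal \<and> 1 \<le> v \<and> v \<le> n"
  by (auto simp: extended_def doubleton_eq_iff)

section \<open>Cycles of the extended graph\<close>

lemma map_pred_path:
  assumes p: "set p \<subseteq> {..n}" "0 \<notin> set p" "distinct p" "p \<noteq> []"
    "successively (\<lambda>u v. {u, v} \<in> extended n E universal) p"
  obtains q where "p = map Suc q" "simple_path {..<n} E q"
proof -
  let ?q = "map (\<lambda>x. x - 1) p"
  have pos: "Suc (x - 1) = x" if "x \<in> set p" for x using that p(2) by (cases "x = 0") auto
  have "map (Suc \<circ> (\<lambda>x. x - 1)) p = p" by (rule map_idI) (simp add: pos del: One_nat_def)
  then obtain q where q: "p = map Suc q" by (metis map_map)
  have "simple_path {..<n} E q" using p unfolding q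
    by (auto simp: simple_path_def distinct_map successively_map Suc_edge_iff)
  then show ?thesis using that q by blast
qed

lemma rotate_cycle:
  assumes "simple_cycle V E (xs @ ys)" shows "simple_cycle V E (ys @ xs)"
proof (cases "xs = [] \<or> ys = []")
  case False
  then show ?thesis using assms
    by (auto simp: simple_cycle_def simple_path_def successively_append_iff)
qed (use assms in auto)

lemma isolated_cycle_iff:
  "simple_cycle {..n} (extended n E False) p \<longleftrightarrow> (\<exists>q. p = map Suc q \<and> simple_cycle {..<n} E q)"
proof
  assume p: "simple_cycle {..n} (extended n E False) p"
  then have d: "set p \<subseteq> {..n}" "distinct p" "p \<noteq> []" "3 \<le> length p" "{last p, hd p} \<in> extended n E False"
    "successively (\<lambda>u v. {u, v} \<in> extended n E False) p"
    by (auto simp: simple_cycle_def simple_path_def)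
  have "0 \<notin> set p"
  proof
    assume "0 \<in> set p"
    then obtain xs ys where xy: "p = xs @ 0 # ys" by (meson split_list)
    \<comment> \<open>Rotated to the front, the vertex 0 would be followed by a neighbour, but it is
      isolated.\<close>
    then have "simple_cycle {..n} (extended n E False) ((0 # ys) @ xs)" using rotate_cycle[of "{..n}" _ xs "0 # ys"] p by simp
    then obtain y zs where "0 # ys @ xs = 0 # y # zs" "{0, y} \<in> extended n E False"
      by (cases "ys @ xs") (auto simp: simple_cycle_def simple_path_def)
    then show False by (simp add: zero_edge_iff)
  qed
  then obtain q where q: "p = map Suc q" "simple_path {..<n} E q" using map_pred_path d by metis
  then have "{last q, hd q} \<in> E" using d(3,5) by (simp add: last_map hd_map Suc_edge_iff)
  then show "\<exists>q. p = map Suc q \<and> simple_cycle {..<n} E q" using q d(4) by (auto simp: simple_cycle_def)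
next
  assume "\<exists>q. p = map Suc q \<and> simple_cycle {..<n} E q"
  then obtain q where q: "p = map Suc q" "simple_cycle {..<n} E q" by blast
  then have "x < n" if "x \<in> set q" for x using that by (auto simp: simple_cycle_def simple_path_def)
  then show "simple_cycle {..n} (extended n E False) p"
    using q by (auto simp: simple_cycle_def simple_path_def distinct_map successively_map Suc_edge_iff
        last_map hd_map Suc_le_eq)
qed

lemma path_imp_cycle:
  assumes q: "simple_path {..<n} E q" "2 \<le> length q"
  shows "simple_cycle {..n} (extended n E True) (0 # map Suc q)"
proof -
  have "hd q \<in> set q" "last q \<in> set q" "set q \<subseteq> {..<n}" "q \<noteq> []" using q by (auto simp: simple_path_def)
  then have "hd q \<in> {..<n}" "last q \<in> {..<n}" by blast+
  then have "hd q < n" "last q < n" by simp_all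
  then show ?thesis
    using q by (auto simp: simple_cycle_def simple_path_def distinct_map successively_map Suc_edge_iff
        last_map hd_map successively_Cons zero_edge_iff insert_commute[of _ 0])
qed

text \<open>Deleting 0, or any vertex if 0 is absent, opens the cycle to a path of the input graph
  with one vertex less. Hence cycles need not be forced through 0.\<close>

lemma cycle_imp_path:
  assumes p: "simple_cycle {..n} (extended n E True) p"
  shows "\<exists>q. simple_path {..<n} E q \<and> length p = length q + 1"
proof -
  have "\<exists>x xs. simple_cycle {..n} (extended n E True) (x # xs) \<and> 0 \<notin> set xs \<and> length p = length xs + 1"
  proof (cases "0 \<in> set p")
    case True
    then obtain xs ys where xy: "p = xs @ 0 # ys" by (meson split_list)
    then have c: "simple_cycle {..n} (extended n E True) ((0 # ys) @ xs)" using rotate_cycle[of "{..n}" _ xs "0 # ys"] p by simp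
    then have "0 \<notin> set (ys @ xs)" by (auto simp: simple_cycle_def simple_path_def)
    then show ?thesis using c xy by (intro exI[of _ 0] exI[of _ "ys @ xs"]) auto
  next
    case False
    obtain x xs where "p = x # xs" using p by (cases p) (auto simp: simple_cycle_def simple_path_def)
    then show ?thesis using p False by (intro exI[of _ x] exI[of _ xs]) simp
  qed
  then obtain x xs where x: "simple_cycle {..n} (extended n E True) (x # xs)" "0 \<notin> set xs" "length p = length xs + 1" by blast
  then have d: "set xs \<subseteq> {..n}" "distinct xs" "xs \<noteq> []" "successively (\<lambda>u v. {u, v} \<in> extended n E True) xs"
    by (auto simp: simple_cycle_def simple_path_def successively_Cons)
  obtain q where "xs = map Suc q" "simple_path {..<n} E q" using map_pred_path[OF d(1) x(2) d(2-4)] by blast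
  then show ?thesis using x(3) by auto
qed

text \<open>The common target of all five problems, in the form that matches the existence of a good
  pair; \<open>m \<le> s\<close> reflects that marks are covered vertices.\<close>

definition cycle_cover_of_size :: "'a set \<Rightarrow> 'a set set \<Rightarrow> nat \<Rightarrow> nat \<Rightarrow> bool" where
  "cycle_cover_of_size V E s m \<longleftrightarrow> (\<exists>C. finite C \<and> card C \<le> m \<and> m \<le> s \<and> (\<forall>p\<in>C. simple_cycle V E p) \<and>
    pairwise (\<lambda>p q. disjnt (set p) (set q)) C \<and> card (\<Union>p\<in>C. set p) = s)"

lemma cycle_cover_one:
  "cycle_cover_of_size V E s 1 \<longleftrightarrow> (\<exists>p. simple_cycle V E p \<and> length p = s)"
proof
  assume "cycle_cover_of_size V E s 1"
  then obtain C where C: "finite C" "card C \<le> 1" "1 \<le> s" "\<forall>p\<in>C. simple_cycle V E p" "card (\<Union>p\<in>C. set p) = s"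
    by (auto simp: cycle_cover_of_size_def)
  then have "C \<noteq> {}" by auto
  then have "card C = 1" using C(1,2) using card_0_eq[of C] \<open>C \<noteq> {}\<close> by linarith
  then obtain p where "C = {p}" by (auto simp: card_1_singleton_iff)
  then show "\<exists>p. simple_cycle V E p \<and> length p = s"
    using C(4,5) by (auto simp: simple_cycle_def simple_path_def distinct_card)
next
  assume "\<exists>p. simple_cycle V E p \<and> length p = s"
  then obtain p where p: "simple_cycle V E p" "length p = s" by blast
  then have "card (set p) = s" "1 \<le> s" by (auto simp: simple_cycle_def simple_path_def distinct_card)
  then show "cycle_cover_of_size V E s 1"
    unfolding cycle_cover_of_size_def using p(1) by (intro exI[of _ "{p}"]) auto
qed

lemma simple_path_length: "simple_path {..<n::nat} E p \<Longrightarrow> length p \<le> n"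
  using card_mono[of "{..<n}" "set p"] by (auto simp: simple_path_def distinct_card)

lemma hamiltonian_cycle_cover:
  "hamiltonian_cycle {..<n} E k \<longleftrightarrow> cycle_cover_of_size {..n} (extended n E False) n 1"
proof -
  have "set q = {..<n} \<longleftrightarrow> length q = n" if "simple_cycle {..<n} E q" for q
  proof -
    have q: "set q \<subseteq> {..<n}" "distinct q" using that by (auto simp: simple_cycle_def simple_path_def)
    then show ?thesis using card_subset_eq[of "{..<n}" "set q"] distinct_card[OF q(2)] by (auto dest: sym)
  qed
  moreover have "(\<exists>p. (\<exists>q. p = map Suc q \<and> simple_cycle {..<n} E q) \<and> length p = n) \<longleftrightarrow>
      (\<exists>q. simple_cycle {..<n} E q \<and> length q = n)"
    by (metis length_map)
  ultimately show ?thesis unfolding cycle_cover_one hamiltonian_cycle_def isolated_cycle_iff by blast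
qed

text \<open>A number \<open>k > n\<close> may exceed all polynomials in \<open>n\<close>, so it is replaced by the unattainable size \<open>n + 1\<close>.\<close>

lemma k_cycle_cover:
  "k_cycle {..<n} E k \<longleftrightarrow> cycle_cover_of_size {..n} (extended n E False) (if n < k then n + 1 else k) 1"
proof -
  have "length q \<le> n" if "simple_cycle {..<n} E q" for q
    using that simple_path_length by (auto simp: simple_cycle_def)
  then show ?thesis unfolding cycle_cover_one k_cycle_def isolated_cycle_iff
    by (cases "n < k") (force, auto)
qed

lemma path_cover:
  "cycle_cover_of_size {..n} (extended n E True) s 1 \<longleftrightarrow> 3 \<le> s \<and> (\<exists>q. simple_path {..<n} E q \<and> length q + 1 = s)"
proof
  assume "cycle_cover_of_size {..n} (extended n E True) s 1"
  then obtain p where p: "simple_cycle {..n} (extended n E True) p" "length p = s"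
    unfolding cycle_cover_one by blast
  then show "3 \<le> s \<and> (\<exists>q. simple_path {..<n} E q \<and> length q + 1 = s)"
    using cycle_imp_path[OF p(1)] by (auto simp: simple_cycle_def)
next
  assume "3 \<le> s \<and> (\<exists>q. simple_path {..<n} E q \<and> length q + 1 = s)"
  then obtain q where q: "3 \<le> s" "simple_path {..<n} E q" "length q + 1 = s" by blast
  then have "simple_cycle {..n} (extended n E True) (0 # map Suc q)" by (intro path_imp_cycle) auto
  then show "cycle_cover_of_size {..n} (extended n E True) s 1"
    unfolding cycle_cover_one using q(3) by (intro exI[of _ "0 # map Suc q"]) simp
qed

text \<open>A path with a single vertex would close to a cycle of length 2, hence the special case.\<close>

lemma hamiltonian_path_cover:
  "hamiltonian_path {..<n} E k \<longleftrightarrow> n = 1 \<or> cycle_cover_of_size {..n} (extended n E True) (n + 1) 1"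
proof -
  have *: "set q = {..<n} \<longleftrightarrow> length q = n" if "simple_path {..<n} E q" for q
  proof -
    have q: "set q \<subseteq> {..<n}" "distinct q" using that by (auto simp: simple_path_def)
    then show ?thesis using card_subset_eq[of "{..<n}" "set q"] distinct_card[OF q(2)] by (auto dest: sym)
  qed
  have one: "hamiltonian_path {..<n} E k" if "n = 1"
    using that unfolding hamiltonian_path_def by (intro exI[of _ "[0]"]) (auto simp: simple_path_def)
  have 0: "\<not> hamiltonian_path {..<n} E k" if "n = 0"
    using that unfolding hamiltonian_path_def by (auto simp: simple_path_def)
  consider "n = 0" | "n = 1" | "2 \<le> n" by linarith
  then show ?thesis
  proof cases
    case 1
    then show ?thesis using 0 unfolding path_cover by simp
  next
    case 2
    then show ?thesis using one by simp
  next
    case 3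
    then show ?thesis using * unfolding path_cover hamiltonian_path_def by auto
  qed
qed

text \<open>For \<open>k = 0\<close> the requested size 1 is below the length 3 of a cycle, and for
  \<open>k > n\<close> the size \<open>n + 2\<close> exceeds the number of vertices; both give the
  answer no. A single vertex closes to no cycle and is treated separately.\<close>

lemma k_path_cover:
  "k_path {..<n} E k \<longleftrightarrow> k = 1 \<and> n \<noteq> 0 \<or> cycle_cover_of_size {..n} (extended n E True) (if n < k then n + 2 else k + 1) 1"
proof -
  have len: "length q \<le> n" "0 < length q" if "simple_path {..<n} E q" for q
    using that simple_path_length[OF that] by (auto simp: simple_path_def)
  have one: "k_path {..<n} E k" if "k = 1" "n \<noteq> 0"
    using that unfolding k_path_def by (intro exI[of _ "[0]"]) (auto simp: simple_path_def)
  consider "k = 1" | "k = 0" | "2 \<le> k" "n < k" | "2 \<le> k" "k \<le> n" by linarith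
  then show ?thesis
  proof cases
    case 1
    then show ?thesis using one len unfolding path_cover k_path_def by (cases "n = 0") force+
  next
    case 2
    then show ?thesis using len unfolding path_cover k_path_def by force
  next
    case 3
    then show ?thesis using len unfolding path_cover k_path_def by force
  next
    case 4
    then show ?thesis unfolding path_cover k_path_def by auto
  qed
qed

lemma card_disjoint_cycles:
  assumes "finite C" "\<forall>p\<in>C. simple_cycle V E p" "pairwise (\<lambda>p q. disjnt (set p) (set q)) C"
  shows "card C \<le> card (\<Union>p\<in>C. set p)"
proof -
  have "card (\<Union>p\<in>C. set p) = (\<Sum>p\<in>C. card (set p))"
    using assms(1,3) by (intro card_UN_disjoint) (auto simp: pairwise_def disjnt_def)
  moreover have "1 \<le> card (set p)" if "p \<in> C" for p
    using that assms(2) by (auto simp: simple_cycle_def simple_path_def distinct_card)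
  then have "(\<Sum>p\<in>C. 1) \<le> (\<Sum>p\<in>C. card (set p))" by (intro sum_mono)
  ultimately show ?thesis by simp
qed

text \<open>Disjoint cycles are nonempty, so there are never more than \<open>n\<close>; capping
  \<open>k\<close> at \<open>n\<close> changes nothing and keeps the number of marks within the
  covered vertices.\<close>

lemma min_cycle_cover_cover:
  "min_cycle_cover {..<n} E k \<longleftrightarrow> cycle_cover_of_size {..n} (extended n E False) n (if n < k then n else k)"
proof
  assume "min_cycle_cover {..<n} E k"
  then obtain C where C: "finite C" "card C \<le> k" "\<forall>p\<in>C. simple_cycle {..<n} E p"
    "pairwise (\<lambda>p q. disjnt (set p) (set q)) C" "(\<Union>p\<in>C. set p) = {..<n}"
    by (auto simp: min_cycle_cover_def)
  have "card C \<le> n" using card_disjoint_cycles[OF C(1,3,4)] C(5) by simp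
  moreover have "card (map Suc ` C) \<le> card C" using C(1) by (rule card_image_le)
  moreover have "(\<Union>p\<in>map Suc ` C. set p) = Suc ` (\<Union>p\<in>C. set p)" by auto
  then have "(\<Union>p\<in>map Suc ` C. set p) = Suc ` {..<n}" by (simp only: C(5))
  then have "card (\<Union>p\<in>map Suc ` C. set p) = n" by (simp add: card_image)
  moreover have "pairwise (\<lambda>p q. disjnt (set p) (set q)) (map Suc ` C)"
    using C(4) by (auto simp: pairwise_def disjnt_def)
  moreover have "\<forall>p\<in>map Suc ` C. simple_cycle {..n} (extended n E False) p"
    using C(3) isolated_cycle_iff by blast
  ultimately show "cycle_cover_of_size {..n} (extended n E False) n (if n < k then n else k)"
    unfolding cycle_cover_of_size_def using C(1,2) by (intro exI[of _ "map Suc ` C"]) auto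
next
  assume "cycle_cover_of_size {..n} (extended n E False) n (if n < k then n else k)"
  then obtain C where C: "finite C" "card C \<le> (if n < k then n else k)"
    "\<forall>p\<in>C. simple_cycle {..n} (extended n E False) p"
    "pairwise (\<lambda>p q. disjnt (set p) (set q)) C" "card (\<Union>p\<in>C. set p) = n"
    unfolding cycle_cover_of_size_def by blast
  have "\<forall>p\<in>C. \<exists>q. p = map Suc q \<and> simple_cycle {..<n} E q" using C(3) by (simp add: isolated_cycle_iff)
  then obtain f where f: "\<And>p. p \<in> C \<Longrightarrow> p = map Suc (f p)" "\<And>p. p \<in> C \<Longrightarrow> simple_cycle {..<n} E (f p)"
    by metis
  have sf: "set p = Suc ` set (f p)" if "p \<in> C" for p using f(1)[OF that] by (metis list.set_map)
  then have U: "(\<Union>p\<in>C. set p) = Suc ` (\<Union>p\<in>f ` C. set p)" by auto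
  have "disjnt (set (f x)) (set (f y))" if "x \<in> C" "y \<in> C" "x \<noteq> y" for x y
    using pairwiseD[OF C(4) that] sf[OF that(1)] sf[OF that(2)] by (auto simp: disjnt_def simp flip: image_Int)
  then have d: "pairwise (\<lambda>p q. disjnt (set p) (set q)) (f ` C)" by (force simp: pairwise_def)
  have "(\<Union>p\<in>f ` C. set p) \<subseteq> {..<n}" using f(2) by (auto simp: simple_cycle_def simple_path_def)
  moreover have "card (\<Union>p\<in>f ` C. set p) = n" using C(5) unfolding U by (simp add: card_image)
  ultimately have "(\<Union>p\<in>f ` C. set p) = {..<n}" by (intro card_subset_eq) auto
  moreover have "card (f ` C) \<le> k" using C(2) card_image_le[OF C(1), of f] by (auto split: if_splits)
  ultimately show "min_cycle_cover {..<n} E k"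
    unfolding min_cycle_cover_def using C(1) f(2) d by (intro exI[of _ "f ` C"]) auto
qed

section \<open>Resource bounds\<close>

text \<open>\<open>dbound n\<close> bounds \<open>\<beta> R\<^sup>5\<close>, as \<open>\<beta> = N\<^sup>2 + 4 N\<close> and \<open>R \<le> 8 N\<^sup>4\<close> with \<open>N = n + 1\<close>. The bounds are stated over
  semirings in order to be evaluated at the indeterminate of a polynomial as well.\<close>

definition dbound :: "'a \<Rightarrow> 'a::comm_semiring_1" where
  "dbound x = ((x + 1) * (x + 1) + 4 * (x + 1)) * (8 * ((x + 1) * (x + 1) * ((x + 1) * (x + 1)))) ^ 5"

definition tbound :: "'a \<Rightarrow> 'a::comm_semiring_1" where
  "tbound x = 30 + 200 * (dbound x + 1) * (dbound x + 1) +
     (2 * (x + 1) * (40 * dbound x + 200) + 20 * (x + 1) + 80) * 5 * (x + 1)"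

definition sbound :: "'a \<Rightarrow> 'a::comm_semiring_1" where
  "sbound x = 40 * (10 + (dbound x + 3 + x)) + dbound x * (dbound x + (dbound x + 3 + x))"

lemma poly_dbound: "poly (dbound [:0, 1:]) x = dbound x" by (simp add: dbound_def mult.commute)
lemma poly_tbound: "poly (tbound [:0, 1:]) x = tbound x" by (simp only: tbound_def poly_add poly_mult poly_numeral poly_1 poly_pCons poly_0 poly_dbound
      mult_zero_right add_0_right add_0_left mult_1_right)
lemma poly_sbound: "poly (sbound [:0, 1:]) x = sbound x" by (simp add: sbound_def poly_dbound mult.commute)

lemma dbound_mono: "x \<le> y \<Longrightarrow> dbound x \<le> dbound y" for x y :: nat
  unfolding dbound_def by (intro mult_mono add_mono power_mono) auto

section \<open>The parameters for a given input\<close>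

locale forest_input =
  fixes n k :: nat and E :: "nat set set" and F :: "(nat \<times> nat) set"
  assumes G: "simple_graph {..<n} E" and F: "elimination_forest {..<n} E F"
begin

lemma forest: "rooted_forest {..<n} F" using F by (simp add: elimination_forest_def)

definition H :: nat where "H = forest_depth {..<n} F"
definition par :: "nat \<Rightarrow> nat" where "par c = parent_code F (c - 1)"
definition adj :: "nat \<Rightarrow> nat \<Rightarrow> bool" where "adj a b \<longleftrightarrow> {a, b} \<in> E"
definition N :: nat where "N = n + 1"
definition b :: nat where "b = (LEAST b. 4 * (N * N) \<le> 2 ^ b)"
definition R :: nat where "R = N * N * 2 ^ b"
definition \<beta> :: nat where "\<beta> = N * N + 4 * N"
definition D :: nat where "D = \<beta> * R ^ 5"
text \<open>The last summand makes room for the input \<open>k\<close>, which may be far larger than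
  \<open>2 ^ D\<close>.\<close>

definition B :: nat where "B = 2 ^ (D + 2 + floorlog 2 k)"
definition A :: nat where "A = n + n * n + N * N * b + N + N + N"

lemma tree: "rooted_tree n H par (level F)"
  using forest_rooted_tree[OF forest] by (simp add: H_def par_def[abs_def])

lemma b_ge: "4 * (N * N) \<le> 2 ^ b"
  unfolding b_def by (rule LeastI[of _ "4 * (N * N)"]) (simp add: less_imp_le)

lemma b_less: "i < b \<Longrightarrow> 2 ^ i < 4 * (N * N)"
  unfolding b_def using not_less_Least by force

lemma N1: "1 \<le> N" by (simp add: N_def)

lemma b_le: "2 ^ b \<le> 8 * (N * N)"
proof (cases b)
  case 0
  then show ?thesis using N1 by (simp add: Suc_le_eq)
next
  case (Suc i)
  then show ?thesis using b_less[of i] by simp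
qed

lemma R_bounds: "4 * (N * N * (N * N)) \<le> R" "R \<le> 8 * (N * N * (N * N))"
  using mult_le_mono2[OF b_ge, of "N * N"] mult_le_mono2[OF b_le, of "N * N"] by (simp_all add: R_def ac_simps)

lemma NN: "N \<le> N * N" "1 \<le> N * N" "N * N \<le> N * N * (N * N)"
  using N1 by simp_all

lemma R_ge: "4 \<le> R" "n + 2 < R" "N * N \<le> R" "2 ^ b \<le> R"
proof -
  show "N * N \<le> R" "4 \<le> R" using R_bounds(1) NN by linarith+
  show "n + 2 < R" using R_bounds(1) NN N_def by linarith
  show "2 ^ b \<le> R" using NN(2) by (simp add: R_def)
qed

lemma A_le: "A \<le> D"
proof -
  have "n * n \<le> N * N" by (simp add: N_def)
  moreover have "N * N * b \<le> R" unfolding R_def by (intro mult_le_mono2) (simp add: less_imp_le)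
  ultimately have "A \<le> \<beta> + R" unfolding A_def \<beta>_def using N_def by linarith
  also have "\<dots> \<le> \<beta> * R"
  proof -
    have "2 \<le> \<beta>" "2 \<le> R" using N1 R_ge(1) by (simp_all add: \<beta>_def)
    then obtain x y where "\<beta> = 2 + x" "R = 2 + y" by (meson le_Suc_ex)
    then show ?thesis by (simp add: algebra_simps)
  qed
  also have "\<dots> \<le> D"
    unfolding D_def using power_increasing[of 1 5 R] R_ge(1) by (intro mult_le_mono2) simp
  finally show ?thesis .
qed

lemma D_le: "D \<le> dbound n"
  unfolding D_def \<beta>_def dbound_def N_def[symmetric]
  by (intro mult_le_mono2 power_mono R_bounds(2)) simp

lemma machine: "machine n H par (level F) b R \<beta> B (parent_code F)"
proof -
  interpret rooted_tree n H par "level F" by (rule tree)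
  show ?thesis
  proof
    show "n + n * n + (n + 1) * (n + 1) * b + (n + 1) + (n + 1) + (n + 1) \<le> \<beta> * R ^ 5"
      using A_le unfolding A_def D_def N_def .
    show "2 ^ (\<beta> * R ^ 5 + 2) \<le> B" unfolding B_def D_def by (intro power_increasing) simp_all
  qed (use R_ge in \<open>simp_all add: N_def \<beta>_def par_def\<close>)
qed

abbreviation arcs :: "nat \<Rightarrow> (nat \<times> nat) set" where "arcs pf \<equiv> machine.EA n par (level F) pf adj"

lemma arcs_iff:
  "(u, v) \<in> arcs pf \<longleftrightarrow> v \<le> n \<and> u \<in> set (rooted_tree.ancestors par (level F) v) \<and>
     (if u = 0 then pf \<noteq> 0 else adj (u - 1) (v - 1))"
  by (simp add: machine.EA_def[OF machine] machine.adjacent_def[OF machine])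

lemma arcs_le: "(u, v) \<in> arcs pf \<Longrightarrow> u \<le> n \<and> v \<le> n \<and> level F u < level F v"
  using rooted_tree.ancestors_lvl[OF tree] by (auto simp: arcs_iff)

lemma arcs_anti: "(u, v) \<in> arcs pf \<Longrightarrow> (v, u) \<notin> arcs pf"
  using arcs_le by (meson less_asym)

lemma cut_count_arcs: "cut_count {..n} (arcs pf)"
  using arcs_le by unfold_locales (auto, fastforce)

lemma Suc_arcs: "(a, c) \<in> F\<^sup>* \<Longrightarrow> {c, a} \<in> E \<Longrightarrow> a < n \<Longrightarrow> a \<noteq> c \<Longrightarrow> (Suc c, Suc a) \<in> arcs pf"
  using forest_ancestors[OF forest, of a c, folded par_def[abs_def]] by (auto simp: arcs_iff adj_def insert_commute)

text \<open>Here the elimination property enters: the ends of every edge are comparable in the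
  forest, so listing the pairs of a vertex and an adjacent ancestor loses no edge.\<close>

lemma edges_eq: "cut_count.edges (arcs pf) = extended n E (pf \<noteq> 0)"
proof -
  interpret rooted_tree n H par "level F" by (rule tree)
  have edge: "{u, v} \<in> extended n E (pf \<noteq> 0)" if uv: "(u, v) \<in> arcs pf" for u v
  proof -
    have v: "v \<noteq> 0" "v \<le> n" using uv by (auto simp: arcs_iff intro: gr0I)
    show ?thesis
    proof (cases u)
      case 0
      then show ?thesis using uv v by (simp add: zero_edge_iff arcs_iff)
    next
      case (Suc a)
      moreover obtain c where "v = Suc c" using v(1) not0_implies_Suc by blast
      ultimately show ?thesis using uv by (simp add: Suc_edge_iff arcs_iff adj_def)
    qed
  qed
  have arc: "\<exists>u v. e = {u, v} \<and> (u, v) \<in> arcs pf" if e: "e \<in> extended n E (pf \<noteq> 0)" for e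
  proof -
    consider e' where "e' \<in> E" "e = Suc ` e'" | v where "e = {0, v}" "1 \<le> v" "v \<le> n" "pf \<noteq> 0"
      using e by (auto simp: extended_def split: if_splits)
    then show ?thesis
    proof cases
      case 1
      then have "e' \<subseteq> {..<n}" "card e' = 2" using G by (auto simp: simple_graph_def)
      then obtain a c where ac: "e' = {a, c}" "a \<noteq> c" "a < n" "c < n" by (auto simp: card_2_iff)
      have "(a, c) \<in> F\<^sup>* \<or> (c, a) \<in> F\<^sup>*" using F 1(1) ac(1) by (auto simp: elimination_forest_def ancestor_def)
      then have "(Suc c, Suc a) \<in> arcs pf \<or> (Suc a, Suc c) \<in> arcs pf"
        using Suc_arcs[of a c pf] Suc_arcs[of c a pf] 1(1) ac by (auto simp: insert_commute)
      moreover have "e = {Suc a, Suc c}" "e = {Suc c, Suc a}" using 1(2) ac(1) by auto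
      ultimately show ?thesis by blast
    next
      case 2
      then have "(0, v) \<in> arcs pf" using root_ancestor[of v] by (simp add: arcs_iff)
      then show ?thesis using 2(1) by blast
    qed
  qed
  show ?thesis unfolding cut_count.edges_def[OF cut_count_arcs] using edge arc by (force simp: image_iff)
qed

lemma good_iff:
  "cut_count.good (arcs pf) s m \<noteq> {} \<longleftrightarrow> cycle_cover_of_size {..n} (extended n E (pf \<noteq> 0)) s m"
proof
  assume "cut_count.good (arcs pf) s m \<noteq> {}"
  then obtain X M where "(X, M) \<in> cut_count.good (arcs pf) s m" by auto
  from cut_count.good_imp_cycles[OF cut_count_arcs arcs_anti this]
  show "cycle_cover_of_size {..n} (extended n E (pf \<noteq> 0)) s m"
    unfolding cycle_cover_of_size_def edges_eq .
next
  assume "cycle_cover_of_size {..n} (extended n E (pf \<noteq> 0)) s m"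
  then obtain C where "finite C" "card C \<le> m" "m \<le> s" "\<forall>p\<in>C. simple_cycle {..n} (cut_count.edges (arcs pf)) p"
    "pairwise (\<lambda>p q. disjnt (set p) (set q)) C" "card (\<Union>p\<in>C. set p) = s"
    unfolding cycle_cover_of_size_def edges_eq by blast
  then show "cut_count.good (arcs pf) s m \<noteq> {}"
    by (intro cut_count.cycles_imp_good[OF cut_count_arcs arcs_anti]) auto
qed

lemma D_less_B: "x \<le> D \<Longrightarrow> x < B"
  using machine.D_less_B[OF machine] by (simp add: D_def)

lemma small_less_B: "n + 2 < B" "k < B"
proof -
  have "R \<le> D" unfolding D_def using power_increasing[of 1 5 R] R_ge(1) N1
    by (intro order_trans[OF _ mult_le_mono1[of 1 \<beta>]]) (simp_all add: \<beta>_def)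
  then show "n + 2 < B" using R_ge(2) by (intro D_less_B) simp
  have "k < 2 ^ floorlog 2 k" by (rule floorlog_leD) simp_all
  also have "\<dots> \<le> B" unfolding B_def by (intro power_increasing) simp_all
  finally show "k < B" .
qed

lemma fits_input: "fits A B (input_state n E F k)"
proof -
  interpret rooted_tree n H par "level F" by (rule tree)
  have "parent_code F a < B" if "a < n" for a
    using par_le[of "Suc a"] that small_less_B(1) by (simp add: par_def)
  then show ?thesis using small_less_B by (auto simp: fits_def input_state_def A_def)
qed

lemma time_bound:
  assumes "btime D pre \<le> 30"
  shows "btime D pre + 200 * (D + 1) * (D + 1) + (machine.CT n R \<beta> + machine.TE n R \<beta>) * 5 ^ (H + 1) * (n + 1)
    \<le> 5 ^ H * tbound n"
proof -
  let ?C = "\<lambda>d. 2 * (n + 1) * (40 * d + 200) + 20 * (n + 1) + 80"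
  have C: "machine.CT n R \<beta> + machine.TE n R \<beta> = ?C D"
    unfolding machine.CT_def[OF machine] machine.TE_def[OF machine] machine.TL_def[OF machine] D_def[symmetric] by simp
  have "btime D pre + 200 * (D + 1) * (D + 1) + (machine.CT n R \<beta> + machine.TE n R \<beta>) * 5 ^ (H + 1) * (n + 1)
      = 1 * (btime D pre + 200 * (D + 1) * (D + 1)) + 5 ^ H * (?C D * 5 * (n + 1))"
    unfolding C by (simp only: power_add power_one_right mult_1 ac_simps)
  also have "\<dots> \<le> 5 ^ H * (30 + 200 * (D + 1) * (D + 1)) + 5 ^ H * (?C D * 5 * (n + 1))"
    using assms by (intro add_mono mult_mono) auto
  also have "\<dots> = 5 ^ H * (30 + 200 * (D + 1) * (D + 1) + ?C D * 5 * (n + 1))" by (simp only: distrib_left)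
  also have "\<dots> \<le> 5 ^ H * tbound n"
    unfolding tbound_def using D_le by (intro mult_mono add_mono) auto
  finally show ?thesis .
qed

lemma space_bound:
  assumes "fits A B s" shows "space_of s \<le> sbound (n + floorlog 2 k)"
proof -
  let ?x = "n + floorlog 2 k"
  have d: "D \<le> dbound ?x" using D_le dbound_mono[of n ?x] by simp
  have "floorlog 2 B \<le> D + 3 + floorlog 2 k"
    unfolding B_def by (rule floorlog_leI[OF power_strict_increasing]) simp_all
  then have B: "floorlog 2 B \<le> dbound ?x + 3 + ?x" using d by simp
  have A: "A \<le> dbound ?x" using A_le d by simp
  have "floorlog 2 A \<le> A" by (rule floorlog_leI) simp_all
  moreover have "floorlog 2 40 \<le> 10" by (rule floorlog_leI) simp_all
  ultimately show ?thesis
    using B A by (intro order_trans[OF fits_space[OF assms]]) (unfold sbound_def, intro add_mono mult_mono, auto)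
qed

text \<open>The preamble \<open>pre\<close> translates the problem into cover parameters and settles
  special cases through \<open>ans\<close>, independently of the coins. If a cover exists, isolation
  bounds the probability that all weight classes are even.\<close>

lemma program_decides:
  assumes pre: "\<And>A D. wp A B D pre (\<lambda>s. \<exists>g. s = (g, snd (input_state n E F k)) \<and>
      g 0 = n \<and> g 2 = pf \<and> g 3 = ks \<and> g 4 = mk \<and> g 5 = ans) (input_state n E F k)"
    and small: "ks \<le> n + 2" "mk \<le> n + 2" "\<And>D. btime D pre \<le> 30"
    and yes: "yes \<longleftrightarrow> ans \<noteq> 0 \<or> cycle_cover_of_size {..n} (extended n E (pf \<noteq> 0)) ks mk"
  shows "decides_one_sided (program pre) (input_state n E F k) yes
    (5 ^ forest_depth {..<n} F * tbound n) (sbound (n + floorlog 2 k))"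
proof -
  let ?s0 = "input_state n E F k" and ?Pi = "Pi_pmf {..<N * N * b} False (\<lambda>_. bernoulli_pmf (1 / 2))"
  let ?good = "cut_count.good (arcs pf) ks mk"
  let ?odd = "\<lambda>g. \<exists>a. odd (card {Y \<in> ?good. cut_count.weight (machine.wts n b g) Y = a})"
  have "snd ?s0 v = parent_code F v" if "v < n" for v using that by (simp add: input_state_def)
  moreover have "snd ?s0 (n + u * n + v) = of_bool (adj u v)" if "u < n" "v < n" for u v
  proof -
    have "u * n + v < Suc u * n" using that by simp
    also have "\<dots> \<le> n * n" using that by (intro mult_le_mono1) simp
    finally show ?thesis using that by (simp add: input_state_def adj_def)
  qed
  ultimately obtain out where out: "halts_as (fits A B) (program pre, ?s0)
      (btime D pre + 200 * (D + 1) * (D + 1) + (machine.CT n R \<beta> + machine.TE n R \<beta>) * 5 ^ (H + 1) * (n + 1)) (map_pmf out ?Pi)"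
    "\<forall>g. fst (out g) 0 \<noteq> 0 \<longleftrightarrow> ans \<noteq> 0 \<or> ?odd g"
    using machine.program_halts[OF machine, folded N_def, folded A_def D_def, of ks mk ?s0 pre "snd ?s0" pf ans adj]
      R_def b_ge b_less \<beta>_def small(1,2) R_ge(2) fits_input pre unfolding N_def by auto
  let ?T = "5 ^ forest_depth {..<n} F * tbound n"
  have halts: "halts_as (fits A B) (program pre, ?s0) ?T (map_pmf out ?Pi)"
    using halts_as_mono[OF out(1) time_bound[OF small(3)]] by (simp add: H_def)
  then have run: "run (program pre) ?s0 ?T = map_pmf (\<lambda>g. (Skip, out g)) ?Pi"
    by (simp add: halts_as_def map_pmf_comp)
  have ans_iff: "answers_yes (Skip, out g) \<longleftrightarrow> ans \<noteq> 0 \<or> ?odd g" for g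
    using out(2) by (simp add: answers_yes_def)
  show ?thesis
    unfolding decides_one_sided_def
  proof (intro conjI allI ballI impI)
    fix cs assume "cs \<in> set_pmf (run (program pre) ?s0 ?T)"
    then show "fst cs = Skip" unfolding run by auto
  next
    fix t cs assume "cs \<in> set_pmf (run (program pre) ?s0 t)"
    then show "space_of (snd cs) \<le> sbound (n + floorlog 2 k)"
      using halts space_bound unfolding halts_as_def by simp
  next
    assume "yes"
    have "measure_pmf.prob (run (program pre) ?s0 ?T) {cs. \<not> answers_yes cs} =
        measure_pmf.prob ?Pi {g. \<not> (ans \<noteq> 0 \<or> ?odd g)}"
      unfolding run measure_map_pmf vimage_def mem_Collect_eq ans_iff ..
    also have "\<dots> \<le> 1 / 2"
    proof (cases "ans = 0")
      case True
      then have "?good \<noteq> {}" using \<open>yes\<close> yes good_iff by blast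
      then show ?thesis
        using machine.good_isolation[OF machine, folded N_def, of pf adj ks mk] b_ge True by simp
    qed simp
    finally show "measure_pmf.prob (run (program pre) ?s0 ?T) {cs. \<not> answers_yes cs} \<le> 1 / 2" .
  next
    fix cs assume "\<not> yes" and cs: "cs \<in> set_pmf (run (program pre) ?s0 ?T)"
    \<comment> \<open>Without a cover every weight class is empty, hence even for all coin tosses:
      there are no false positives.\<close>
    then have "?good = {}" "ans = 0" using yes good_iff by blast+
    then have "\<not> answers_yes (Skip, out g)" for g unfolding ans_iff by simp
    then show "\<not> answers_yes cs" using cs unfolding run by auto
  qed
qed

lemma hamiltonian_cycle_decides:
  "decides_one_sided (program (Set 3 (Reg 0) ;; Set 4 (Const 1))) (input_state n E F k)
    (hamiltonian_cycle {..<n} E k) (5 ^ forest_depth {..<n} F * tbound n) (sbound (n + floorlog 2 k))"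
  by (rule program_decides[where pf = 0 and ks = n and mk = 1 and ans = 0])
    (use small_less_B in \<open>simp_all add: hamiltonian_cycle_cover input_state_def\<close>)

lemma hamiltonian_path_decides:
  "decides_one_sided (program (Set 2 (Const 1) ;; Set 3 (Add (Reg 0) (Const 1)) ;; Set 4 (Const 1) ;;
      If (absd (Reg 0) (Const 1)) Nop (Set 5 (Const 1)))) (input_state n E F k)
    (hamiltonian_path {..<n} E k) (5 ^ forest_depth {..<n} F * tbound n) (sbound (n + floorlog 2 k))"
  by (rule program_decides[where pf = 1 and ks = "n + 1" and mk = 1 and ans = "of_bool (n = 1)"])
    (use small_less_B in \<open>auto simp: hamiltonian_path_cover input_state_def\<close>)

lemma k_cycle_decides:
  "decides_one_sided (program (If (Sub (Reg 1) (Reg 0)) (Set 3 (Add (Reg 0) (Const 1))) (Set 3 (Reg 1)) ;;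
      Set 4 (Const 1))) (input_state n E F k)
    (k_cycle {..<n} E k) (5 ^ forest_depth {..<n} F * tbound n) (sbound (n + floorlog 2 k))"
  by (rule program_decides[where pf = 0 and ks = "if n < k then n + 1 else k" and mk = 1 and ans = 0])
    (use small_less_B in \<open>auto simp: k_cycle_cover input_state_def\<close>)

lemma k_path_decides:
  "decides_one_sided (program (Set 2 (Const 1) ;;
      If (Sub (Reg 1) (Reg 0)) (Set 3 (Add (Reg 0) (Const 2))) (Set 3 (Add (Reg 1) (Const 1))) ;; Set 4 (Const 1) ;;
      If (absd (Reg 1) (Const 1)) Nop (If (Reg 0) (Set 5 (Const 1)) Nop))) (input_state n E F k)
    (k_path {..<n} E k) (5 ^ forest_depth {..<n} F * tbound n) (sbound (n + floorlog 2 k))"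
  by (rule program_decides[where pf = 1 and ks = "if n < k then n + 2 else k + 1" and mk = 1 and ans = "of_bool (k = 1 \<and> n \<noteq> 0)"])
    (use small_less_B in \<open>auto simp: k_path_cover input_state_def\<close>)

lemma min_cycle_cover_decides:
  "decides_one_sided (program (Set 3 (Reg 0) ;; If (Sub (Reg 1) (Reg 0)) (Set 4 (Reg 0)) (Set 4 (Reg 1))))
    (input_state n E F k) (min_cycle_cover {..<n} E k)
    (5 ^ forest_depth {..<n} F * tbound n) (sbound (n + floorlog 2 k))"
  by (rule program_decides[where pf = 0 and ks = n and mk = "if n < k then n else k" and ans = 0])
    (use small_less_B in \<open>auto simp: min_cycle_cover_cover input_state_def\<close>)

end

lemma decided_by_program:
  fixes Q :: "nat problem"
  assumes "\<And>n E F k. forest_input n E F \<Longrightarrow> decides_one_sided P (input_state n E F k) (Q {..<n} E k)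
    (5 ^ forest_depth {..<n} F * tbound n) (sbound (n + floorlog 2 k))"
  shows "\<exists>(P :: com) (p :: nat poly) (q :: nat poly).
           \<forall>(n :: nat) (E :: nat set set) (F :: (nat \<times> nat) set) (k :: nat).
             simple_graph {..<n} E \<longrightarrow> elimination_forest {..<n} E F \<longrightarrow>
             decides_one_sided P (input_state n E F k) (Q {..<n} E k)
               (5 ^ forest_depth {..<n} F * poly p n)
               (poly q (n + floorlog 2 k))"
  by (intro exI[of _ P] exI[of _ "tbound [:0, 1:]"] exI[of _ "sbound [:0, 1:]"])
    (unfold poly_tbound poly_sbound, blast intro: assms forest_input.intro)

theorem theorem1:
  fixes Q :: "nat problem"
  assumes "Q \<in> {hamiltonian_cycle, hamiltonian_path, k_cycle, k_path, min_cycle_cover}"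
  shows "\<exists>(P :: com) (p :: nat poly) (q :: nat poly).
           \<forall>(n :: nat) (E :: nat set set) (F :: (nat \<times> nat) set) (k :: nat).
             simple_graph {..<n} E \<longrightarrow> elimination_forest {..<n} E F \<longrightarrow>
             decides_one_sided P (input_state n E F k) (Q {..<n} E k)
               (5 ^ forest_depth {..<n} F * poly p n)
               (poly q (n + floorlog 2 k))"
proof -
  consider "Q = hamiltonian_cycle" | "Q = hamiltonian_path" | "Q = k_cycle" | "Q = k_path" | "Q = min_cycle_cover"
    using assms by blast
  then show ?thesis
    by cases (simp_all only:, rule decided_by_program, erule forest_input.hamiltonian_cycle_decides,
      rule decided_by_program, erule forest_input.hamiltonian_path_decides,
      rule decided_by_program, erule forest_input.k_cycle_decides,
      rule decided_by_program, erule forest_input.k_path_decides,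
      rule decided_by_program, erule forest_input.min_cycle_cover_decides)
qed

end
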